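(* Let $$\Omega_{\mathrm{RB}}(\lambda;t)=\sum_{H}\frac{\lambda^{|V_H|}\,\omega_{RB,c}(H)}{\sigma(H)}\,I_{\mathrm{color}}(H;t),$$ the sum running over isomorphism classes of finite connected acyclic RB graphs $H$. Then $$\exp_\star\bigl(\Omega_{\mathrm{RB}}(\lambda;t)\bigr)=U(\lambda;t),$$ where $U(\lambda;t)$ is the Dyson series. Consequently, $\Omega_{\mathrm{RB}}(\lambda;t)=\Omega(\lambda;t)$, where $\Omega(\lambda;t)$ is the Magnusian.
   Context: Graphs. A (finite) quiver $G=(V_G,E_G,\rho_G)$ has finite sets $V_G,E_G$ and $\rho_G:E_G\to V_G\times V_G$, where $\rho_G(\varepsilon)=(u,v)$ is written $\varepsilon:u\to v$; parallel edges, directed cycles and tadpoles ($u\to u$) are allowed; acyclic means no directed cycle (tadpoles count as directed cycles); connected means nonempty with connected underlying undirected graph. Edges carry parameters $\beta_\varepsilon$, kept by edges surviving in subquivers/contractions; $\beta_{\varepsilon,\pm}=(\beta_\varepsilon\pm1)/2$. A cut-subquiver $H\preceq G$ has vertex set $V_G$ and any $E_H\subseteq E_G$; the contraction $G/H$ has vertices the connected components of $H$ and edges $E_G\setminus E_H$ with induced incidences. For tadpole-free $G$, $e_0(G)=|\operatorname{LE}(G)|/|V_G|!$ if $G$ is acyclic ($\operatorname{LE}(G)$ = linear extensions of the partial order induced by the edges), $e_0(G)=0$ otherwise; in general $e(G;\boldsymbol\beta)=\bigl(\prod_{\varepsilon\text{ tadpole}}(-\beta_{\varepsilon,-})\bigr)e_0(G_{\mathrm{pruned}})$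 with $G_{\mathrm{pruned}}$ obtained by deleting all tadpoles. $\omega$ is the unique function on quivers with $\sum_{H\preceq G}\omega(H)e(G/H)=\epsilon(G)$, $\epsilon(G)=1$ if $E_G=\emptyset$ and $0$ otherwise; $\omega_c(G)=\omega(G)$ for connected $G$, and $\omega_c(G)=0$ otherwise. An RB graph is a quiver with each edge colored red or blue; $b(G)$ is the number of blue edges. Put $\omega_{RB,c}(G)=(-1)^{b(G)}\omega_c(G;\boldsymbol\beta)$ at $\beta_\varepsilon=1$ on red and $\beta_\varepsilon=-1$ on blue edges. $\sigma(G)$ is the number of automorphisms of $G$: pairs of bijections of $V_G$ and $E_G$ preserving source, target and color of each edge. Operators. Normally ordered oscillator symbols are (power series) functions of commuting variables $a,a^\dagger$, with star product $F\star G=\sum_{r\ge0}\frac1{r!}\frac{\partial^rF}{\partial a^r}\frac{\partial^rG}{\partial(a^\dagger)^r}$; juxtaposition or $\prod$ denotes the ordinary commutative product of symbols. Given a function $f(t)$ with $\bar f(t)$ its complex conjugate, let $A(t)=e^{f(t)a^\dagger}e^{\bar f(t)a}$ and, for time variables $t_i$, $W_{ij}=\bar f(t_i)f(t_j)$, and $\theta_{ij}=\theta(t_i-t_j)$, where $\theta(x)=1$ for $x>0$ and $\theta(x)=0$ for $x<0$ (the value at $0$ is irrelevant). For an acyclic RB graph $G$, $$I_{\mathrm{color}}(G;t)=\int_{[0,t]^{|V_G|}}\Bigl(\prod_{\varepsilon:j\to i\text{ blue}}W_{ij}\theta_{ij}\Bigr)\Bigl(\prod_{\varepsilon:j\to i\text{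 red}}W_{ji}\theta_{ij}\Bigr)\Bigl(\prod_{v\in V_G}A(t_v)\Bigr)\prod_{v\in V_G}dt_v .$$ The Dyson series is $U(\lambda;t)=\mathbf 1+\sum_{n\ge1}\lambda^n\int_{0<t_n<\cdots<t_1<t}A(t_1)\star\cdots\star A(t_n)\,dt_1\cdots dt_n$, with $\lambda$ a formal parameter; $\exp_\star$ and $\log_\star$ are the formal exponential and logarithm for the product $\star$ (extended $\lambda$-linearly), and the Magnusian is $\Omega(\lambda;t)=\sum_{n\geq1}\lambda^n\Omega_n(t)=\log_\star U(\lambda;t)$, i.e. $U=\exp_\star(\Omega)$. Everything is understood formally, without convergence assumptions: identities are between formal power series in $\lambda$ with coefficients in a suitable completion of the symbol algebra, and infinite sums over graphs with a fixed number of vertices are expansions in the number of contractions $W$ (number of edges). *)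

theory Defs
  imports
    "HOL-Analysis.Analysis"
    "HOL-Computational_Algebra.Formal_Power_Series"
    "HOL-Combinatorics.Permutations"
    "Graph_Theory.Digraph_Component"
begin

unbundle no vec_syntax
unbundle fps_syntax

section \<open>Quivers\<close>

text \<open>
  A finite quiver is a \<^locale>\<open>fin_digraph\<close> of the Graph Theory entry (parallel arcs and loops are
  allowed there).  Acyclicity is \<^const>\<open>acyclic\<close> of the arc relation, so that a
  tadpole counts as a directed cycle.  \<open>Digraph_Component.connected\<close> is connectedness of the
  underlying undirected graph and includes nonemptiness.
\<close>

definition cut_subquiver :: "('v, 'e) pre_digraph \<Rightarrow> 'e set \<Rightarrow> ('v, 'e) pre_digraph" where
  "cut_subquiver G S = G\<lparr>arcs := S\<rparr>"

definition weak_component :: "('v, 'e) pre_digraph \<Rightarrow> 'v \<Rightarrow> 'v set" where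
  "weak_component H u = {v. u \<rightarrow>\<^sup>*\<^bsub>mk_symmetric H\<^esub> v}"

definition contract :: "('v, 'e) pre_digraph \<Rightarrow> 'e set \<Rightarrow> ('v set, 'e) pre_digraph" where
  "contract G S =
     \<lparr>verts = weak_component (cut_subquiver G S) ` verts G,
      arcs = arcs G - S,
      tail = (\<lambda>e. weak_component (cut_subquiver G S) (tail G e)),
      head = (\<lambda>e. weak_component (cut_subquiver G S) (head G e))\<rparr>"

definition tadpoles :: "('v, 'e) pre_digraph \<Rightarrow> 'e set" where
  "tadpoles G = {e \<in> arcs G. tail G e = head G e}"

definition linear_extensions :: "('v, 'e) pre_digraph \<Rightarrow> ('v \<times> 'v) set set" where
  "linear_extensions G = {r. linear_order_on (verts G) r \<and> (arcs_ends G)\<^sup>+ \<subseteq> r}"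

definition e0 :: "('v, 'e) pre_digraph \<Rightarrow> real" where
  "e0 G = (if acyclic (arcs_ends G)
           then real (card (linear_extensions G)) / fact (card (verts G)) else 0)"

definition beta_minus :: "('e \<Rightarrow> real) \<Rightarrow> 'e \<Rightarrow> real" where
  "beta_minus \<beta> e = (\<beta> e - 1) / 2"

definition e_quiver :: "('e \<Rightarrow> real) \<Rightarrow> ('v, 'e) pre_digraph \<Rightarrow> real" where
  "e_quiver \<beta> G = (\<Prod>e\<in>tadpoles G. - beta_minus \<beta> e) * e0 (cut_subquiver G (arcs G - tadpoles G))"

definition counit :: "('v, 'e) pre_digraph \<Rightarrow> real" where
  "counit G = (if arcs G = {} then 1 else 0)"

text \<open>
  The parameters are fixed once for the whole arc type, so arcs keep them in cut-subquivers and
  contractions.  The value \<open>0\<close> outside finite quivers is only there to make \<open>w\<close> unique as a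
  function on the record type.
\<close>

definition is_omega ::
  "('e \<Rightarrow> real) \<Rightarrow> (('v, 'e) pre_digraph \<Rightarrow> real) \<Rightarrow> bool" where
  "is_omega \<beta> w \<longleftrightarrow>
     (\<forall>G. fin_digraph G \<longrightarrow>
        (\<Sum>S\<in>Pow (arcs G). w (cut_subquiver G S) * e_quiver \<beta> (contract G S)) = counit G) \<and>
     (\<forall>G. \<not> fin_digraph G \<longrightarrow> w G = 0)"

definition omega :: "('e \<Rightarrow> real) \<Rightarrow> ('v, 'e) pre_digraph \<Rightarrow> real" where
  "omega \<beta> = (THE w. is_omega \<beta> w)"

definition omega_c :: "('e \<Rightarrow> real) \<Rightarrow> ('v, 'e) pre_digraph \<Rightarrow> real" where
  "omega_c \<beta> G = (if Digraph_Component.connected G then omega \<beta> G else 0)"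

subsection \<open>Existence and uniqueness of \<open>\<omega>\<close>\<close>

lemma e_quiver_contract_all_nonzero:
  assumes "fin_digraph G"
  shows "e_quiver \<beta> (contract G (arcs G)) \<noteq> 0"
proof -
  let ?Q = "contract G (arcs G)"
  have fin: "finite (verts ?Q)"
    using assms by (simp add: contract_def fin_digraph.finite_verts)
  have no: "arcs ?Q = {}" by (simp add: contract_def)
  have cutQ: "cut_subquiver ?Q (arcs ?Q - tadpoles ?Q) = ?Q"
    by (simp add: cut_subquiver_def contract_def)
  have ends: "arcs_ends ?Q = {}" by (simp add: arcs_ends_def no)
  have LE: "linear_extensions ?Q = {r. linear_order_on (verts ?Q) r}"
    by (simp add: linear_extensions_def ends)
  have "finite (linear_extensions ?Q)"
    by (rule finite_subset[of _ "Pow (verts ?Q \<times> verts ?Q)"])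
       (use fin in \<open>auto simp: LE order_on_defs\<close>)
  moreover have "linear_extensions ?Q \<noteq> {}"
  proof -
    obtain r where "well_order_on (verts ?Q) r" using well_order_on by blast
    then show ?thesis unfolding LE well_order_on_def by blast
  qed
  ultimately have "e0 ?Q \<noteq> 0"
    by (simp add: e0_def ends acyclic_def)
  then show ?thesis unfolding e_quiver_def cutQ by (simp add: tadpoles_def no)
qed

lemma fin_digraph_cut_subquiver: "fin_digraph G \<Longrightarrow> S \<subseteq> arcs G \<Longrightarrow> fin_digraph (cut_subquiver G S)"
  unfolding fin_digraph_def fin_digraph_axioms_def wf_digraph_def cut_subquiver_def
  by (auto intro: finite_subset)

lemma arcs_cut_subquiver [simp]: "arcs (cut_subquiver G S) = S"
  by (simp add: cut_subquiver_def)

function omega_rec :: "('e \<Rightarrow> real) \<Rightarrow> ('v, 'e) pre_digraph \<Rightarrow> real" where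
  "omega_rec \<beta> G =
     (if fin_digraph G
      then (counit G - (\<Sum>S\<in>Pow (arcs G) - {arcs G}.
              omega_rec \<beta> (cut_subquiver G S) * e_quiver \<beta> (contract G S)))
             / e_quiver \<beta> (contract G (arcs G))
      else 0)"
  by pat_completeness auto
termination
  by (relation "Wellfounded.measure (\<lambda>(\<beta>, G). card (arcs G))")
     (auto intro!: psubset_card_mono simp: fin_digraph.finite_arcs)

declare omega_rec.simps [simp del]

lemma sum_Pow_arcs:
  assumes "fin_digraph G"
  shows "(\<Sum>S\<in>Pow (arcs G). w (cut_subquiver G S) * e_quiver \<beta> (contract G S)) =
    w G * e_quiver \<beta> (contract G (arcs G)) +
    (\<Sum>S\<in>Pow (arcs G) - {arcs G}. w (cut_subquiver G S) * e_quiver \<beta> (contract G S))"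
proof -
  have "cut_subquiver G (arcs G) = G" by (simp add: cut_subquiver_def)
  then show ?thesis
    using assms by (subst sum.remove[of _ "arcs G"]) (auto simp: fin_digraph.finite_arcs)
qed

lemma is_omega_unique:
  assumes "is_omega \<beta> w"
  shows "w G = omega_rec \<beta> G"
proof (induction "card (arcs G)" arbitrary: G rule: less_induct)
  case less
  show ?case
  proof (cases "fin_digraph G")
    case True
    have IH: "w (cut_subquiver G S) = omega_rec \<beta> (cut_subquiver G S)" if "S \<in> Pow (arcs G) - {arcs G}" for S
      by (rule less) (use that True in \<open>auto intro!: psubset_card_mono simp: fin_digraph.finite_arcs\<close>)
    have eq: "(\<Sum>S\<in>Pow (arcs G) - {arcs G}. w (cut_subquiver G S) * e_quiver \<beta> (contract G S)) =
        (\<Sum>S\<in>Pow (arcs G) - {arcs G}. omega_rec \<beta> (cut_subquiver G S) * e_quiver \<beta> (contract G S))"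
      by (intro sum.cong refl arg_cong2[where f = "(*)"] IH)
    have "w G * e_quiver \<beta> (contract G (arcs G)) +
        (\<Sum>S\<in>Pow (arcs G) - {arcs G}. w (cut_subquiver G S) * e_quiver \<beta> (contract G S)) = counit G"
      using assms True sum_Pow_arcs[OF True, of w \<beta>] unfolding is_omega_def by simp
    then have "w G * e_quiver \<beta> (contract G (arcs G)) = counit G -
        (\<Sum>S\<in>Pow (arcs G) - {arcs G}. omega_rec \<beta> (cut_subquiver G S) * e_quiver \<beta> (contract G S))"
      by (simp add: eq algebra_simps)
    then show ?thesis
      using True e_quiver_contract_all_nonzero[OF True, of \<beta>]
      by (subst omega_rec.simps) (simp add: field_simps)
  next
    case False
    then show ?thesis using assms by (simp add: is_omega_def omega_rec.simps)
  qed
qed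

lemma is_omega_omega_rec:
  fixes \<beta> :: "'e \<Rightarrow> real"
  shows "is_omega \<beta> (omega_rec \<beta> :: ('v, 'e) pre_digraph \<Rightarrow> real)"
  unfolding is_omega_def
proof (intro conjI allI impI)
  fix G :: "('v, 'e) pre_digraph"
  assume G: "fin_digraph G"
  have "omega_rec \<beta> G * e_quiver \<beta> (contract G (arcs G)) = counit G -
        (\<Sum>S\<in>Pow (arcs G) - {arcs G}. omega_rec \<beta> (cut_subquiver G S) * e_quiver \<beta> (contract G S))"
    using G e_quiver_contract_all_nonzero[OF G, of \<beta>]
    by (subst omega_rec.simps) simp
  then show "(\<Sum>S\<in>Pow (arcs G). omega_rec \<beta> (cut_subquiver G S) * e_quiver \<beta> (contract G S)) = counit G"
    using sum_Pow_arcs[OF G, of "omega_rec \<beta>" \<beta>] by simp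
qed (simp add: omega_rec.simps)

lemma ex1_is_omega: "\<exists>!w. is_omega \<beta> w"
  using is_omega_omega_rec is_omega_unique by (metis ext)

lemma is_omega_omega: "is_omega \<beta> (omega \<beta>)"
  unfolding omega_def by (rule theI'[OF ex1_is_omega])

section \<open>RB graphs\<close>

datatype color = Red | Blue

type_synonym ('v, 'e) rb_graph = "('v, 'e) pre_digraph \<times> ('e \<Rightarrow> color)"

definition arcs_of_color :: "color \<Rightarrow> ('v, 'e) rb_graph \<Rightarrow> 'e set" where
  "arcs_of_color k H = {e \<in> arcs (fst H). snd H e = k}"

definition omega_RB_c :: "('v, 'e) rb_graph \<Rightarrow> real" where
  "omega_RB_c H = (-1) ^ card (arcs_of_color Blue H) *
     omega_c (\<lambda>e. case snd H e of Red \<Rightarrow> 1 | Blue \<Rightarrow> - 1) (fst H)"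

definition is_rb_isomorphism ::
  "('v \<Rightarrow> 'w) \<Rightarrow> ('e \<Rightarrow> 'd) \<Rightarrow> ('v, 'e) rb_graph \<Rightarrow> ('w, 'd) rb_graph \<Rightarrow> bool" where
  "is_rb_isomorphism \<phi> \<psi> H K \<longleftrightarrow>
     bij_betw \<phi> (verts (fst H)) (verts (fst K)) \<and> bij_betw \<psi> (arcs (fst H)) (arcs (fst K)) \<and>
     (\<forall>e\<in>arcs (fst H). tail (fst K) (\<psi> e) = \<phi> (tail (fst H) e) \<and>
                       head (fst K) (\<psi> e) = \<phi> (head (fst H) e) \<and>
                       snd K (\<psi> e) = snd H e)"

definition rb_iso :: "(('v, 'e) rb_graph \<times> ('v, 'e) rb_graph) set" where
  "rb_iso = {(H, K). fin_digraph (fst H) \<and> fin_digraph (fst K) \<and>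
                     (\<exists>\<phi> \<psi>. is_rb_isomorphism \<phi> \<psi> H K)}"

definition sigma_aut :: "('v, 'e) rb_graph \<Rightarrow> nat" where
  "sigma_aut H = card {(\<phi>, \<psi>). \<phi> permutes verts (fst H) \<and> \<psi> permutes arcs (fst H) \<and>
                        is_rb_isomorphism \<phi> \<psi> H H}"

text \<open>
  Every finite RB graph is isomorphic to one whose vertices and arcs are natural numbers, so the
  isomorphism classes are represented over \<^typ>\<open>nat\<close>.  For given numbers of vertices
  and arcs there are finitely many of them.
\<close>

definition rb_classes :: "nat \<Rightarrow> nat \<Rightarrow> (nat, nat) rb_graph set set" where
  "rb_classes n m =
     {H. fin_digraph (fst H) \<and> Digraph_Component.connected (fst H) \<and>
         acyclic (arcs_ends (fst H)) \<and> card (verts (fst H)) = n \<and> card (arcs (fst H)) = m}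
     // rb_iso"

section \<open>Symbols and star product\<close>

text \<open>
  A symbol is a formal power series in \<open>a\<close> (outer variable) and \<open>a\<dagger>\<close> (inner variable).
  On unrestricted symbols the sum defining \<open>\<star>\<close> need not be finite in each coefficient, so
  symbols are completed with respect to the number of contractions: a graded symbol is a formal sum
  of symbols \<open>F $ m\<close>, where \<open>m\<close> counts contractions, and the \<open>r\<close>-th term
  \<open>1/r! \<partial>\<^sup>rF/\<partial>a\<^sup>r \<partial>\<^sup>rG/\<partial>(a\<dagger>)\<^sup>r\<close> of the star product, which makes \<open>r\<close> contractions,
  raises the degree by \<open>r\<close>.  A symbol series is a formal power series in \<open>\<lambda>\<close> over graded symbols.
\<close>

type_synonym symbol = "complex fps fps"
type_synonym graded_symbol = "symbol fps"
type_synonym symbol_series = "graded_symbol fps"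

definition sconst :: "complex \<Rightarrow> symbol" where
  "sconst c = fps_const (fps_const c)"

definition exp_a :: "complex \<Rightarrow> symbol" where
  "exp_a c = Abs_fps (\<lambda>j. fps_const (fps_exp c $ j))"

definition exp_adag :: "complex \<Rightarrow> symbol" where
  "exp_adag c = fps_const (fps_exp c)"

definition deriv_a :: "symbol \<Rightarrow> symbol" where
  "deriv_a F = fps_deriv F"

definition deriv_adag :: "symbol \<Rightarrow> symbol" where
  "deriv_adag F = Abs_fps (\<lambda>j. fps_deriv (F $ j))"

definition star :: "graded_symbol \<Rightarrow> graded_symbol \<Rightarrow> graded_symbol" (infixl \<open>\<star>\<close> 70) where
  "F \<star> G = Abs_fps (\<lambda>m. \<Sum>r\<le>m. \<Sum>i\<le>m - r.
     sconst (1 / fact r) * (deriv_a ^^ r) (F $ i) * (deriv_adag ^^ r) (G $ (m - r - i)))"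

definition star_series :: "symbol_series \<Rightarrow> symbol_series \<Rightarrow> symbol_series"
    (infixl \<open>\<star>\<^sub>\<lambda>\<close> 70) where
  "F \<star>\<^sub>\<lambda> G = Abs_fps (\<lambda>n. \<Sum>i\<le>n. (F $ i) \<star> (G $ (n - i)))"

primrec star_power :: "symbol_series \<Rightarrow> nat \<Rightarrow> symbol_series" where
  "star_power F 0 = 1"
| "star_power F (Suc k) = F \<star>\<^sub>\<lambda> star_power F k"

text \<open>
  For \<open>F $ 0 = 0\<close> the \<open>k\<close>-th star power has no terms of \<open>\<lambda>\<close>-degree below \<open>k\<close>, so truncating
  the exponential and logarithm series at \<open>k = n\<close> gives the exact coefficient of \<open>\<lambda>\<^sup>n\<close>.
  The exponential is only meant for \<open>F $ 0 = 0\<close> and the logarithm for \<open>F $ 0 = 1\<close>.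
\<close>

definition exp_star :: "symbol_series \<Rightarrow> symbol_series" where
  "exp_star F = Abs_fps (\<lambda>n. \<Sum>k\<le>n. fps_const (sconst (1 / fact k)) * (star_power F k $ n))"

definition log_star :: "symbol_series \<Rightarrow> symbol_series" where
  "log_star F = Abs_fps (\<lambda>n. \<Sum>k=1..n.
     fps_const (sconst ((-1) ^ (k + 1) / of_nat k)) * (star_power (F - 1) k $ n))"

section \<open>Operators and integrals\<close>

definition A_symbol :: "(real \<Rightarrow> complex) \<Rightarrow> real \<Rightarrow> symbol" where
  "A_symbol f s = exp_adag (f s) * exp_a (cnj (f s))"

definition W_contraction :: "(real \<Rightarrow> complex) \<Rightarrow> real \<Rightarrow> real \<Rightarrow> complex" where
  "W_contraction f s s' = cnj (f s) * f s'"

definition theta :: "real \<Rightarrow> complex" where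
  "theta x = (if x > 0 then 1 else 0)"

definition symbol_integral :: "'x measure \<Rightarrow> 'x set \<Rightarrow> ('x \<Rightarrow> symbol) \<Rightarrow> symbol" where
  "symbol_integral M S F = Abs_fps (\<lambda>j. Abs_fps (\<lambda>k. LINT x:S|M. F x $ j $ k))"

definition I_color :: "(real \<Rightarrow> complex) \<Rightarrow> real \<Rightarrow> ('v, 'e) rb_graph \<Rightarrow> symbol" where
  "I_color f t H = (let G = fst H in
     symbol_integral (\<Pi>\<^sub>M v\<in>verts G. lborel) (\<Pi>\<^sub>E v\<in>verts G. {0..t})
       (\<lambda>x. sconst (\<Prod>e\<in>arcs_of_color Blue H.
               W_contraction f (x (head G e)) (x (tail G e)) * theta (x (head G e) - x (tail G e))) *
            sconst (\<Prod>e\<in>arcs_of_color Red H.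
               W_contraction f (x (tail G e)) (x (head G e)) * theta (x (head G e) - x (tail G e))) *
            (\<Prod>v\<in>verts G. A_symbol f (x v))))"

text \<open>A graph with \<open>n\<close> vertices and \<open>m\<close> arcs contributes to \<open>\<lambda>\<^sup>n\<close> with \<open>m\<close> contractions.\<close>

definition Omega_RB :: "(real \<Rightarrow> complex) \<Rightarrow> real \<Rightarrow> symbol_series" where
  "Omega_RB f t = Abs_fps (\<lambda>n. Abs_fps (\<lambda>m. \<Sum>C\<in>rb_classes n m.
     let H = (SOME H. H \<in> C)
     in sconst (complex_of_real (omega_RB_c H / real (sigma_aut H))) * I_color f t H))"

definition time_ordered :: "real \<Rightarrow> nat \<Rightarrow> (nat \<Rightarrow> real) set" where
  "time_ordered t n = {x \<in> {1..n} \<rightarrow>\<^sub>E UNIV.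
     0 < x n \<and> (\<forall>i\<in>{1..<n}. x (i + 1) < x i) \<and> x 1 < t}"

definition Dyson :: "(real \<Rightarrow> complex) \<Rightarrow> real \<Rightarrow> symbol_series" where
  "Dyson f t = Abs_fps (\<lambda>n. if n = 0 then 1 else
     Abs_fps (\<lambda>m. symbol_integral (\<Pi>\<^sub>M i\<in>{1..n}. lborel) (time_ordered t n)
       (\<lambda>x. foldr (\<star>) (map (\<lambda>i. fps_const (A_symbol f (x i))) [1..<n + 1]) 1 $ m)))"

definition Magnusian :: "(real \<Rightarrow> complex) \<Rightarrow> real \<Rightarrow> symbol_series" where
  "Magnusian f t = log_star (Dyson f t)"

end

theory Submission
  imports Defs "HOL-Combinatorics.Multiset_Permutations"
begin

text \<open>
  Expand everything in labelled RB graphs.  A symbol series is described by a kernel, which assigns to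
  finite sets of vertex labels and arc labels an integrand in the times of the vertices; the star
  product of two series has the kernel that distributes the labels over the two factors and over the
  contractions between them (\<open>ser_conv\<close>).  By orbit counting \<^term>\<open>Omega_RB\<close> is the series of the kernel
  that sums over all labelled graphs with coefficient \<^term>\<open>omega_RB_c\<close> (\<open>Omega_RB_eq_ser\<close>); graphs
  with directed cycles may be included because their integrands vanish.  The Dyson series is the series
  of the kernel that sums over all labelled graphs with only blue arcs (\<open>Dyson_eq_ser\<close>).

  In a star power of \<^term>\<open>Omega_RB\<close> a contraction of a vertex \<open>i\<close> of an earlier factor with a vertex \<open>j\<close>
  of a later factor contributes \<open>W\<^sub>i\<^sub>j\<close>.  At different times \<open>W\<^sub>i\<^sub>j = W\<^sub>i\<^sub>j \<theta>\<^sub>i\<^sub>j + W\<^sub>i\<^sub>j \<theta>\<^sub>j\<^sub>i\<close>, a blue arc from \<open>j\<close> to \<open>i\<close>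
  plus a red arc from \<open>i\<close> to \<open>j\<close>.  Hence the coefficient of a labelled graph \<open>G\<close> in the star
  exponential is a sum over ordered partitions of its vertices into connected blocks such that red arcs
  between blocks go forward and blue arcs go backward.  Connected partitions correspond to the
  cut-subquivers \<open>H\<close> for which \<open>G/H\<close> has no tadpoles, \<open>\<omega>\<close> is multiplicative over components
  (\<open>omega_disjoint_union\<close>), and the average over the orderings of the blocks is \<open>e\<close> of \<open>G/H\<close> with its blue
  arcs reversed.

  Reversing an arc replaces the indicator \<open>\<chi>\<close> of its direction by \<open>1 - \<chi>\<close>.  At \<open>\<beta> = 1\<close> on red and
  \<open>\<beta> = -1\<close> on blue arcs the tadpole factors of \<open>e\<close> are \<open>\<chi> = 0\<close> and \<open>\<chi> = 1\<close>, so the same rule assigns weight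
  zero to contractions with tadpoles.  Expanding the product over the blue arcs turns the coefficient
  into \<open>\<Sum>\<^sub>K (-1)\<^bsup>b(K)\<^esup> \<Sum>\<^sub>H \<omega>(H) e(K/H)\<close>, where \<open>K\<close> runs over the cut-subquivers of \<open>G\<close> with all
  red arcs and \<open>H\<close> over those of \<open>K\<close>.  The inner sum is \<open>\<epsilon>(K)\<close>, so the coefficient is one if \<open>G\<close> has
  no red arcs and zero otherwise (\<open>sum_ordered_partitions\<close>).  This is the kernel of the Dyson series.

  The second claim follows because the star product is associative, so that identities between power
  series in one variable carry over and \<^const>\<open>log_star\<close> inverts \<^const>\<open>exp_star\<close> (\<open>log_star_exp_star\<close>).
\<close>

section \<open>The star product algebra\<close>

lemma sconst_0 [simp]: "sconst 0 = 0" and sconst_1 [simp]: "sconst 1 = 1"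
  by (simp_all add: sconst_def)

lemma sconst_add: "sconst (c + d) = sconst c + sconst d"
  by (simp add: sconst_def)

lemma sconst_mult: "sconst (c * d) = sconst c * sconst d"
  by (simp add: sconst_def)

lemma sconst_sum: "sconst (\<Sum>i\<in>A. c i) = (\<Sum>i\<in>A. sconst (c i))"
  by (induction A rule: infinite_finite_induct) (auto simp: sconst_add)

lemma sum_fps_const: "fps_const (\<Sum>i\<in>A. c i) = (\<Sum>i\<in>A. fps_const (c i))"
  by (induction A rule: infinite_finite_induct) (auto simp flip: fps_const_add)

lemma sconst_of_nat: "sconst (of_nat n) = of_nat n"
  by (induction n) (auto simp: sconst_add)

lemma sconst_mult_nth [simp]: "(sconst c * F) $ j $ k = c * F $ j $ k"
  by (simp add: sconst_def)

lemma deriv_a_nth: "deriv_a F $ j $ k = of_nat (Suc j) * F $ Suc j $ k"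
  by (simp add: deriv_a_def fps_of_nat [symmetric] del: of_nat_Suc)

lemma deriv_adag_nth: "deriv_adag F $ j $ k = of_nat (Suc k) * F $ j $ Suc k"
  by (simp add: deriv_adag_def)

lemma symbol_eqI: "(\<And>j k. F $ j $ k = G $ j $ k) \<Longrightarrow> F = (G :: symbol)"
  by (simp add: fps_eq_iff)

lemma deriv_a_add: "deriv_a (F + G) = deriv_a F + deriv_a G"
  by (simp add: deriv_a_def)

lemma deriv_a_mult: "deriv_a (F * G) = deriv_a F * G + F * deriv_a G"
  by (simp add: deriv_a_def)

lemma deriv_adag_add: "deriv_adag (F + G) = deriv_adag F + deriv_adag G"
  by (rule symbol_eqI) (simp add: deriv_adag_nth algebra_simps)

lemma deriv_adag_mult: "deriv_adag (F * G) = deriv_adag F * G + F * deriv_adag G"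
  by (rule fps_ext)
     (simp add: deriv_adag_def fps_mult_nth fps_deriv_sum sum.distrib [symmetric] add.commute)

lemma deriv_a_sconst: "deriv_a (sconst c) = 0"
  by (simp add: deriv_a_def sconst_def)

lemma deriv_adag_sconst: "deriv_adag (sconst c) = 0"
  by (rule symbol_eqI) (simp add: deriv_adag_nth sconst_def)

lemma deriv_commute: "deriv_a (deriv_adag F) = deriv_adag (deriv_a F)"
  by (rule symbol_eqI) (simp add: deriv_adag_nth deriv_a_nth)

text \<open>An additive map that satisfies the Leibniz rule.\<close>

locale derivation =
  fixes D :: "symbol \<Rightarrow> symbol"
  assumes add: "D (F + G) = D F + D G"
    and mult: "D (F * G) = D F * G + F * D G"
    and sconst: "D (sconst c) = 0"
begin

lemma zero: "D 0 = 0"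
  using sconst[of 0] by simp

lemma scale: "D (sconst c * F) = sconst c * D F"
  by (simp add: mult sconst)

lemma pow_add: "(D ^^ r) (F + G) = (D ^^ r) F + (D ^^ r) G"
  by (induction r) (auto simp: add)

lemma pow_zero: "(D ^^ r) 0 = 0"
  by (induction r) (auto simp: zero)

lemma pow_sum: "(D ^^ r) (\<Sum>i\<in>A. F i) = (\<Sum>i\<in>A. (D ^^ r) (F i))"
  by (induction A rule: infinite_finite_induct) (auto simp: pow_add pow_zero)

lemma pow_scale: "(D ^^ r) (sconst c * F) = sconst c * (D ^^ r) F"
  by (induction r) (auto simp: scale)

lemma Leibniz_divided:
  "sconst (1 / fact n) * (D ^^ n) (F * G) =
     (\<Sum>k\<le>n. (sconst (1 / fact k) * (D ^^ k) F) * (sconst (1 / fact (n - k)) * (D ^^ (n - k)) G))"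
proof (induction n)
  case 0
  show ?case by simp
next
  case (Suc n)
  define d where "d k F = sconst (1 / fact k) * (D ^^ k) F" for k F
  have Dd: "D (d k F) = sconst (of_nat (Suc k)) * d (Suc k) F" for k F
  proof -
    have *: "(1 / fact k :: complex) = of_nat (Suc k) * (1 / fact (Suc k))"
      by (simp add: field_simps del: of_nat_Suc)
    show ?thesis
      unfolding d_def mult.assoc[symmetric] sconst_mult[symmetric] *[symmetric]
      by (simp add: scale)
  qed
  have IH: "d n (F * G) = (\<Sum>k\<le>n. d k F * d (n - k) G)"
    using Suc by (simp add: d_def)
  have "sconst (of_nat (Suc n)) * d (Suc n) (F * G) = D (d n (F * G))"
    by (simp add: Dd)
  also have "\<dots> = (\<Sum>k\<le>n. D (d k F * d (n - k) G))"
    unfolding IH using pow_sum[of 1] by simp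
  also have "\<dots> = (\<Sum>k\<le>n. sconst (of_nat (Suc k)) * (d (Suc k) F * d (Suc n - Suc k) G)) +
                  (\<Sum>k\<le>n. sconst (of_nat (Suc n - k)) * (d k F * d (Suc n - k) G))"
    unfolding sum.distrib[symmetric]
  proof (rule sum.cong)
    fix k assume "k \<in> {..n}"
    then show "D (d k F * d (n - k) G) =
       sconst (of_nat (Suc k)) * (d (Suc k) F * d (Suc n - Suc k) G) +
       sconst (of_nat (Suc n - k)) * (d k F * d (Suc n - k) G)"
      by (simp only: mult Dd) (simp add: Suc_diff_le algebra_simps del: of_nat_Suc)
  qed simp
  also have "(\<Sum>k\<le>n. sconst (of_nat (Suc k)) * (d (Suc k) F * d (Suc n - Suc k) G)) =
      (\<Sum>k\<le>Suc n. sconst (of_nat k) * (d k F * d (Suc n - k) G))"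
    by (simp only: sum.atMost_Suc_shift) simp
  also have "(\<Sum>k\<le>n. sconst (of_nat (Suc n - k)) * (d k F * d (Suc n - k) G)) =
      (\<Sum>k\<le>Suc n. sconst (of_nat (Suc n - k)) * (d k F * d (Suc n - k) G))"
    by simp
  also have "(\<Sum>k\<le>Suc n. sconst (of_nat k) * (d k F * d (Suc n - k) G)) + \<dots> =
      (\<Sum>k\<le>Suc n. sconst (of_nat (Suc n)) * (d k F * d (Suc n - k) G))"
    unfolding sum.distrib[symmetric] distrib_right[symmetric] sconst_add[symmetric] of_nat_add[symmetric]
    by (intro sum.cong) auto
  also have "\<dots> = sconst (of_nat (Suc n)) * (\<Sum>k\<le>Suc n. d k F * d (Suc n - k) G)"
    by (simp only: sum_distrib_left)
  finally have eq: "sconst (of_nat (Suc n)) * d (Suc n) (F * G) =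
      sconst (of_nat (Suc n)) * (\<Sum>k\<le>Suc n. d k F * d (Suc n - k) G)" .
  have "d (Suc n) (F * G) = (\<Sum>k\<le>Suc n. d k F * d (Suc n - k) G)"
    by (rule mult_left_cancel[THEN iffD1, OF _ eq]) (simp add: sconst_of_nat del: of_nat_Suc)
  then show ?case by (simp add: d_def)
qed

end

interpretation a: derivation deriv_a
  by unfold_locales (simp_all add: deriv_a_add deriv_a_mult deriv_a_sconst)

interpretation adag: derivation deriv_adag
  by unfold_locales (simp_all add: deriv_adag_add deriv_adag_mult deriv_adag_sconst)

text \<open>The part of the star product with \<open>r\<close> contractions.\<close>

definition contr :: "nat \<Rightarrow> symbol \<Rightarrow> symbol \<Rightarrow> symbol" where
  "contr r F G = sconst (1 / fact r) * (deriv_a ^^ r) F * (deriv_adag ^^ r) G"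

lemma star_nth: "(F \<star> G) $ m = (\<Sum>r\<le>m. \<Sum>i\<le>m - r. contr r (F $ i) (G $ (m - r - i)))"
  by (simp add: star_def contr_def)

lemma contr_sum_left: "contr r (\<Sum>i\<in>A. F i) G = (\<Sum>i\<in>A. contr r (F i) G)"
  by (simp add: contr_def a.pow_sum sum_distrib_left sum_distrib_right)

lemma contr_sum_right: "contr r F (\<Sum>i\<in>A. G i) = (\<Sum>i\<in>A. contr r F (G i))"
  by (simp add: contr_def adag.pow_sum sum_distrib_left)

lemma contr_scale_left: "contr r (sconst c * F) G = sconst c * contr r F G"
  unfolding contr_def a.pow_scale by (simp only: mult_ac)

lemma contr_scale_right: "contr r F (sconst c * G) = sconst c * contr r F G"
  unfolding contr_def adag.pow_scale by (simp only: mult_ac)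

lemma deriv_pow_commute: "(deriv_a ^^ r) ((deriv_adag ^^ s) F) = (deriv_adag ^^ s) ((deriv_a ^^ r) F)"
proof (induction r)
  case (Suc r)
  have "deriv_a ((deriv_adag ^^ s) X) = (deriv_adag ^^ s) (deriv_a X)" for X
    by (induction s) (auto simp: deriv_commute)
  then show ?case using Suc by simp
qed simp

text \<open>
  Associativity of the star product for a fixed total number \<open>n\<close> of contractions.  By the Leibniz
  rule both sides are the sum over the numbers of contractions between the first and second, first and
  third, and second and third factor.
\<close>

lemma contr_assoc:
  "(\<Sum>s\<le>n. contr (n - s) (contr s F G) H) = (\<Sum>s\<le>n. contr (n - s) F (contr s G H))"
proof -
  \<comment> \<open>\<open>s\<close>, \<open>p\<close>, \<open>q\<close> contractions between \<open>F\<close> and \<open>G\<close>, \<open>F\<close> and \<open>H\<close>, \<open>G\<close> and \<open>H\<close>\<close>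
  define T where "T s p q = sconst (1 / fact s) * sconst (1 / fact p) * sconst (1 / fact q) *
     (deriv_a ^^ (p + s)) F * (deriv_adag ^^ s) ((deriv_a ^^ q) G) * (deriv_adag ^^ (p + q)) H" for s p q
  have 1: "contr r (contr s F G) H = (\<Sum>p\<le>r. T s p (r - p))" for r s
  proof -
    have "contr r (contr s F G) H = sconst (1 / fact s) *
       (sconst (1 / fact r) * (deriv_a ^^ r) ((deriv_a ^^ s) F * (deriv_adag ^^ s) G)) * (deriv_adag ^^ r) H"
      by (simp add: contr_def a.pow_scale mult.assoc[symmetric]) (simp add: a.pow_scale mult.assoc)
    also have "\<dots> = (\<Sum>p\<le>r. T s p (r - p))"
      unfolding a.Leibniz_divided sum_distrib_left sum_distrib_right
      by (intro sum.cong)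
         (auto simp: T_def funpow_add deriv_pow_commute mult_ac)
    finally show ?thesis .
  qed
  have 2: "contr r F (contr s G H) = (\<Sum>p\<le>r. T (r - p) p s)" for r s
  proof -
    have "contr r F (contr s G H) = sconst (1 / fact s) * (deriv_a ^^ r) F *
       (sconst (1 / fact r) * (deriv_adag ^^ r) ((deriv_adag ^^ s) H * (deriv_a ^^ s) G))"
      by (simp add: contr_def mult.assoc adag.pow_scale) (simp add: mult_ac)
    also have "\<dots> = (\<Sum>p\<le>r. T (r - p) p s)"
      unfolding adag.Leibniz_divided sum_distrib_left sum_distrib_right
      by (intro sum.cong)
         (auto simp: T_def mult_ac funpow_add[symmetric, THEN fun_cong, simplified])
    finally show ?thesis .
  qed
  have "(\<Sum>s\<le>n. \<Sum>p\<le>n - s. T s p (n - s - p)) = (\<Sum>s\<le>n. \<Sum>p\<le>n - s. T (n - s - p) p s)"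
    unfolding sum.Sigma[OF finite_atMost ballI[OF finite_atMost]]
    by (rule sum.reindex_bij_witness[of _ "\<lambda>(s, p). (n - s - p, p)" "\<lambda>(s, p). (n - s - p, p)"]) auto
  then show ?thesis unfolding 1 2 by simp
qed


lemma sum_diag4:
  fixes T :: "nat \<Rightarrow> nat \<Rightarrow> nat \<Rightarrow> nat \<Rightarrow> nat \<Rightarrow> 'a :: comm_monoid_add"
  shows "(\<Sum>r\<le>m. \<Sum>i\<le>m - r. \<Sum>s\<le>i. \<Sum>p\<le>i - s. T r s p (i - s - p) (m - r - i)) =
    (\<Sum>n\<le>m. \<Sum>p\<le>m - n. \<Sum>q\<le>m - n - p. \<Sum>s\<le>n. T (n - s) s p q (m - n - p - q))" (is "?L = ?R")
proof -
  have "?L = (\<Sum>(r, i, s, p)\<in>(SIGMA r:{..m}. SIGMA i:{..m - r}. SIGMA s:{..i}. {..i - s}).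
      T r s p (i - s - p) (m - r - i))"
    by (simp add: sum.Sigma [symmetric])
  also have "\<dots> = (\<Sum>(n, p, q, s)\<in>(SIGMA n:{..m}. SIGMA p:{..m - n}. SIGMA q:{..m - n - p}. {..n}).
      T (n - s) s p q (m - n - p - q))"
    by (rule sum.reindex_bij_witness[of _ "\<lambda>(n, p, q, s). (n - s, s + p + q, s, p)"
             "\<lambda>(r, i, s, p). (r + s, p, i - s - p, s)"]) (auto split: prod.splits)
  also have "\<dots> = ?R"
    by (simp add: sum.Sigma [symmetric])
  finally show ?thesis .
qed

lemma sum_diag4':
  fixes T :: "nat \<Rightarrow> nat \<Rightarrow> nat \<Rightarrow> nat \<Rightarrow> nat \<Rightarrow> 'a :: comm_monoid_add"
  shows "(\<Sum>r\<le>m. \<Sum>p\<le>m - r. \<Sum>s\<le>m - r - p. \<Sum>q\<le>m - r - p - s. T r s p q (m - r - p - s - q)) =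
    (\<Sum>n\<le>m. \<Sum>p\<le>m - n. \<Sum>q\<le>m - n - p. \<Sum>s\<le>n. T (n - s) s p q (m - n - p - q))" (is "?L = ?R")
proof -
  have "?L = (\<Sum>(r, p, s, q)\<in>(SIGMA r:{..m}. SIGMA p:{..m - r}. SIGMA s:{..m - r - p}. {..m - r - p - s}).
      T r s p q (m - r - p - s - q))"
    by (simp add: sum.Sigma [symmetric])
  also have "\<dots> = (\<Sum>(n, p, q, s)\<in>(SIGMA n:{..m}. SIGMA p:{..m - n}. SIGMA q:{..m - n - p}. {..n}).
      T (n - s) s p q (m - n - p - q))"
    by (rule sum.reindex_bij_witness[of _ "\<lambda>(n, p, q, s). (n - s, p, s, q)"
             "\<lambda>(r, p, s, q). (r + s, p, q, s)"]) (auto split: prod.splits intro!: arg_cong[of _ _ "T _ _ _ _"])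
  also have "\<dots> = ?R"
    by (simp add: sum.Sigma [symmetric])
  finally show ?thesis .
qed

lemma star_assoc: "(F \<star> G) \<star> H = F \<star> (G \<star> H)"
proof (rule fps_ext)
  fix m
  have "((F \<star> G) \<star> H) $ m = (\<Sum>r\<le>m. \<Sum>i\<le>m - r. \<Sum>s\<le>i. \<Sum>p\<le>i - s.
      contr r (contr s (F $ p) (G $ (i - s - p))) (H $ (m - r - i)))"
    by (simp add: star_nth contr_sum_left)
  also have "\<dots> = (\<Sum>n\<le>m. \<Sum>p\<le>m - n. \<Sum>q\<le>m - n - p. \<Sum>s\<le>n.
      contr (n - s) (contr s (F $ p) (G $ q)) (H $ (m - n - p - q)))"
    by (rule sum_diag4)
  also have "\<dots> = (\<Sum>n\<le>m. \<Sum>p\<le>m - n. \<Sum>q\<le>m - n - p. \<Sum>s\<le>n.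
      contr (n - s) (F $ p) (contr s (G $ q) (H $ (m - n - p - q))))"
    by (simp only: contr_assoc)
  also have "\<dots> = (\<Sum>r\<le>m. \<Sum>p\<le>m - r. \<Sum>s\<le>m - r - p. \<Sum>q\<le>m - r - p - s.
      contr r (F $ p) (contr s (G $ q) (H $ (m - r - p - s - q))))"
    by (rule sum_diag4' [symmetric])
  also have "\<dots> = (F \<star> (G \<star> H)) $ m"
    by (simp add: star_nth contr_sum_right)
  finally show "((F \<star> G) \<star> H) $ m = (F \<star> (G \<star> H)) $ m" .
qed

lemma contr_0_left [simp]: "contr r 0 G = 0" and contr_0_right [simp]: "contr r F 0 = 0"
  by (simp_all add: contr_def a.pow_zero adag.pow_zero)

lemma star_0_left [simp]: "0 \<star> G = 0" and star_0_right [simp]: "F \<star> 0 = 0"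
  by (rule fps_ext, simp add: star_nth)+

lemma star_sum_left: "(\<Sum>i\<in>A. F i) \<star> G = (\<Sum>i\<in>A. F i \<star> G)"
proof (rule fps_ext)
  fix m
  have "((\<Sum>i\<in>A. F i) \<star> G) $ m = (\<Sum>r\<le>m. \<Sum>p\<le>m - r. \<Sum>i\<in>A. contr r (F i $ p) (G $ (m - r - p)))"
    by (simp add: star_nth fps_sum_nth contr_sum_left)
  also have "\<dots> = (\<Sum>i\<in>A. F i \<star> G) $ m"
    unfolding fps_sum_nth star_nth
    by (simp only: sum.swap[of _ A] cong: sum.cong)
  finally show "((\<Sum>i\<in>A. F i) \<star> G) $ m = (\<Sum>i\<in>A. F i \<star> G) $ m" .
qed

lemma star_sum_right: "F \<star> (\<Sum>i\<in>A. G i) = (\<Sum>i\<in>A. F \<star> G i)"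
proof (rule fps_ext)
  fix m
  have "(F \<star> (\<Sum>i\<in>A. G i)) $ m = (\<Sum>r\<le>m. \<Sum>p\<le>m - r. \<Sum>i\<in>A. contr r (F $ p) (G i $ (m - r - p)))"
    by (simp add: star_nth fps_sum_nth contr_sum_right)
  also have "\<dots> = (\<Sum>i\<in>A. F \<star> G i) $ m"
    unfolding fps_sum_nth star_nth
    by (simp only: sum.swap[of _ A] cong: sum.cong)
  finally show "(F \<star> (\<Sum>i\<in>A. G i)) $ m = (\<Sum>i\<in>A. F \<star> G i) $ m" .
qed

lemma star_scale_left: "(fps_const (sconst c) * F) \<star> G = fps_const (sconst c) * (F \<star> G)"
  by (rule fps_ext) (simp add: star_nth contr_scale_left sum_distrib_left)

lemma star_scale_right: "F \<star> (fps_const (sconst c) * G) = fps_const (sconst c) * (F \<star> G)"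
  by (rule fps_ext) (simp add: star_nth contr_scale_right sum_distrib_left)

lemma contr_1_left: "contr r 1 G = (if r = 0 then G else 0)"
  using a.pow_scale[of r 1 1] a.sconst[of 1] 
  by (cases r) (auto simp: contr_def funpow_Suc_right a.pow_zero simp del: funpow.simps)

lemma star_1_left [simp]: "1 \<star> G = G"
proof (rule fps_ext)
  fix m
  have "(1 \<star> G) $ m = (\<Sum>r\<le>m. \<Sum>i\<le>m - r. if i = 0 then contr r 1 (G $ (m - r)) else 0)"
    unfolding star_nth by (intro sum.cong) auto
  also have "\<dots> = (\<Sum>r\<le>m. if r = 0 then G $ (m - r) else 0)"
    by (intro sum.cong) (auto simp: contr_1_left)
  finally show "(1 \<star> G) $ m = G $ m" by simp
qed

lemma contr_1_right: "contr r F 1 = (if r = 0 then F else 0)"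
  using adag.pow_scale[of r 1 1] adag.sconst[of 1]
  by (cases r) (auto simp: contr_def funpow_Suc_right adag.pow_zero simp del: funpow.simps)

lemma star_1_right [simp]: "F \<star> 1 = F"
proof (rule fps_ext)
  fix m
  have "(F \<star> 1) $ m = (\<Sum>r\<le>m. \<Sum>i\<le>m - r. if i = m - r then (if r = 0 then F $ i else 0) else 0)"
    unfolding star_nth by (intro sum.cong) (auto simp: contr_1_right)
  also have "\<dots> = (\<Sum>r\<le>m. if r = 0 then F $ m else 0)"
    by (intro sum.cong) auto
  finally show "(F \<star> 1) $ m = F $ m" by simp
qed

lemma star_series_nth: "(F \<star>\<^sub>\<lambda> G) $ n = (\<Sum>i\<le>n. F $ i \<star> G $ (n - i))"
  by (simp add: star_series_def)

lemma star_series_assoc: "(F \<star>\<^sub>\<lambda> G) \<star>\<^sub>\<lambda> H = F \<star>\<^sub>\<lambda> (G \<star>\<^sub>\<lambda> H)"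
proof (rule fps_ext)
  fix n
  have "(\<Sum>j\<le>n. \<Sum>i\<le>j. (F $ i \<star> G $ (j - i)) \<star> H $ (n - j)) =
        (\<Sum>j\<le>n. \<Sum>i\<le>n - j. F $ j \<star> (G $ i \<star> H $ (n - j - i)))"
    using fps_mult_assoc_lemma[where k = n and n = n and f = "\<lambda>i j k. F $ i \<star> (G $ j \<star> H $ k)"]
    by (simp add: star_assoc atLeast0AtMost)
  then show "((F \<star>\<^sub>\<lambda> G) \<star>\<^sub>\<lambda> H) $ n = (F \<star>\<^sub>\<lambda> (G \<star>\<^sub>\<lambda> H)) $ n"
    by (simp add: star_series_nth star_sum_left star_sum_right)
qed

lemma star_series_1_left [simp]: "1 \<star>\<^sub>\<lambda> G = G"
proof (rule fps_ext)
  fix n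
  have "(1 \<star>\<^sub>\<lambda> G) $ n = (\<Sum>i\<le>n. if i = 0 then G $ n else 0)"
    unfolding star_series_nth by (intro sum.cong) auto
  then show "(1 \<star>\<^sub>\<lambda> G) $ n = G $ n" by simp
qed

section \<open>The formal exponential and logarithm\<close>

lemma star_power_add: "star_power F k \<star>\<^sub>\<lambda> star_power F l = star_power F (k + l)"
  by (induction k) (simp_all add: star_series_assoc)

lemma star_power_nth_eq_0: "F $ 0 = 0 \<Longrightarrow> n < k \<Longrightarrow> star_power F k $ n = 0"
proof (induction k arbitrary: n)
  case (Suc k)
  have "F $ i \<star> star_power F k $ (n - i) = 0" if "i \<le> n" for i
    by (cases "i = 0") (use Suc that in auto)
  then show ?case by (simp add: star_series_nth)
qed simp

text \<open>
  The value \<open>\<Sum>\<^sub>k p\<^sub>k F\<^bsup>\<star>k\<^esup>\<close> of a power series \<open>p\<close> in one variable at a symbol series \<open>F\<close> without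
  constant term, truncated like \<^const>\<open>exp_star\<close>.
\<close>

definition star_subst :: "complex fps \<Rightarrow> symbol_series \<Rightarrow> symbol_series" where
  "star_subst p F = Abs_fps (\<lambda>n. \<Sum>k\<le>n. fps_const (sconst (p $ k)) * (star_power F k $ n))"

lemma star_subst_nth:
  assumes "F $ 0 = 0" "n \<le> N"
  shows "star_subst p F $ n = (\<Sum>k\<le>N. fps_const (sconst (p $ k)) * (star_power F k $ n))"
  unfolding star_subst_def fps_nth_Abs_fps
  by (rule sum.mono_neutral_left) (use assms in \<open>auto simp: star_power_nth_eq_0\<close>)

lemma star_subst_mult:
  assumes F: "F $ 0 = 0"
  shows "star_subst p F \<star>\<^sub>\<lambda> star_subst q F = star_subst (p * q) F"
proof (rule fps_ext)
  fix n
  let ?c = "\<lambda>x. fps_const (sconst x)"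
  have "(star_subst p F \<star>\<^sub>\<lambda> star_subst q F) $ n =
    (\<Sum>i\<le>n. (\<Sum>k\<le>n. ?c (p $ k) * (star_power F k $ i)) \<star> (\<Sum>l\<le>n. ?c (q $ l) * (star_power F l $ (n - i))))"
    unfolding star_series_nth by (intro sum.cong) (simp_all add: star_subst_nth[OF F, of _ n])
  also have "\<dots> = (\<Sum>i\<le>n. \<Sum>k\<le>n. \<Sum>l\<le>n. ?c (p $ k * q $ l) * (star_power F k $ i \<star> star_power F l $ (n - i)))"
    by (simp only: star_sum_left, simp only: star_sum_right,
        simp only: star_scale_left star_scale_right sconst_mult mult.assoc fps_const_mult[symmetric],
        simp only: mult_ac)
  also have "\<dots> = (\<Sum>k\<le>n. \<Sum>l\<le>n. ?c (p $ k * q $ l) * (\<Sum>i\<le>n. star_power F k $ i \<star> star_power F l $ (n - i)))"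
    unfolding sum_distrib_left
    by (subst sum.swap, rule sum.cong[OF refl], rule sum.swap)
  also have "\<dots> = (\<Sum>k\<le>n. \<Sum>l\<le>n. ?c (p $ k * q $ l) * (star_power F (k + l) $ n))"
    by (simp add: star_power_add[symmetric] star_series_nth)
  also have "\<dots> = (\<Sum>k\<le>n. \<Sum>l\<le>n - k. ?c (p $ k * q $ l) * (star_power F (k + l) $ n))"
    by (intro sum.cong[OF refl] sum.mono_neutral_right) (auto simp: star_power_nth_eq_0[OF F])
  also have "\<dots> = (\<Sum>d\<le>n. \<Sum>k\<le>d. ?c (p $ k * q $ (d - k)) * (star_power F d $ n))"
    unfolding sum.Sigma[OF finite_atMost ballI[OF finite_atMost]]
    by (rule sum.reindex_bij_witness[of _ "\<lambda>(d, k). (k, d - k)" "\<lambda>(k, l). (k + l, k)"]) auto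
  also have "\<dots> = star_subst (p * q) F $ n"
    by (simp add: star_subst_def fps_mult_nth sconst_sum sum_distrib_right sum_fps_const
           atLeast0AtMost)
  finally show "(star_subst p F \<star>\<^sub>\<lambda> star_subst q F) $ n = star_subst (p * q) F $ n" .
qed

lemma star_subst_1: "star_subst 1 F = 1"
proof (rule fps_ext)
  fix n
  have "star_subst 1 F $ n = (\<Sum>k\<le>n. if k = 0 then 1 $ n else 0)"
    unfolding star_subst_def fps_nth_Abs_fps by (intro sum.cong) auto
  then show "star_subst 1 F $ n = 1 $ n" by simp
qed

lemma star_power_subst: "F $ 0 = 0 \<Longrightarrow> star_power (star_subst p F) k = star_subst (p ^ k) F"
  by (induction k) (simp_all add: star_subst_1 star_subst_mult)

text \<open>
  All star powers of one series commute, so \<^const>\<open>star_subst\<close> is multiplicative in \<open>p\<close> and turns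
  composition of power series in one variable into substitution.  This reduces the inversion of
  \<^const>\<open>exp_star\<close> by \<^const>\<open>log_star\<close> to that of the usual exponential by the usual logarithm.
\<close>

lemma star_subst_compose:
  assumes F: "F $ 0 = 0" and p: "p $ 0 = 0"
  shows "star_subst q (star_subst p F) = star_subst (q oo p) F"
proof (rule fps_ext)
  fix n
  let ?c = "\<lambda>x. fps_const (sconst x)"
  have "star_subst q (star_subst p F) $ n = (\<Sum>k\<le>n. \<Sum>j\<le>n. ?c (q $ k * (p ^ k) $ j) * (star_power F j $ n))"
    by (simp add: star_subst_def[of q] star_power_subst[OF F] star_subst_def[of "p ^ _"] sum_distrib_left
        sconst_mult mult_ac)
  also have "\<dots> = (\<Sum>j\<le>n. (\<Sum>k\<le>n. ?c (q $ k * (p ^ k) $ j)) * (star_power F j $ n))"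
    unfolding sum_distrib_right by (rule sum.swap)
  also have "\<dots> = (\<Sum>j\<le>n. (\<Sum>k\<le>j. ?c (q $ k * (p ^ k) $ j)) * (star_power F j $ n))"
    by (intro sum.cong[OF refl] arg_cong2[where f = "(*)"] sum.mono_neutral_right)
       (auto simp: startsby_zero_power_prefix[OF p])
  also have "\<dots> = star_subst (q oo p) F $ n"
    by (simp add: star_subst_def fps_compose_nth sconst_sum sum_fps_const
           atLeast0AtMost)
  finally show "star_subst q (star_subst p F) $ n = star_subst (q oo p) F $ n" .
qed

lemma star_subst_X:
  assumes "F $ 0 = 0"
  shows "star_subst fps_X F = F"
proof (rule fps_ext)
  fix n
  have pow1: "star_power F (Suc 0) = F"
  proof (rule fps_ext)
    fix n
    have "star_power F (Suc 0) $ n = (\<Sum>i\<le>n. if i = n then F $ n else 0)"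
      unfolding star_power.simps star_series_nth by (intro sum.cong) auto
    then show "star_power F (Suc 0) $ n = F $ n" by simp
  qed
  have "star_subst fps_X F $ n = (\<Sum>k\<le>n. if k = 1 then F $ n else 0)"
    unfolding star_subst_def fps_nth_Abs_fps by (intro sum.cong) (auto simp: fps_X_def pow1 simp del: star_power.simps)
  then show "star_subst fps_X F $ n = F $ n"
    using assms by (cases n) auto
qed

theorem log_star_exp_star:
  assumes "F $ 0 = 0"
  shows "log_star (exp_star F) = F"
proof -
  have 1: "exp_star F - 1 = star_subst (fps_exp 1 - 1) F"
  proof -
    have "star_subst (fps_exp 1) F = star_subst (fps_exp 1 - 1) F + star_subst 1 F"
      by (rule fps_ext)
         (simp add: star_subst_def sum.distrib[symmetric] distrib_right[symmetric] sconst_add[symmetric])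
    moreover have "exp_star F = star_subst (fps_exp 1) F"
      by (simp add: exp_star_def star_subst_def fps_exp_def)
    ultimately show ?thesis by (simp add: star_subst_1)
  qed
  have 2: "log_star G = star_subst (fps_ln 1) (G - 1)" for G
  proof (rule fps_ext)
    fix n
    have "star_subst (fps_ln 1) (G - 1) $ n =
       (\<Sum>k=1..n. fps_const (sconst (fps_ln 1 $ k)) * (star_power (G - 1) k $ n))"
      unfolding star_subst_def fps_nth_Abs_fps
      by (rule sum.mono_neutral_right) (auto simp: fps_ln_def not_le)
    also have "\<dots> = log_star G $ n"
      unfolding log_star_def fps_nth_Abs_fps
    proof (rule sum.cong[OF refl])
      fix k assume "k \<in> {1..n}"
      then obtain j where "k = Suc j" by (cases k) auto
      then show "fps_const (sconst (fps_ln 1 $ k)) * (star_power (G - 1) k $ n) =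
        fps_const (sconst ((- 1) ^ (k + 1) / of_nat k)) * (star_power (G - 1) k $ n)"
        by (simp add: fps_ln_def)
    qed
    finally show "log_star G $ n = star_subst (fps_ln 1) (G - 1) $ n" by simp
  qed
  have "fps_ln 1 oo (fps_exp 1 - 1 :: complex fps) = fps_X"
    by (simp add: fps_ln_fps_exp_inv[of 1] fps_inv)
  then show ?thesis
    unfolding 2 1 using assms by (simp add: star_subst_compose star_subst_X)
qed

section \<open>Linear orders as lists\<close>

text \<open>
  The linear order on the elements of a distinct list in which earlier entries are smaller.  Orderings
  of a finite set are then its permutations as lists, which supports recursion on the least element,
  restriction by \<^const>\<open>filter\<close>, and counting by shuffles.
\<close>

primrec list_order :: "'a list \<Rightarrow> ('a \<times> 'a) set" where
  "list_order [] = {}"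
| "list_order (x # xs) = {x} \<times> set (x # xs) \<union> list_order xs"

lemma list_order_in_set: "(u, v) \<in> list_order xs \<Longrightarrow> u \<in> set xs \<and> v \<in> set xs"
  by (induction xs) auto

lemma list_order_refl: "u \<in> set xs \<Longrightarrow> (u, u) \<in> list_order xs"
  by (induction xs) auto

lemma list_order_total: "u \<in> set xs \<Longrightarrow> v \<in> set xs \<Longrightarrow> (u, v) \<in> list_order xs \<or> (v, u) \<in> list_order xs"
  by (induction xs) auto

lemma list_order_antisym: "distinct xs \<Longrightarrow> (u, v) \<in> list_order xs \<Longrightarrow> (v, u) \<in> list_order xs \<Longrightarrow> u = v"
  by (induction xs) (auto dest: list_order_in_set)

lemma list_order_trans:
  "distinct xs \<Longrightarrow> (u, v) \<in> list_order xs \<Longrightarrow> (v, w) \<in> list_order xs \<Longrightarrow> (u, w) \<in> list_order xs"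
  by (induction xs) (auto dest: list_order_in_set)

lemma list_order_filter: "list_order (filter P xs) = {(u, v) \<in> list_order xs. P u \<and> P v}"
  by (induction xs) auto

lemma list_order_map:
  assumes "inj_on g V" "set xs \<subseteq> V" "u \<in> V" "v \<in> V"
  shows "(g u, g v) \<in> list_order (map g xs) \<longleftrightarrow> (u, v) \<in> list_order xs"
  using assms(2)
proof (induction xs)
  case (Cons x xs)
  then have "g u = g x \<longleftrightarrow> u = x" "g v = g x \<longleftrightarrow> v = x" "g v \<in> g ` set xs \<longleftrightarrow> v \<in> set xs"
    using assms(1,3,4) by (auto simp: inj_on_eq_iff)
  then show ?case using Cons by auto
qed simp

lemma linear_order_list_order:
  assumes "distinct xs"
  shows "linear_order_on (set xs) (list_order xs)"
  using assms list_order_in_set[of _ _ xs] list_order_refl[of _ xs] list_order_total[of _ xs]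
    list_order_antisym[of xs] list_order_trans[of xs]
  unfolding order_on_defs refl_on_def total_on_def antisym_def trans_def
  by (intro conjI subrelI) blast+

lemma list_order_inject:
  "distinct xs \<Longrightarrow> distinct ys \<Longrightarrow> set xs = set ys \<Longrightarrow> list_order xs = list_order ys \<Longrightarrow> xs = ys"
proof (induction xs arbitrary: ys)
  case (Cons x xs)
  then obtain y ys' where ys: "ys = y # ys'" by (cases ys) auto
  have "x = y"
  proof (rule ccontr)
    assume "x \<noteq> y"
    have "(x, y) \<in> list_order ys" using Cons.prems ys by auto
    then show False using \<open>x \<noteq> y\<close> Cons.prems ys by (auto dest: list_order_in_set)
  qed
  have drop: "list_order zs = {(u, v) \<in> list_order (z # zs). u \<noteq> z \<and> v \<noteq> z}"
    if "distinct (z # zs)" for z :: 'a and zs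
    using that by (auto dest: list_order_in_set)
  have "list_order xs = {(u, v) \<in> list_order (x # xs). u \<noteq> x \<and> v \<noteq> x}"
    using Cons.prems(1) by (rule drop)
  also have "\<dots> = {(u, v) \<in> list_order (y # ys'). u \<noteq> y \<and> v \<noteq> y}"
    using Cons.prems(4) unfolding ys \<open>x = y\<close> by (simp only:)
  also have "\<dots> = list_order ys'"
    using Cons.prems(2) unfolding ys by (rule drop[symmetric])
  finally have "list_order xs = list_order ys'" .
  moreover have "set xs = set ys'" using Cons.prems ys \<open>x = y\<close> by auto
  ultimately show ?case using Cons ys \<open>x = y\<close> by auto
qed simp

lemma linear_order_obtain_list:
  assumes "finite V" "linear_order_on V r"
  shows "\<exists>xs. distinct xs \<and> set xs = V \<and> list_order xs = r"
  using assms
proof (induction "card V" arbitrary: V r)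
  case 0
  then show ?case by (auto simp: order_on_defs refl_on_def intro!: exI[of _ "[]"])
next
  case (Suc n)
  have r: "r \<subseteq> V \<times> V" "refl_on V r" "trans r" "antisym r" "total_on V r"
    using Suc.prems(2) by (auto simp: order_on_defs)
  note sub = r(1)
  have refl: "\<And>u. u \<in> V \<Longrightarrow> (u, u) \<in> r" using r(2) by (simp add: refl_on_def)
  have tr: "\<And>u v w. (u, v) \<in> r \<Longrightarrow> (v, w) \<in> r \<Longrightarrow> (u, w) \<in> r" using r(3) by (rule transD)
  have anti: "\<And>u v. (u, v) \<in> r \<Longrightarrow> (v, u) \<in> r \<Longrightarrow> u = v" using r(4) by (rule antisymD)
  have tot: "\<And>u v. u \<in> V \<Longrightarrow> v \<in> V \<Longrightarrow> (u, v) \<in> r \<or> (v, u) \<in> r"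
    using r(5) refl unfolding total_on_def by metis
  have "\<exists>x\<in>A. \<forall>y\<in>A. (x, y) \<in> r" if "finite A" "A \<noteq> {}" "A \<subseteq> V" for A
    using that
  proof (induction A rule: finite_ne_induct)
    case (singleton x) then show ?case using refl by auto
  next
    case (insert a A)
    then obtain x where x: "x \<in> A" "\<forall>y\<in>A. (x, y) \<in> r" by auto
    show ?case
    proof (cases "(a, x) \<in> r")
      case True
      then show ?thesis using x tr refl insert.prems by (intro bexI[of _ a]) auto
    next
      case False
      then show ?thesis using x tot[of a x] insert.prems by (intro bexI[of _ x]) auto
    qed
  qed
  from this[of V] obtain x where x: "x \<in> V" "\<And>y. y \<in> V \<Longrightarrow> (x, y) \<in> r"
    using Suc by force
  let ?r = "{(u, v) \<in> r. u \<noteq> x \<and> v \<noteq> x}"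
  have "linear_order_on (V - {x}) ?r"
    unfolding order_on_defs refl_on_def total_on_def antisym_def trans_def
    using sub refl anti tot by (auto intro: tr)
  moreover have "card (V - {x}) = n" using Suc x by simp
  ultimately obtain xs where xs: "distinct xs" "set xs = V - {x}" "list_order xs = ?r"
    using Suc.hyps(1)[of "V - {x}" ?r] Suc.prems(1) by auto
  have "list_order (x # xs) = r"
    using xs x sub anti by auto
  then show ?case using xs x by (intro exI[of _ "x # xs"]) auto
qed

lemma bij_betw_list_order:
  assumes "finite V"
  shows "bij_betw list_order (permutations_of_set V) {r. linear_order_on V r}"
  unfolding bij_betw_def inj_on_def permutations_of_set_def
  using list_order_inject linear_order_list_order linear_order_obtain_list[OF assms] by fastforce

section \<open>The functional \<open>e\<close> as an average over orderings\<close>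

text \<open>
  The factor of an arc from \<open>u\<close> to \<open>v\<close> in \<open>e\<close> for a fixed linear order \<open>r\<close> of the vertices: \<open>b\<close> for a
  tadpole, and otherwise the truth value of \<open>u\<close> being smaller than \<open>v\<close>.
\<close>

definition arc_weight :: "('v \<times> 'v) set \<Rightarrow> real \<Rightarrow> 'v \<Rightarrow> 'v \<Rightarrow> real" where
  "arc_weight r b u v = (if u = v then b else of_bool ((u, v) \<in> r))"

lemma fin_digraph_iff:
  "fin_digraph G \<longleftrightarrow> finite (verts G) \<and> finite (arcs G) \<and>
     (\<forall>e\<in>arcs G. tail G e \<in> verts G \<and> head G e \<in> verts G)"
  by (auto simp: fin_digraph_def fin_digraph_axioms_def wf_digraph_def)

lemma trancl_subset_iff: "trans r \<Longrightarrow> R\<^sup>+ \<subseteq> r \<longleftrightarrow> R \<subseteq> r"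
  using trancl_mono_subset[of R r] r_into_trancl'[of _ R] by (fastforce simp: trancl_id)

text \<open>
  On a tadpole-free quiver a directed cycle excludes every linear extension, so the case distinction in
  \<^const>\<open>e0\<close> is not needed.
\<close>

lemma e0_eq:
  assumes G: "fin_digraph G" and no_tadpoles: "\<And>e. e \<in> arcs G \<Longrightarrow> tail G e \<noteq> head G e"
  shows "e0 G = real (card {xs \<in> permutations_of_set (verts G). arcs_ends G \<subseteq> list_order xs}) /
    fact (card (verts G))"
proof -
  let ?L = "{r. linear_order_on (verts G) r \<and> arcs_ends G \<subseteq> r}"
  have fin: "finite (verts G)" using G by (simp add: fin_digraph_iff)
  have LE: "linear_extensions G = ?L"
  proof -
    have "linear_order_on (verts G) r \<and> (arcs_ends G)\<^sup>+ \<subseteq> r \<longleftrightarrow> linear_order_on (verts G) r \<and> arcs_ends G \<subseteq> r" for r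
      using trancl_subset_iff[of r "arcs_ends G"] by (auto simp: order_on_defs)
    then show ?thesis by (simp add: linear_extensions_def)
  qed
  have "bij_betw list_order {xs \<in> permutations_of_set (verts G). arcs_ends G \<subseteq> list_order xs} ?L"
  proof (rule bij_betw_subset[OF bij_betw_list_order[OF fin]])
    have "list_order ` {xs \<in> permutations_of_set (verts G). arcs_ends G \<subseteq> list_order xs} =
        {r \<in> list_order ` permutations_of_set (verts G). arcs_ends G \<subseteq> r}" by auto
    then show "list_order ` {xs \<in> permutations_of_set (verts G). arcs_ends G \<subseteq> list_order xs} = ?L"
      using bij_betw_list_order[OF fin] by (simp add: bij_betw_def)
  qed auto
  then have card: "card {xs \<in> permutations_of_set (verts G). arcs_ends G \<subseteq> list_order xs} = card ?L"
    by (rule bij_betw_same_card)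
  have empty: "?L = {}" if "\<not> acyclic (arcs_ends G)"
  proof -
    from that obtain u where u: "(u, u) \<in> (arcs_ends G)\<^sup>+" by (auto simp: acyclic_def)
    {
      fix r assume r: "linear_order_on (verts G) r" "arcs_ends G \<subseteq> r"
      obtain v where v: "(u, v) \<in> arcs_ends G" "(v, u) \<in> (arcs_ends G)\<^sup>*"
        using u by (meson tranclD)
      have tr: "trans r" and refl: "refl_on (verts G) r" and anti: "antisym r"
        using r by (auto simp: order_on_defs)
      have "u \<noteq> v" using v no_tadpoles by (auto simp: arcs_ends_def arc_to_ends_def)
      with v have "(v, u) \<in> (arcs_ends G)\<^sup>+" by (metis rtrancl_eq_or_trancl)
      then have "(v, u) \<in> r" using r tr trancl_subset_iff by blast
      then have False using v r anti \<open>u \<noteq> v\<close> by (auto simp: antisym_def)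
    }
    then show ?thesis by blast
  qed
  have "card ?L = 0" if "\<not> acyclic (arcs_ends G)"
    unfolding empty[OF that] by (rule card.empty)
  then show ?thesis
    unfolding e0_def LE card by auto
qed

lemma e_quiver_eq:
  assumes G: "fin_digraph G"
  shows "e_quiver \<beta> G =
    (\<Sum>xs\<in>permutations_of_set (verts G).
       \<Prod>e\<in>arcs G. arc_weight (list_order xs) (- beta_minus \<beta> e) (tail G e) (head G e)) /
    fact (card (verts G))"
proof -
  let ?T = "tadpoles G" and ?A = "arcs G - tadpoles G"
  let ?C = "cut_subquiver G ?A"
  have fin: "finite (arcs G)" "finite (verts G)" and T: "?T \<subseteq> arcs G"
    using G by (auto simp: fin_digraph_iff tadpoles_def)
  have C: "fin_digraph ?C" by (rule fin_digraph_cut_subquiver[OF G]) auto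
  have V: "verts ?C = verts G" and ends: "tail ?C = tail G" "head ?C = head G"
    by (simp_all add: cut_subquiver_def)
  have prod: "(\<Prod>e\<in>arcs G. arc_weight (list_order xs) (- beta_minus \<beta> e) (tail G e) (head G e)) =
      (\<Prod>e\<in>?T. - beta_minus \<beta> e) * of_bool (arcs_ends ?C \<subseteq> list_order xs)" for xs
  proof -
    have "(\<Prod>e\<in>arcs G. arc_weight (list_order xs) (- beta_minus \<beta> e) (tail G e) (head G e)) =
        (\<Prod>e\<in>?T. arc_weight (list_order xs) (- beta_minus \<beta> e) (tail G e) (head G e)) *
        (\<Prod>e\<in>?A. arc_weight (list_order xs) (- beta_minus \<beta> e) (tail G e) (head G e))"
      using prod.subset_diff[OF T fin(1)] by (simp add: mult.commute)
    also have "(\<Prod>e\<in>?T. arc_weight (list_order xs) (- beta_minus \<beta> e) (tail G e) (head G e)) =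
        (\<Prod>e\<in>?T. - beta_minus \<beta> e)"
      by (rule prod.cong) (auto simp: tadpoles_def arc_weight_def)
    also have "(\<Prod>e\<in>?A. arc_weight (list_order xs) (- beta_minus \<beta> e) (tail G e) (head G e)) =
        (\<Prod>e\<in>?A. of_bool ((tail G e, head G e) \<in> list_order xs))"
      by (rule prod.cong) (auto simp: tadpoles_def arc_weight_def)
    also have "\<dots> = of_bool (arcs_ends ?C \<subseteq> list_order xs)"
    proof (cases "arcs_ends ?C \<subseteq> list_order xs")
      case True
      then show ?thesis by (auto simp: arcs_ends_def arc_to_ends_def cut_subquiver_def intro!: prod.neutral)
    next
      case False
      then obtain e where "e \<in> ?A" "(tail G e, head G e) \<notin> list_order xs"
        by (auto simp: arcs_ends_def arc_to_ends_def cut_subquiver_def)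
      then show ?thesis using fin False by (auto intro!: prod_zero bexI[of _ e])
    qed
    finally show ?thesis .
  qed
  have "e0 ?C = real (card {xs \<in> permutations_of_set (verts G). arcs_ends ?C \<subseteq> list_order xs}) / fact (card (verts G))"
    using e0_eq[OF C] unfolding V ends by (auto simp: tadpoles_def)
  also have "real (card {xs \<in> permutations_of_set (verts G). arcs_ends ?C \<subseteq> list_order xs}) =
      (\<Sum>xs\<in>permutations_of_set (verts G). of_bool (arcs_ends ?C \<subseteq> list_order xs))"
    by (simp add: of_bool_def sum.If_cases Int_def)
  finally show ?thesis
    unfolding e_quiver_def prod by (simp add: sum_distrib_left)
qed

text \<open>
  Restricting an ordering of a disjoint union to the two parts is independent and uniform: each pair of
  orderings arises from the same number of shuffles.
\<close>

lemma sum_permutations_of_disjoint_union: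
  fixes F H :: "'a list \<Rightarrow> real"
  assumes fin: "finite A" "finite B" and disj: "A \<inter> B = {}"
  shows "(\<Sum>xs\<in>permutations_of_set (A \<union> B). F (filter (\<lambda>x. x \<in> A) xs) * H (filter (\<lambda>x. x \<in> B) xs)) =
    real ((card A + card B) choose card A) *
      ((\<Sum>xs\<in>permutations_of_set A. F xs) * (\<Sum>xs\<in>permutations_of_set B. H xs))"
proof -
  let ?P = "permutations_of_set A \<times> permutations_of_set B"
  let ?g = "\<lambda>zs. (filter (\<lambda>x. x \<in> A) zs, filter (\<lambda>x. x \<in> B) zs)"
  have finP: "finite ?P" by simp
  have img: "?g ` permutations_of_set (A \<union> B) \<subseteq> ?P"
    by (auto simp: permutations_of_set_def)
  have fibre: "{zs \<in> permutations_of_set (A \<union> B). ?g zs = (xs, ys)} = shuffles xs ys"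
    if "(xs, ys) \<in> ?P" for xs ys
  proof -
    from that have xs: "set xs = A" "distinct xs" and ys: "set ys = B" "distinct ys"
      by (auto simp: permutations_of_set_def)
    have d: "set xs \<inter> set ys = {}" using xs ys disj by simp
    show ?thesis
    proof (intro equalityI subsetI)
      fix zs assume "zs \<in> {zs \<in> permutations_of_set (A \<union> B). ?g zs = (xs, ys)}"
      then have zs: "set zs = A \<union> B" "filter (\<lambda>x. x \<in> A) zs = xs" "filter (\<lambda>x. x \<in> B) zs = ys"
        by (auto simp: permutations_of_set_def)
      have "filter (\<lambda>x. x \<in> B) zs = filter (\<lambda>x. x \<notin> A) zs"
        using zs(1) disj by (intro filter_cong) auto
      then show "zs \<in> shuffles xs ys"
        using partition_in_shuffles[of zs "\<lambda>x. x \<in> A"] zs by simp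
    next
      fix zs assume zs: "zs \<in> shuffles xs ys"
      have "set zs = A \<union> B" using set_shuffles[OF zs] xs ys by simp
      moreover have "distinct zs" using distinct_disjoint_shuffles[OF xs(2) ys(2) d zs] .
      moreover have "filter (\<lambda>x. x \<in> A) zs = xs" using filter_shuffles_disjoint1(1)[OF d zs] xs by simp
      moreover have "filter (\<lambda>x. x \<in> B) zs = ys" using filter_shuffles_disjoint2(1)[OF d zs] ys by simp
      ultimately show "zs \<in> {zs \<in> permutations_of_set (A \<union> B). ?g zs = (xs, ys)}"
        by (auto simp: permutations_of_set_def)
    qed
  qed
  have "(\<Sum>zs\<in>permutations_of_set (A \<union> B). F (filter (\<lambda>x. x \<in> A) zs) * H (filter (\<lambda>x. x \<in> B) zs)) =
      (\<Sum>p\<in>?P. \<Sum>zs\<in>{zs \<in> permutations_of_set (A \<union> B). ?g zs = p}. F (fst (?g zs)) * H (snd (?g zs)))"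
    by (subst sum.group[OF _ finP img]) simp_all
  also have "\<dots> = (\<Sum>p\<in>?P. real ((card A + card B) choose card A) * (F (fst p) * H (snd p)))"
  proof (rule sum.cong[OF refl])
    fix p assume p: "p \<in> ?P"
    obtain xs ys where [simp]: "p = (xs, ys)" by (cases p)
    have "(\<Sum>zs\<in>{zs \<in> permutations_of_set (A \<union> B). ?g zs = p}. F (fst (?g zs)) * H (snd (?g zs))) =
        (\<Sum>zs\<in>shuffles xs ys. F xs * H ys)"
      using fibre[of xs ys] p by (intro sum.cong) auto
    also have "\<dots> = real (card (shuffles xs ys)) * (F xs * H ys)" by simp
    also have "card (shuffles xs ys) = (card A + card B) choose card A"
      using p disj by (subst card_disjoint_shuffles) (auto simp: permutations_of_set_def distinct_card)
    finally show "(\<Sum>zs\<in>{zs \<in> permutations_of_set (A \<union> B). ?g zs = p}. F (fst (?g zs)) * H (snd (?g zs))) =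
       real ((card A + card B) choose card A) * (F (fst p) * H (snd p))" by simp
  qed
  also have "\<dots> = real ((card A + card B) choose card A) *
      ((\<Sum>xs\<in>permutations_of_set A. F xs) * (\<Sum>xs\<in>permutations_of_set B. H xs))"
    unfolding sum_distrib_left[symmetric] by (simp only: sum_product sum.cartesian_product case_prod_unfold)
  finally show ?thesis .
qed

lemma e_quiver_disjoint_union:
  assumes G1: "fin_digraph G1" and G2: "fin_digraph G2" and G: "fin_digraph G"
    and V: "verts G = verts G1 \<union> verts G2" "verts G1 \<inter> verts G2 = {}"
    and A: "arcs G = arcs G1 \<union> arcs G2" "arcs G1 \<inter> arcs G2 = {}"
    and ends1: "\<And>e. e \<in> arcs G1 \<Longrightarrow> tail G e = tail G1 e \<and> head G e = head G1 e"
    and ends2: "\<And>e. e \<in> arcs G2 \<Longrightarrow> tail G e = tail G2 e \<and> head G e = head G2 e"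
  shows "e_quiver \<beta> G = e_quiver \<beta> G1 * e_quiver \<beta> G2"
proof -
  have fin: "finite (verts G1)" "finite (verts G2)" "finite (arcs G1)" "finite (arcs G2)"
    using G1 G2 by (auto simp: fin_digraph_iff)
  let ?w = "\<lambda>K xs e. arc_weight (list_order xs) (- beta_minus \<beta> e) (tail K e) (head K e)"
  let ?r = "\<lambda>K. filter (\<lambda>x. x \<in> verts K)"
  have "(\<Prod>e\<in>arcs G. ?w G xs e) = (\<Prod>e\<in>arcs G1. ?w G1 (?r G1 xs) e) * (\<Prod>e\<in>arcs G2. ?w G2 (?r G2 xs) e)" for xs
  proof -
    have "(\<Prod>e\<in>arcs G1. ?w G xs e) = (\<Prod>e\<in>arcs G1. ?w G1 (?r G1 xs) e)"
      by (rule prod.cong) (use G1 ends1 in \<open>auto simp: arc_weight_def list_order_filter fin_digraph_iff\<close>)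
    moreover have "(\<Prod>e\<in>arcs G2. ?w G xs e) = (\<Prod>e\<in>arcs G2. ?w G2 (?r G2 xs) e)"
      by (rule prod.cong) (use G2 ends2 in \<open>auto simp: arc_weight_def list_order_filter fin_digraph_iff\<close>)
    ultimately show ?thesis
      unfolding A(1) by (simp add: prod.union_disjoint[OF fin(3,4) A(2)])
  qed
  then have "(\<Sum>xs\<in>permutations_of_set (verts G). \<Prod>e\<in>arcs G. ?w G xs e) =
      (\<Sum>xs\<in>permutations_of_set (verts G1 \<union> verts G2).
        (\<Prod>e\<in>arcs G1. ?w G1 (?r G1 xs) e) * (\<Prod>e\<in>arcs G2. ?w G2 (?r G2 xs) e))"
    by (simp only: V(1))
  also have "\<dots> = real ((card (verts G1) + card (verts G2)) choose card (verts G1)) *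
      ((\<Sum>xs\<in>permutations_of_set (verts G1). \<Prod>e\<in>arcs G1. ?w G1 xs e) *
       (\<Sum>xs\<in>permutations_of_set (verts G2). \<Prod>e\<in>arcs G2. ?w G2 xs e))"
    using sum_permutations_of_disjoint_union[OF fin(1,2) V(2),
        of "\<lambda>xs. \<Prod>e\<in>arcs G1. ?w G1 xs e" "\<lambda>xs. \<Prod>e\<in>arcs G2. ?w G2 xs e"] .
  finally have "(\<Sum>xs\<in>permutations_of_set (verts G). \<Prod>e\<in>arcs G. ?w G xs e) =
     real ((card (verts G1) + card (verts G2)) choose card (verts G1)) *
      ((\<Sum>xs\<in>permutations_of_set (verts G1). \<Prod>e\<in>arcs G1. ?w G1 xs e) *
       (\<Sum>xs\<in>permutations_of_set (verts G2). \<Prod>e\<in>arcs G2. ?w G2 xs e))" .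
  moreover have "card (verts G) = card (verts G1) + card (verts G2)"
    unfolding V(1) using card_Un_disjoint[OF fin(1,2) V(2)] .
  ultimately show ?thesis
    unfolding e_quiver_eq[OF G] e_quiver_eq[OF G1] e_quiver_eq[OF G2]
    by (simp add: binomial_fact field_simps)
qed

section \<open>Isomorphisms and disjoint unions\<close>

text \<open>Isomorphisms of quivers; only the values on vertices and arcs matter.\<close>

definition quiver_iso ::
  "('v \<Rightarrow> 'w) \<Rightarrow> ('e \<Rightarrow> 'd) \<Rightarrow> ('v, 'e) pre_digraph \<Rightarrow> ('w, 'd) pre_digraph \<Rightarrow> bool" where
  "quiver_iso \<phi> \<psi> G K \<longleftrightarrow>
     bij_betw \<phi> (verts G) (verts K) \<and> bij_betw \<psi> (arcs G) (arcs K) \<and>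
     (\<forall>e\<in>arcs G. tail K (\<psi> e) = \<phi> (tail G e) \<and> head K (\<psi> e) = \<phi> (head G e))"

lemma e_quiver_iso:
  assumes G: "fin_digraph G" and K: "fin_digraph K" and iso: "quiver_iso \<phi> \<psi> G K"
    and \<beta>: "\<And>e. e \<in> arcs G \<Longrightarrow> \<beta>' (\<psi> e) = \<beta> e"
  shows "e_quiver \<beta> G = e_quiver \<beta>' K"
proof -
  from iso have \<phi>: "bij_betw \<phi> (verts G) (verts K)" and \<psi>: "bij_betw \<psi> (arcs G) (arcs K)"
    and ends: "\<And>e. e \<in> arcs G \<Longrightarrow> tail K (\<psi> e) = \<phi> (tail G e)"
       "\<And>e. e \<in> arcs G \<Longrightarrow> head K (\<psi> e) = \<phi> (head G e)"
    by (auto simp: quiver_iso_def)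
  have inj: "inj_on \<phi> (verts G)" and im: "\<phi> ` verts G = verts K" using \<phi> by (auto simp: bij_betw_def)
  let ?w = "\<lambda>\<beta> K xs e. arc_weight (list_order xs) (- beta_minus \<beta> e) (tail K e) (head K e)"
  have perm: "permutations_of_set (verts K) = map \<phi> ` permutations_of_set (verts G)"
    using permutations_of_set_image_inj[OF inj] im by simp
  have inj_map: "inj_on (map \<phi>) (permutations_of_set (verts G))"
    using inj by (intro inj_on_mapI) (auto simp: permutations_of_set_def Union_eq intro: inj_on_subset)
  have "(\<Sum>xs\<in>permutations_of_set (verts K). \<Prod>e\<in>arcs K. ?w \<beta>' K xs e) =
      (\<Sum>xs\<in>permutations_of_set (verts G). \<Prod>e\<in>arcs K. ?w \<beta>' K (map \<phi> xs) e)"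
    unfolding perm by (simp add: sum.reindex[OF inj_map])
  also have "\<dots> = (\<Sum>xs\<in>permutations_of_set (verts G). \<Prod>e\<in>arcs G. ?w \<beta> G xs e)"
  proof (rule sum.cong[OF refl])
    fix xs assume xs: "xs \<in> permutations_of_set (verts G)"
    have "(\<Prod>e\<in>arcs K. ?w \<beta>' K (map \<phi> xs) e) = (\<Prod>e\<in>arcs G. ?w \<beta>' K (map \<phi> xs) (\<psi> e))"
      by (rule prod.reindex_bij_betw[OF \<psi>, symmetric])
    also have "\<dots> = (\<Prod>e\<in>arcs G. ?w \<beta> G xs e)"
    proof (rule prod.cong[OF refl])
      fix e assume e: "e \<in> arcs G"
      then have t: "tail G e \<in> verts G" "head G e \<in> verts G" using G by (auto simp: fin_digraph_iff)
      have "set xs \<subseteq> verts G" using xs by (auto simp: permutations_of_set_def)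
      then show "?w \<beta>' K (map \<phi> xs) (\<psi> e) = ?w \<beta> G xs e"
        using e \<beta>[OF e] ends t list_order_map[OF inj _ t, of xs] inj_on_eq_iff[OF inj t]
        by (simp add: arc_weight_def beta_minus_def)
    qed
    finally show "(\<Prod>e\<in>arcs K. ?w \<beta>' K (map \<phi> xs) e) = (\<Prod>e\<in>arcs G. ?w \<beta> G xs e)" .
  qed
  finally show ?thesis
    unfolding e_quiver_eq[OF G] e_quiver_eq[OF K] using bij_betw_same_card[OF \<phi>] by simp
qed

text \<open>Adjacency of the underlying undirected graph of the cut-subquiver with arcs \<open>S\<close>.\<close>

definition adj :: "('v, 'e) pre_digraph \<Rightarrow> 'e set \<Rightarrow> ('v \<times> 'v) set" where
  "adj G S = (\<Union>e\<in>S. {(tail G e, head G e), (head G e, tail G e)})"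

lemma rtrancl_on_eq_rtrancl:
  assumes "R \<subseteq> V \<times> V" "u \<in> V"
  shows "(u, v) \<in> rtrancl_on V R \<longleftrightarrow> (u, v) \<in> R\<^sup>*"
proof
  assume "(u, v) \<in> R\<^sup>*"
  then show "(u, v) \<in> rtrancl_on V R"
    by induction (use assms in \<open>auto intro: rtrancl_on_into_rtrancl_on\<close>)
qed (rule rtrancl_on_rtranclI)

lemma arcs_ends_mk_symmetric: "arcs_ends (with_proj (mk_symmetric G)) = adj G (arcs G)"
  by (auto simp: arcs_ends_def arc_to_ends_def mk_symmetric_def adj_def)

lemma weak_component_eq:
  assumes G: "fin_digraph G" and S: "S \<subseteq> arcs G" and u: "u \<in> verts G"
  shows "weak_component (cut_subquiver G S) u = {v. (u, v) \<in> (adj G S)\<^sup>*}"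
proof -
  have "arcs_ends (with_proj (mk_symmetric (cut_subquiver G S))) = adj G S"
    unfolding arcs_ends_mk_symmetric by (simp add: adj_def cut_subquiver_def)
  moreover have "pverts (mk_symmetric (cut_subquiver G S)) = verts G"
    by (simp add: mk_symmetric_def cut_subquiver_def)
  moreover have "adj G S \<subseteq> verts G \<times> verts G"
    using G S by (auto simp: fin_digraph_iff adj_def)
  ultimately show ?thesis
    using u by (simp add: weak_component_def reachable_def rtrancl_on_eq_rtrancl)
qed

lemma connected_iff:
  assumes G: "fin_digraph G"
  shows "Digraph_Component.connected G \<longleftrightarrow>
    verts G \<noteq> {} \<and> (\<forall>u\<in>verts G. \<forall>v\<in>verts G. (u, v) \<in> (adj G (arcs G))\<^sup>*)"
proof -
  have "adj G (arcs G) \<subseteq> verts G \<times> verts G"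
    using G by (auto simp: fin_digraph_iff adj_def)
  then show ?thesis
    unfolding Digraph_Component.connected_def strongly_connected_def reachable_def arcs_ends_mk_symmetric
    by (auto simp: mk_symmetric_def rtrancl_on_eq_rtrancl)
qed

lemma adj_rtrancl_in_verts:
  assumes "fin_digraph G" "S \<subseteq> arcs G" "u \<in> verts G" "(u, v) \<in> (adj G S)\<^sup>*"
  shows "v \<in> verts G"
  using assms(4) by induction (use assms in \<open>auto simp: fin_digraph_iff adj_def\<close>)

lemma fin_digraph_contract:
  assumes "fin_digraph G"
  shows "fin_digraph (contract G S)"
  using assms by (auto simp: fin_digraph_iff contract_def)

lemma quiver_iso_rtrancl:
  assumes G: "fin_digraph G" and iso: "quiver_iso \<phi> \<psi> G K" and S: "S \<subseteq> arcs G" and u: "u \<in> verts G"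
  shows "{w. (\<phi> u, w) \<in> (adj K (\<psi> ` S))\<^sup>*} = \<phi> ` {v. (u, v) \<in> (adj G S)\<^sup>*}"
proof (intro equalityI subsetI)
  from iso have inj: "inj_on \<phi> (verts G)"
    and ends: "\<And>e. e \<in> arcs G \<Longrightarrow> tail K (\<psi> e) = \<phi> (tail G e)"
       "\<And>e. e \<in> arcs G \<Longrightarrow> head K (\<psi> e) = \<phi> (head G e)"
    by (auto simp: quiver_iso_def bij_betw_def)
  {
    fix w assume "w \<in> {w. (\<phi> u, w) \<in> (adj K (\<psi> ` S))\<^sup>*}"
    then have "(\<phi> u, w) \<in> (adj K (\<psi> ` S))\<^sup>*" by simp
    then have "\<exists>v. w = \<phi> v \<and> (u, v) \<in> (adj G S)\<^sup>*"
    proof induction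
      case (step y z)
      then obtain v where v: "y = \<phi> v" "(u, v) \<in> (adj G S)\<^sup>*" by blast
      have vV: "v \<in> verts G" by (rule adj_rtrancl_in_verts[OF G S u v(2)])
      from step(2) obtain e where e: "e \<in> S"
        "(y, z) = (tail K (\<psi> e), head K (\<psi> e)) \<or> (y, z) = (head K (\<psi> e), tail K (\<psi> e))"
        by (auto simp: adj_def)
      have eG: "tail G e \<in> verts G" "head G e \<in> verts G" "e \<in> arcs G"
        using e S G by (auto simp: fin_digraph_iff)
      from e(2) show ?case
      proof
        assume "(y, z) = (tail K (\<psi> e), head K (\<psi> e))"
        then have "v = tail G e" "z = \<phi> (head G e)"
          using v(1) ends[OF eG(3)] inj vV eG by (auto dest: inj_onD)
        then show ?thesis
          using v(2) e(1) by (intro exI[of _ "head G e"]) (auto simp: adj_def intro: rtrancl_into_rtrancl)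
      next
        assume "(y, z) = (head K (\<psi> e), tail K (\<psi> e))"
        then have "v = head G e" "z = \<phi> (tail G e)"
          using v(1) ends[OF eG(3)] inj vV eG by (auto dest: inj_onD)
        then show ?thesis
          using v(2) e(1) by (intro exI[of _ "tail G e"]) (auto simp: adj_def intro: rtrancl_into_rtrancl)
      qed
    qed auto
    then show "w \<in> \<phi> ` {v. (u, v) \<in> (adj G S)\<^sup>*}" by auto
  next
    fix w assume "w \<in> \<phi> ` {v. (u, v) \<in> (adj G S)\<^sup>*}"
    then obtain v where v: "w = \<phi> v" "(u, v) \<in> (adj G S)\<^sup>*" by auto
    from v(2) have "(\<phi> u, \<phi> v) \<in> (adj K (\<psi> ` S))\<^sup>*"
    proof induction
      case (step y z)
      then obtain e where e: "e \<in> S" "(y, z) = (tail G e, head G e) \<or> (y, z) = (head G e, tail G e)"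
        by (auto simp: adj_def)
      then have "(\<phi> y, \<phi> z) \<in> adj K (\<psi> ` S)"
        using ends S by (force simp: adj_def)
      then show ?case using step by (auto intro: rtrancl_into_rtrancl)
    qed auto
    then show "w \<in> {w. (\<phi> u, w) \<in> (adj K (\<psi> ` S))\<^sup>*}" using v by simp
  }
qed

lemma quiver_iso_cut:
  assumes "quiver_iso \<phi> \<psi> G K" "S \<subseteq> arcs G"
  shows "quiver_iso \<phi> \<psi> (cut_subquiver G S) (cut_subquiver K (\<psi> ` S))"
  using assms by (auto simp: quiver_iso_def cut_subquiver_def intro: bij_betw_subset)

lemma connected_iso:
  assumes G: "fin_digraph G" and K: "fin_digraph K" and iso: "quiver_iso \<phi> \<psi> G K"
    and conn: "Digraph_Component.connected G"
  shows "Digraph_Component.connected K"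
proof -
  from iso have \<phi>: "\<phi> ` verts G = verts K" and \<psi>: "\<psi> ` arcs G = arcs K"
    by (auto simp: quiver_iso_def bij_betw_def)
  show ?thesis
    unfolding connected_iff[OF K]
  proof (intro conjI ballI)
    show "verts K \<noteq> {}" using conn \<phi> by (auto simp: connected_iff[OF G])
    fix u v assume "u \<in> verts K" "v \<in> verts K"
    then obtain u' v' where uv: "u = \<phi> u'" "v = \<phi> v'" "u' \<in> verts G" "v' \<in> verts G" using \<phi> by (metis imageE)
    then have "v \<in> \<phi> ` {v. (u', v) \<in> (adj G (arcs G))\<^sup>*}"
      using conn by (auto simp: connected_iff[OF G])
    then show "(u, v) \<in> (adj K (arcs K))\<^sup>*"
      using quiver_iso_rtrancl[OF G iso order.refl uv(3)] uv \<psi> by auto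
  qed
qed

lemma quiver_iso_inv:
  assumes "quiver_iso \<phi> \<psi> G K" "fin_digraph G"
  shows "quiver_iso (inv_into (verts G) \<phi>) (inv_into (arcs G) \<psi>) K G"
proof -
  from assms have \<phi>: "bij_betw \<phi> (verts G) (verts K)" and \<psi>: "bij_betw \<psi> (arcs G) (arcs K)"
    by (auto simp: quiver_iso_def)
  show ?thesis
    unfolding quiver_iso_def
  proof (intro conjI ballI)
    show "bij_betw (inv_into (verts G) \<phi>) (verts K) (verts G)"
      "bij_betw (inv_into (arcs G) \<psi>) (arcs K) (arcs G)"
      using \<phi> \<psi> by (auto intro: bij_betw_inv_into)
    fix e assume "e \<in> arcs K"
    then obtain d where d: "d \<in> arcs G" "e = \<psi> d" using \<psi> by (auto simp: bij_betw_def)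
    then have "inv_into (arcs G) \<psi> e = d" using \<psi> by (auto simp: bij_betw_def)
    then show "tail G (inv_into (arcs G) \<psi> e) = inv_into (verts G) \<phi> (tail K e)"
      "head G (inv_into (arcs G) \<psi> e) = inv_into (verts G) \<phi> (head K e)"
      using d assms \<phi> by (auto simp: quiver_iso_def bij_betw_def fin_digraph_iff)
  qed
qed

lemma quiver_iso_contract:
  assumes G: "fin_digraph G" and K: "fin_digraph K" and iso: "quiver_iso \<phi> \<psi> G K" and S: "S \<subseteq> arcs G"
  shows "quiver_iso (image \<phi>) \<psi> (contract G S) (contract K (\<psi> ` S))"
proof -
  from iso have \<phi>: "bij_betw \<phi> (verts G) (verts K)" and \<psi>: "bij_betw \<psi> (arcs G) (arcs K)"
    and ends: "\<And>e. e \<in> arcs G \<Longrightarrow> tail K (\<psi> e) = \<phi> (tail G e) \<and> head K (\<psi> e) = \<phi> (head G e)"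
    by (auto simp: quiver_iso_def)
  have S': "\<psi> ` S \<subseteq> arcs K" using S \<psi> by (auto simp: bij_betw_def)
  have wc: "weak_component (cut_subquiver K (\<psi> ` S)) (\<phi> u) = \<phi> ` weak_component (cut_subquiver G S) u"
    if "u \<in> verts G" for u
    using that \<phi> quiver_iso_rtrancl[OF G iso S that]
    by (simp add: weak_component_eq[OF G S] weak_component_eq[OF K S'] bij_betw_apply)
  have sub: "weak_component (cut_subquiver G S) u \<subseteq> verts G" if "u \<in> verts G" for u
    using that adj_rtrancl_in_verts[OF G S that] by (auto simp: weak_component_eq[OF G S])
  have "inj_on (image \<phi>) (weak_component (cut_subquiver G S) ` verts G)"
    using \<phi> sub by (intro inj_on_subset[OF inj_on_image_Pow[of \<phi> "verts G"]]) (auto simp: bij_betw_def)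
  moreover have "image \<phi> ` weak_component (cut_subquiver G S) ` verts G =
      weak_component (cut_subquiver K (\<psi> ` S)) ` verts K"
  proof -
    have "weak_component (cut_subquiver K (\<psi> ` S)) ` verts K =
        (\<lambda>u. weak_component (cut_subquiver K (\<psi> ` S)) (\<phi> u)) ` verts G"
      using \<phi> unfolding bij_betw_def by (metis image_image)
    also have "\<dots> = image \<phi> ` weak_component (cut_subquiver G S) ` verts G"
      unfolding image_image by (rule image_cong) (simp_all add: wc)
    finally show ?thesis by simp
  qed
  moreover have "bij_betw \<psi> (arcs G - S) (arcs K - \<psi> ` S)"
    using \<psi> S by (intro bij_betw_DiffI) (auto intro: bij_betw_subset dest: bij_betw_apply)
  moreover have "tail (contract K (\<psi> ` S)) (\<psi> e) = \<phi> ` tail (contract G S) e \<and>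
      head (contract K (\<psi> ` S)) (\<psi> e) = \<phi> ` head (contract G S) e" if "e \<in> arcs G" for e
    using ends[OF that] that G wc by (simp add: contract_def fin_digraph_iff)
  ultimately show ?thesis
    unfolding quiver_iso_def bij_betw_def by (simp add: contract_def)
qed

section \<open>Invariance and multiplicativity of \<open>\<omega>\<close>\<close>

lemma omega_sum:
  assumes "fin_digraph G"
  shows "(\<Sum>S\<in>Pow (arcs G). omega \<beta> (cut_subquiver G S) * e_quiver \<beta> (contract G S)) = counit G"
  using assms is_omega_omega[of \<beta>] unfolding is_omega_def by blast

text \<open>
  The defining recursion of \<open>\<omega>\<close> determines the value at \<open>G\<close> from the values at its proper cut-subquivers,
  because \<open>e\<close> does not vanish on the arcless quiver \<open>G/G\<close>.
\<close>

lemma omega_eqI: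
  assumes G: "fin_digraph G"
    and eq: "x * e_quiver \<beta> (contract G (arcs G)) +
      (\<Sum>S\<in>Pow (arcs G) - {arcs G}. omega \<beta> (cut_subquiver G S) * e_quiver \<beta> (contract G S)) = counit G"
  shows "omega \<beta> G = x"
proof -
  have "omega \<beta> G * e_quiver \<beta> (contract G (arcs G)) = x * e_quiver \<beta> (contract G (arcs G))"
    using omega_sum[OF G, of \<beta>] eq unfolding sum_Pow_arcs[OF G] by linarith
  then show ?thesis using e_quiver_contract_all_nonzero[OF G, of \<beta>] by simp
qed

lemma omega_iso:
  assumes "fin_digraph G" "fin_digraph K" "quiver_iso \<phi> \<psi> G K"
    and "\<And>e. e \<in> arcs G \<Longrightarrow> \<beta>' (\<psi> e) = \<beta> e"
  shows "omega \<beta> G = omega \<beta>' K"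
  using assms
proof (induction "card (arcs G)" arbitrary: G K rule: less_induct)
  case less
  note G = less.prems(1) and K = less.prems(2) and iso = less.prems(3) and \<beta> = less.prems(4)
  from iso have \<psi>: "bij_betw \<psi> (arcs G) (arcs K)" by (auto simp: quiver_iso_def)
  have finG: "finite (arcs G)" using G by (simp add: fin_digraph_iff)
  have imG: "\<psi> ` arcs G = arcs K" using \<psi> by (simp add: bij_betw_def)
  have e: "e_quiver \<beta> (contract G S) = e_quiver \<beta>' (contract K (\<psi> ` S))" if "S \<subseteq> arcs G" for S
    by (rule e_quiver_iso[OF fin_digraph_contract[OF G] fin_digraph_contract[OF K]
          quiver_iso_contract[OF G K iso that]]) (auto simp: contract_def \<beta>)
  have w: "omega \<beta> (cut_subquiver G S) = omega \<beta>' (cut_subquiver K (\<psi> ` S))"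
    if "S \<in> Pow (arcs G) - {arcs G}" for S
  proof (rule less.hyps)
    show "card (arcs (cut_subquiver G S)) < card (arcs G)"
      using that finG by (auto intro!: psubset_card_mono)
    show "fin_digraph (cut_subquiver G S)" "fin_digraph (cut_subquiver K (\<psi> ` S))"
      using that imG by (auto intro!: fin_digraph_cut_subquiver G K)
    show "quiver_iso \<phi> \<psi> (cut_subquiver G S) (cut_subquiver K (\<psi> ` S))"
      using that by (intro quiver_iso_cut[OF iso]) auto
  qed (use that \<beta> in auto)
  have bij: "bij_betw (image \<psi>) (Pow (arcs G)) (Pow (arcs K))"
    using \<psi> by (rule bij_betw_Pow)
  have "bij_betw (image \<psi>) (Pow (arcs G) - {arcs G}) (Pow (arcs K) - {arcs K})"
    using bij by (rule bij_betw_DiffI) (auto simp: imG)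
  then have "(\<Sum>S\<in>Pow (arcs K) - {arcs K}. omega \<beta>' (cut_subquiver K S) * e_quiver \<beta>' (contract K S)) =
     (\<Sum>S\<in>Pow (arcs G) - {arcs G}. omega \<beta>' (cut_subquiver K (\<psi> ` S)) * e_quiver \<beta>' (contract K (\<psi> ` S)))"
    by (rule sum.reindex_bij_betw[symmetric])
  also have "\<dots> = (\<Sum>S\<in>Pow (arcs G) - {arcs G}. omega \<beta> (cut_subquiver G S) * e_quiver \<beta> (contract G S))"
    by (intro sum.cong refl arg_cong2[where f = "(*)"]) (use w e in auto)
  finally have "omega \<beta>' K * e_quiver \<beta> (contract G (arcs G)) +
     (\<Sum>S\<in>Pow (arcs G) - {arcs G}. omega \<beta> (cut_subquiver G S) * e_quiver \<beta> (contract G S)) = counit K"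
    using omega_sum[OF K, of \<beta>'] unfolding sum_Pow_arcs[OF K] by (simp add: e imG)
  also have "counit K = counit G" using imG by (auto simp: counit_def)
  finally show ?case by (intro omega_eqI[OF G])
qed

lemma omega_no_arcs:
  assumes G: "fin_digraph G" and no: "arcs G = {}"
  shows "omega \<beta> G = 1"
proof (rule omega_eqI[OF G])
  have "e_quiver \<beta> (contract G (arcs G)) = 1"
    unfolding e_quiver_eq[OF fin_digraph_contract[OF G]]
    using G by (simp add: contract_def fin_digraph_iff)
  then show "1 * e_quiver \<beta> (contract G (arcs G)) +
      (\<Sum>S\<in>Pow (arcs G) - {arcs G}. omega \<beta> (cut_subquiver G S) * e_quiver \<beta> (contract G S)) = counit G"
    by (simp add: no counit_def)
qed

lemma sum_Pow_Un:
  assumes "finite A" "finite B" "A \<inter> B = {}"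
  shows "(\<Sum>S\<in>Pow (A \<union> B). f S) = (\<Sum>S\<in>Pow A. \<Sum>T\<in>Pow B. f (S \<union> T))"
proof -
  have "(\<Sum>S\<in>Pow (A \<union> B). f S) = (\<Sum>(S, T)\<in>Pow A \<times> Pow B. f (S \<union> T))"
    by (rule sum.reindex_bij_witness[of _ "\<lambda>(S, T). S \<union> T" "\<lambda>S. (S \<inter> A, S \<inter> B)"])
       (use assms(3) in \<open>auto intro!: arg_cong[of _ _ f]\<close>)
  then show ?thesis by (simp add: sum.cartesian_product)
qed

text \<open>
  The subquiver with vertices \<open>V\<close> and arcs \<open>A\<close>; that the arcs in \<open>A\<close> have their ends in \<open>V\<close> is left to
  the places of use.
\<close>

definition sub_quiver :: "('v, 'e) pre_digraph \<Rightarrow> 'v set \<Rightarrow> 'e set \<Rightarrow> ('v, 'e) pre_digraph" where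
  "sub_quiver G V A = G\<lparr>verts := V, arcs := A\<rparr>"

lemma sub_quiver_simps [simp]:
  "verts (sub_quiver G V A) = V" "arcs (sub_quiver G V A) = A"
  "tail (sub_quiver G V A) = tail G" "head (sub_quiver G V A) = head G"
  "cut_subquiver (sub_quiver G V A) S = sub_quiver G V S"
  by (simp_all add: sub_quiver_def cut_subquiver_def)

lemma cut_simps [simp]:
  "verts (cut_subquiver G S) = verts G" "tail (cut_subquiver G S) = tail G" "head (cut_subquiver G S) = head G"
  by (simp_all add: cut_subquiver_def)

lemma rtrancl_disjoint_union:
  assumes "R1 \<subseteq> V1 \<times> V1" "R2 \<subseteq> V2 \<times> V2" "V1 \<inter> V2 = {}" "u \<in> V1"
  shows "(u, v) \<in> (R1 \<union> R2)\<^sup>* \<longleftrightarrow> (u, v) \<in> R1\<^sup>*"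
proof
  assume "(u, v) \<in> (R1 \<union> R2)\<^sup>*"
  then have "(u, v) \<in> R1\<^sup>* \<and> v \<in> V1"
    by induction (use assms in \<open>auto intro: rtrancl_into_rtrancl\<close>)
  then show "(u, v) \<in> R1\<^sup>*" ..
qed (meson Un_upper1 in_mono rtrancl_mono)

text \<open>
  By induction on the number of arcs: the product of the two defining sums has the same terms as the
  defining sum of the union, except possibly the one that contains \<open>\<omega>(G)\<close> itself.
\<close>

lemma omega_disjoint_union:
  assumes "fin_digraph G" "verts G = V1 \<union> V2" "V1 \<inter> V2 = {}" "arcs G = A1 \<union> A2"
    and "\<And>e. e \<in> A1 \<Longrightarrow> tail G e \<in> V1 \<and> head G e \<in> V1"
    and "\<And>e. e \<in> A2 \<Longrightarrow> tail G e \<in> V2 \<and> head G e \<in> V2"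
  shows "omega \<beta> G = omega \<beta> (sub_quiver G V1 A1) * omega \<beta> (sub_quiver G V2 A2)"
  using assms
proof (induction "card (arcs G)" arbitrary: G A1 A2 rule: less_induct)
  case less
  note G = less.prems(1) and V = less.prems(2,3) and A = less.prems(4)
    and e1 = less.prems(5) and e2 = less.prems(6)
  let ?G1 = "sub_quiver G V1 A1" and ?G2 = "sub_quiver G V2 A2"
  have fin: "finite A1" "finite A2" "finite V1" "finite V2"
    using G V A by (auto simp: fin_digraph_iff)
  have AA: "A1 \<inter> A2 = {}" using e1 e2 V by blast
  have G1: "fin_digraph ?G1" and G2: "fin_digraph ?G2"
    using fin e1 e2 by (auto simp: fin_digraph_iff)
  have e: "e_quiver \<beta> (contract G (S1 \<union> S2)) = e_quiver \<beta> (contract ?G1 S1) * e_quiver \<beta> (contract ?G2 S2)"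
    if S: "S1 \<subseteq> A1" "S2 \<subseteq> A2" for S1 S2
  proof (rule e_quiver_disjoint_union[OF fin_digraph_contract[OF G1] fin_digraph_contract[OF G2] fin_digraph_contract[OF G]])
    have adjs: "adj G (S1 \<union> S2) = adj G S1 \<union> adj G S2" "adj ?G1 S1 = adj G S1" "adj ?G2 S2 = adj G S2"
      by (auto simp: adj_def)
    have sub: "adj G S1 \<subseteq> V1 \<times> V1" "adj G S2 \<subseteq> V2 \<times> V2"
      using S e1 e2 by (auto simp: adj_def)
    have wc1: "weak_component (cut_subquiver G (S1 \<union> S2)) u = weak_component (cut_subquiver ?G1 S1) u"
      if "u \<in> V1" for u
    proof -
      have "weak_component (cut_subquiver G (S1 \<union> S2)) u = {v. (u, v) \<in> (adj G (S1 \<union> S2))\<^sup>*}"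
        using S that V A by (intro weak_component_eq[OF G]) auto
      also have "\<dots> = {v. (u, v) \<in> (adj ?G1 S1)\<^sup>*}"
        unfolding adjs using rtrancl_disjoint_union[OF sub V(2) that] by simp
      also have "\<dots> = weak_component (cut_subquiver ?G1 S1) u"
        using S that by (intro weak_component_eq[OF G1, symmetric]) auto
      finally show ?thesis .
    qed
    have wc2: "weak_component (cut_subquiver G (S1 \<union> S2)) u = weak_component (cut_subquiver ?G2 S2) u"
      if "u \<in> V2" for u
    proof -
      have "weak_component (cut_subquiver G (S1 \<union> S2)) u = {v. (u, v) \<in> (adj G (S1 \<union> S2))\<^sup>*}"
        using S that V A by (intro weak_component_eq[OF G]) auto
      also have "\<dots> = {v. (u, v) \<in> (adj ?G2 S2)\<^sup>*}"
        unfolding adjs using rtrancl_disjoint_union[OF sub(2,1) _ that] V(2) by (simp add: Un_commute Int_commute)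
      also have "\<dots> = weak_component (cut_subquiver ?G2 S2) u"
        using S that by (intro weak_component_eq[OF G2, symmetric]) auto
      finally show ?thesis .
    qed
    show "verts (contract G (S1 \<union> S2)) = verts (contract ?G1 S1) \<union> verts (contract ?G2 S2)"
      using V(1) wc1 wc2 by (auto simp: contract_def image_Un cong: image_cong simp del: sub_quiver_simps(5))
    have ne: "weak_component (cut_subquiver ?G1 S1) u \<inter> weak_component (cut_subquiver ?G2 S2) v = {} \<and>
        u \<in> weak_component (cut_subquiver ?G1 S1) u"
      if uv: "u \<in> V1" "v \<in> V2" for u v
    proof -
      have 1: "weak_component (cut_subquiver ?G1 S1) u = {x. (u, x) \<in> (adj ?G1 S1)\<^sup>*}"
        "\<And>x. (u, x) \<in> (adj ?G1 S1)\<^sup>* \<Longrightarrow> x \<in> V1"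
        using weak_component_eq[OF G1, of S1 u] adj_rtrancl_in_verts[OF G1, of S1 u] uv S by simp_all
      have 2: "weak_component (cut_subquiver ?G2 S2) v = {x. (v, x) \<in> (adj ?G2 S2)\<^sup>*}"
        "\<And>x. (v, x) \<in> (adj ?G2 S2)\<^sup>* \<Longrightarrow> x \<in> V2"
        using weak_component_eq[OF G2, of S2 v] adj_rtrancl_in_verts[OF G2, of S2 v] uv S by simp_all
      show ?thesis
        unfolding 1(1) 2(1) using 1(2) 2(2) V(2) by blast
    qed
    show "verts (contract ?G1 S1) \<inter> verts (contract ?G2 S2) = {}"
    proof (rule ccontr)
      assume "verts (contract ?G1 S1) \<inter> verts (contract ?G2 S2) \<noteq> {}"
      then obtain u v where "u \<in> V1" "v \<in> V2"
        "weak_component (cut_subquiver ?G1 S1) u = weak_component (cut_subquiver ?G2 S2) v"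
        by (auto simp: contract_def simp del: sub_quiver_simps(5))
      then show False using ne[of u v] by auto
    qed
    show "arcs (contract G (S1 \<union> S2)) = arcs (contract ?G1 S1) \<union> arcs (contract ?G2 S2)"
      "arcs (contract ?G1 S1) \<inter> arcs (contract ?G2 S2) = {}"
      using S A AA by (auto simp: contract_def)
    show "tail (contract G (S1 \<union> S2)) a = tail (contract ?G1 S1) a \<and>
        head (contract G (S1 \<union> S2)) a = head (contract ?G1 S1) a" if "a \<in> arcs (contract ?G1 S1)" for a
      using that e1 wc1 by (auto simp: contract_def simp del: sub_quiver_simps(5))
    show "tail (contract G (S1 \<union> S2)) a = tail (contract ?G2 S2) a \<and>
        head (contract G (S1 \<union> S2)) a = head (contract ?G2 S2) a" if "a \<in> arcs (contract ?G2 S2)" for a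
      using that e2 wc2 by (auto simp: contract_def simp del: sub_quiver_simps(5))
  qed
  define W where "W S = omega \<beta> (sub_quiver G V1 (S \<inter> A1)) * omega \<beta> (sub_quiver G V2 (S \<inter> A2))" for S
  have IH: "omega \<beta> (cut_subquiver G S) = W S" if S: "S \<in> Pow (arcs G) - {arcs G}" for S
  proof -
    have "omega \<beta> (cut_subquiver G S) =
        omega \<beta> (sub_quiver (cut_subquiver G S) V1 (S \<inter> A1)) * omega \<beta> (sub_quiver (cut_subquiver G S) V2 (S \<inter> A2))"
    proof (rule less.hyps)
      show "card (arcs (cut_subquiver G S)) < card (arcs G)"
        using S fin A by (auto intro!: psubset_card_mono)
      show "fin_digraph (cut_subquiver G S)" using S by (intro fin_digraph_cut_subquiver[OF G]) auto
    qed (use S V A e1 e2 in auto)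
    then show ?thesis by (simp add: W_def sub_quiver_def cut_subquiver_def)
  qed
  have "(\<Sum>S\<in>Pow (arcs G). W S * e_quiver \<beta> (contract G S)) =
     (\<Sum>S1\<in>Pow A1. \<Sum>S2\<in>Pow A2. W (S1 \<union> S2) * e_quiver \<beta> (contract G (S1 \<union> S2)))"
    unfolding A by (rule sum_Pow_Un[OF fin(1,2) AA])
  also have "\<dots> = (\<Sum>S1\<in>Pow A1. \<Sum>S2\<in>Pow A2.
      (omega \<beta> (cut_subquiver ?G1 S1) * e_quiver \<beta> (contract ?G1 S1)) *
      (omega \<beta> (cut_subquiver ?G2 S2) * e_quiver \<beta> (contract ?G2 S2)))"
  proof (intro sum.cong refl)
    fix S1 S2 assume S: "S1 \<in> Pow A1" "S2 \<in> Pow A2"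
    then have "(S1 \<union> S2) \<inter> A1 = S1" "(S1 \<union> S2) \<inter> A2 = S2" using AA by auto
    then show "W (S1 \<union> S2) * e_quiver \<beta> (contract G (S1 \<union> S2)) =
      (omega \<beta> (cut_subquiver ?G1 S1) * e_quiver \<beta> (contract ?G1 S1)) *
      (omega \<beta> (cut_subquiver ?G2 S2) * e_quiver \<beta> (contract ?G2 S2))"
      using e[of S1 S2] S by (simp add: W_def)
  qed
  also have "\<dots> = counit ?G1 * counit ?G2"
    using omega_sum[OF G1, of \<beta>] omega_sum[OF G2, of \<beta>] by (simp add: sum_product[symmetric])
  also have "\<dots> = counit G" using A by (simp add: counit_def)
  finally have "W (arcs G) * e_quiver \<beta> (contract G (arcs G)) +
      (\<Sum>S\<in>Pow (arcs G) - {arcs G}. W S * e_quiver \<beta> (contract G S)) = counit G"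
    using fin A by (subst (asm) sum.remove[of _ "arcs G"]) auto
  moreover have "(\<Sum>S\<in>Pow (arcs G) - {arcs G}. W S * e_quiver \<beta> (contract G S)) =
      (\<Sum>S\<in>Pow (arcs G) - {arcs G}. omega \<beta> (cut_subquiver G S) * e_quiver \<beta> (contract G S))"
    by (intro sum.cong refl) (simp add: IH)
  ultimately have "omega \<beta> G = W (arcs G)" by (intro omega_eqI[OF G]) simp
  also have "\<dots> = omega \<beta> ?G1 * omega \<beta> ?G2"
    using A AA by (simp add: W_def Int_absorb1)
  finally show ?case .
qed

section \<open>The colored generating identity\<close>

text \<open>
  The RB graph with vertex set \<open>V\<close> and arc set \<open>E\<close>, where \<open>g e\<close> lists tail, head and color of \<open>e\<close>.
\<close>

definition rb :: "'v set \<Rightarrow> 'e set \<Rightarrow> ('e \<Rightarrow> 'v \<times> 'v \<times> color) \<Rightarrow> ('v, 'e) rb_graph" where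
  "rb V E g = (\<lparr>verts = V, arcs = E, tail = (\<lambda>e. fst (g e)), head = (\<lambda>e. fst (snd (g e)))\<rparr>,
     (\<lambda>e. snd (snd (g e))))"

lemma rb_simps [simp]:
  "verts (fst (rb V E g)) = V" "arcs (fst (rb V E g)) = E"
  "tail (fst (rb V E g)) = (\<lambda>e. fst (g e))" "head (fst (rb V E g)) = (\<lambda>e. fst (snd (g e)))"
  "snd (rb V E g) = (\<lambda>e. snd (snd (g e)))"
  by (simp_all add: rb_def)

lemma sub_quiver_rb [simp]: "sub_quiver (fst (rb V E g)) V' E' = fst (rb V' E' g)"
  by (simp add: sub_quiver_def rb_def)

lemma cut_subquiver_rb [simp]: "cut_subquiver (fst (rb V E g)) E' = fst (rb V E' g)"
  by (simp add: cut_subquiver_def rb_def)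

text \<open>The arcs of \<open>E\<close> with both ends in \<open>x\<close>.\<close>

definition arcs_within :: "'v set \<Rightarrow> 'e set \<Rightarrow> ('e \<Rightarrow> 'v \<times> 'v \<times> color) \<Rightarrow> 'e set" where
  "arcs_within x E g = {e \<in> E. fst (g e) \<in> x \<and> fst (snd (g e)) \<in> x}"

text \<open>The blue arcs among \<open>E\<close>.\<close>

definition blue_arcs :: "'e set \<Rightarrow> ('e \<Rightarrow> 'v \<times> 'v \<times> color) \<Rightarrow> 'e set" where
  "blue_arcs E g = {e \<in> E. snd (snd (g e)) = Blue}"

text \<open>The specialization \<open>\<beta> = 1\<close> on red and \<open>\<beta> = -1\<close> on blue arcs.\<close>

definition color_beta :: "('e \<Rightarrow> 'v \<times> 'v \<times> color) \<Rightarrow> 'e \<Rightarrow> real" where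
  "color_beta g = (\<lambda>e. case snd (snd (g e)) of Red \<Rightarrow> 1 | Blue \<Rightarrow> - 1)"

lemma omega_RB_c_rb:
  "omega_RB_c (rb V E g) = (-1) ^ card (blue_arcs E g) * omega_c (color_beta g) (fst (rb V E g))"
  by (simp add: omega_RB_c_def arcs_of_color_def blue_arcs_def color_beta_def)

text \<open>
  An arc between \<open>x\<close> and \<open>y\<close> in the direction that its color allows: red arcs go from \<open>x\<close> to \<open>y\<close>,
  blue arcs from \<open>y\<close> to \<open>x\<close>.
\<close>

definition crosses :: "'v set \<Rightarrow> 'v set \<Rightarrow> 'v \<times> 'v \<times> color \<Rightarrow> bool" where
  "crosses x y a \<longleftrightarrow> (case snd (snd a) of
     Red \<Rightarrow> fst a \<in> x \<and> fst (snd a) \<in> y | Blue \<Rightarrow> fst (snd a) \<in> x \<and> fst a \<in> y)"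

text \<open>
  Every arc lies within one block, or goes from an earlier to a later block if it is red and from a
  later to an earlier block if it is blue.
\<close>

definition compatible_blocks :: "'e set \<Rightarrow> ('e \<Rightarrow> 'v \<times> 'v \<times> color) \<Rightarrow> 'v set list \<Rightarrow> bool" where
  "compatible_blocks E g xs \<longleftrightarrow> (\<forall>e\<in>E. (\<exists>x\<in>set xs. fst (g e) \<in> x \<and> fst (snd (g e)) \<in> x) \<or>
     (\<exists>x y. x \<noteq> y \<and> (x, y) \<in> list_order xs \<and> crosses x y (g e)))"

text \<open>Ordered set partitions into nonempty blocks.\<close>

definition ordered_partitions :: "'v set \<Rightarrow> 'v set list set" where
  "ordered_partitions V = {xs. distinct xs \<and> partition_on V (set xs)}"

lemma finite_ordered_partitions:
  assumes "finite V"
  shows "finite (ordered_partitions V)"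
proof (rule finite_subset)
  have "length xs \<le> card (Pow V)" if "distinct xs" "set xs \<subseteq> Pow V" for xs :: "'a set list"
    using that assms by (metis card_mono distinct_card finite_Pow_iff)
  then show "ordered_partitions V \<subseteq> {xs. set xs \<subseteq> Pow V \<and> length xs \<le> card (Pow V)}"
    by (auto simp: ordered_partitions_def partition_on_def)
  show "finite {xs. set xs \<subseteq> Pow V \<and> length xs \<le> card (Pow V)}"
    using assms by (intro finite_lists_length_le) simp
qed

text \<open>
  Weights are multiplicative over the blocks of a partition, where only the arcs within blocks are kept.
\<close>

lemma omega_rb_partition:
  assumes "finite P" "\<And>x. x \<in> P \<Longrightarrow> finite x" "finite E"
    and "\<And>x y. x \<in> P \<Longrightarrow> y \<in> P \<Longrightarrow> x \<noteq> y \<Longrightarrow> x \<inter> y = {}"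
  shows "omega \<beta> (fst (rb (\<Union>P) (\<Union>x\<in>P. arcs_within x E g) g)) =
      (\<Prod>x\<in>P. omega \<beta> (fst (rb x (arcs_within x E g) g)))
    \<and> (-1 :: real) ^ card (blue_arcs (\<Union>x\<in>P. arcs_within x E g) g) =
      (\<Prod>x\<in>P. (-1) ^ card (blue_arcs (arcs_within x E g) g))"
  using assms(1,2,4)
proof (induction P rule: finite_induct)
  case empty
  show ?case using assms by (simp add: blue_arcs_def omega_no_arcs fin_digraph_iff)
next
  case (insert x P)
  let ?A = "\<Union>x\<in>P. arcs_within x E g" and ?B = "arcs_within x E g"
  have disj: "x \<inter> \<Union>P = {}" using insert.prems(2)[of x] insert.hyps by fastforce
  have "omega \<beta> (fst (rb (\<Union>(insert x P)) (\<Union>x\<in>insert x P. arcs_within x E g) g)) =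
      omega \<beta> (sub_quiver (fst (rb (\<Union>(insert x P)) (\<Union>x\<in>insert x P. arcs_within x E g) g)) x ?B) *
      omega \<beta> (sub_quiver (fst (rb (\<Union>(insert x P)) (\<Union>x\<in>insert x P. arcs_within x E g) g)) (\<Union>P) ?A)"
    by (rule omega_disjoint_union)
       (use disj insert assms(3) in \<open>auto simp: fin_digraph_iff arcs_within_def\<close>)
  moreover have "blue_arcs (\<Union>x\<in>insert x P. arcs_within x E g) g = blue_arcs ?B g \<union> blue_arcs ?A g"
    by (auto simp: blue_arcs_def)
  moreover have "card (blue_arcs ?B g \<union> blue_arcs ?A g) = card (blue_arcs ?B g) + card (blue_arcs ?A g)"
  proof (rule card_Un_disjoint)
    have "blue_arcs ?B g \<subseteq> E" "blue_arcs ?A g \<subseteq> E" by (auto simp: blue_arcs_def arcs_within_def)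
    then show "finite (blue_arcs ?B g)" "finite (blue_arcs ?A g)" using assms(3) finite_subset by blast+
    show "blue_arcs ?B g \<inter> blue_arcs ?A g = {}"
      using disj by (auto simp: blue_arcs_def arcs_within_def)
  qed
  ultimately show ?case using insert by (simp add: power_add)
qed

text \<open>A fixed finite RB graph on the vertices \<open>V\<close> with arcs \<open>E\<close>.\<close>

locale finite_rb =
  fixes V :: "'v set" and E :: "'e set" and g :: "'e \<Rightarrow> 'v \<times> 'v \<times> color"
  assumes finV: "finite V" and finE: "finite E" and g: "g \<in> E \<rightarrow> V \<times> V \<times> UNIV"
begin

text \<open>The component of a vertex in the cut-subquiver with arcs \<open>S\<close>.\<close>

definition comp :: "'e set \<Rightarrow> 'v \<Rightarrow> 'v set" where
  "comp S = weak_component (fst (rb V S g))"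

text \<open>Tail and head of an arc.\<close>

definition t :: "'e \<Rightarrow> 'v" where "t e = fst (g e)"
definition h :: "'e \<Rightarrow> 'v" where "h e = fst (snd (g e))"

lemma ends: "e \<in> E \<Longrightarrow> t e \<in> V" "e \<in> E \<Longrightarrow> h e \<in> V"
  using g by (auto simp: t_def h_def Pi_iff mem_Times_iff)

lemma fin_sub: "S \<subseteq> E \<Longrightarrow> fin_digraph (fst (rb V S g))"
  using finV finE ends by (auto simp: fin_digraph_iff t_def h_def intro: finite_subset)

text \<open>Connectedness by undirected paths with arcs in \<open>S\<close>.\<close>

definition conn :: "'e set \<Rightarrow> ('v \<times> 'v) set" where
  "conn S = (\<Union>e\<in>S. {(t e, h e), (h e, t e)})\<^sup>*"

lemma adj_rb: "adj (fst (rb U A g)) S = (\<Union>e\<in>S. {(t e, h e), (h e, t e)})"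
  by (simp add: adj_def t_def h_def)

lemma comp_eq: "S \<subseteq> E \<Longrightarrow> u \<in> V \<Longrightarrow> comp S u = {v. (u, v) \<in> conn S}"
  using weak_component_eq[OF fin_sub[of S], of S u] by (simp add: comp_def conn_def adj_rb)

lemma conn_sym: "(u, v) \<in> conn S \<Longrightarrow> (v, u) \<in> conn S"
  unfolding conn_def by (rule symD[OF sym_rtrancl]) (auto simp: sym_def)

lemma conn_trans: "(u, v) \<in> conn S \<Longrightarrow> (v, w) \<in> conn S \<Longrightarrow> (u, w) \<in> conn S"
  by (simp add: conn_def)

lemma conn_refl: "(u, u) \<in> conn S"
  by (simp add: conn_def)

lemma conn_arc: "e \<in> S \<Longrightarrow> (t e, h e) \<in> conn S"
  unfolding conn_def by (rule r_into_rtrancl) auto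

lemma conn_verts: "S \<subseteq> E \<Longrightarrow> u \<in> V \<Longrightarrow> (u, v) \<in> conn S \<Longrightarrow> v \<in> V"
  using adj_rtrancl_in_verts[OF fin_sub[of S], of S u v] by (simp add: conn_def adj_rb)

lemma comp_eq_iff:
  assumes "S \<subseteq> E" "u \<in> V" "v \<in> V"
  shows "comp S u = comp S v \<longleftrightarrow> (u, v) \<in> conn S"
proof
  assume "comp S u = comp S v"
  then show "(u, v) \<in> conn S" using assms conn_refl[of v S] by (auto simp: comp_eq)
next
  assume "(u, v) \<in> conn S"
  then have "(u, w) \<in> conn S \<longleftrightarrow> (v, w) \<in> conn S" for w
    using conn_trans[of v u S w] conn_trans[of u v S w] conn_sym by blast
  then show "comp S u = comp S v" using assms by (simp add: comp_eq)
qed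

text \<open>The components of the cut-subquiver with arcs \<open>S\<close>, that is, the vertices of the contraction.\<close>

definition blocks :: "'e set \<Rightarrow> 'v set set" where
  "blocks S = comp S ` V"

lemma comp_self: "S \<subseteq> E \<Longrightarrow> u \<in> V \<Longrightarrow> u \<in> comp S u"
  by (simp add: comp_eq conn_refl)

lemma comp_memD:
  assumes "S \<subseteq> E" "u \<in> V" "v \<in> comp S u"
  shows "v \<in> V" "comp S v = comp S u"
proof -
  have uv: "(u, v) \<in> conn S" using assms by (simp add: comp_eq)
  show "v \<in> V" using conn_verts[OF assms(1,2) uv] .
  then show "comp S v = comp S u" using comp_eq_iff[OF assms(1) _ assms(2)] conn_sym[OF uv] by simp
qed

lemma partition_blocks:
  assumes S: "S \<subseteq> E"
  shows "partition_on V (blocks S)"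
proof (rule partition_onI)
  show "\<Union> (blocks S) = V"
    using comp_self[OF S] comp_memD(1)[OF S] by (auto simp: blocks_def)
  show "disjnt p q" if "p \<in> blocks S" "q \<in> blocks S" "p \<noteq> q" for p q
  proof -
    from that obtain u v where uv: "u \<in> V" "p = comp S u" "v \<in> V" "q = comp S v"
      by (auto simp: blocks_def)
    have False if "w \<in> p" "w \<in> q" for w
      using comp_memD(2)[OF S uv(1), of w] comp_memD(2)[OF S uv(3), of w] that uv \<open>p \<noteq> q\<close> by simp
    then show ?thesis by (auto simp: disjnt_def)
  qed
  show "{} \<notin> blocks S"
    using comp_self[OF S] by (auto simp: blocks_def)
qed

text \<open>
  If contracting \<open>S\<close> leaves no tadpoles, then \<open>S\<close> consists of all arcs within its components, and so is
  determined by the partition into components.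
\<close>

lemma arcs_within_blocks:
  assumes S: "S \<subseteq> E" and no_tadpoles: "\<And>e. e \<in> E - S \<Longrightarrow> comp S (t e) \<noteq> comp S (h e)"
  shows "(\<Union>x\<in>blocks S. arcs_within x E g) = S"
proof (intro equalityI subsetI)
  fix e assume e: "e \<in> S"
  have eE: "e \<in> E" using e S by auto
  have "e \<in> arcs_within (comp S (t e)) E g"
    using conn_arc[OF e] conn_refl eE comp_eq[OF S ends(1)[OF eE]]
    by (auto simp: arcs_within_def t_def[symmetric] h_def[symmetric])
  then show "e \<in> (\<Union>x\<in>blocks S. arcs_within x E g)"
    using e S ends[of e] by (auto simp: blocks_def)
next
  fix e assume "e \<in> (\<Union>x\<in>blocks S. arcs_within x E g)"
  then obtain u where u: "u \<in> V" "e \<in> E" "t e \<in> comp S u" "h e \<in> comp S u"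
    by (auto simp: blocks_def arcs_within_def t_def h_def)
  have "comp S (t e) = comp S (h e)"
    using comp_memD(2)[OF S u(1) u(3)] comp_memD(2)[OF S u(1) u(4)] by simp
  then show "e \<in> S" using no_tadpoles[of e] u by auto
qed

lemma connected_block:
  assumes S: "S \<subseteq> E" and x: "x \<in> blocks S"
  shows "Digraph_Component.connected (fst (rb x (arcs_within x E g) g))"
proof -
  obtain u where u: "u \<in> V" "x = comp S u" using x by (auto simp: blocks_def)
  have xV: "x \<subseteq> V" using u comp_memD(1)[OF S u(1)] by auto
  have x_iff: "v \<in> x \<longleftrightarrow> (u, v) \<in> conn S" for v using u by (simp add: comp_eq[OF S])
  have fin: "fin_digraph (fst (rb x (arcs_within x E g) g))"
    using xV finV finE by (auto simp: fin_digraph_iff arcs_within_def intro: finite_subset)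
  have path: "(v, w) \<in> (\<Union>e\<in>arcs_within x E g. {(t e, h e), (h e, t e)})\<^sup>* \<and> w \<in> x"
    if "v \<in> x" "(v, w) \<in> conn S" for v w
    using that(2) unfolding conn_def
  proof induction
    case base then show ?case using that by simp
  next
    case (step y z)
    then obtain e where e: "e \<in> S" "(y, z) = (t e, h e) \<or> (y, z) = (h e, t e)" by auto
    have "(y, z) \<in> conn S" unfolding conn_def by (rule r_into_rtrancl) fact
    moreover have "y \<in> x" using step by blast
    ultimately have "z \<in> x" using conn_trans[of u y S z] by (simp add: x_iff)
    then have "e \<in> arcs_within x E g"
      using \<open>y \<in> x\<close> e S by (auto simp: arcs_within_def t_def h_def)
    then have "(y, z) \<in> (\<Union>e\<in>arcs_within x E g. {(t e, h e), (h e, t e)})" using e(2) by auto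
    then show ?case using step.IH \<open>z \<in> x\<close> by (blast intro: rtrancl_into_rtrancl)
  qed
  have "u \<in> x" by (simp add: x_iff conn_refl)
  moreover have "(v, w) \<in> conn S" if "v \<in> x" "w \<in> x" for v w
    using that conn_trans[OF conn_sym[of u v S]] by (simp add: x_iff)
  ultimately show ?thesis
    unfolding connected_iff[OF fin] adj_rb rb_simps using path by blast
qed

lemma blocks_of_partition:
  assumes P: "partition_on V P"
    and conn: "\<And>x. x \<in> P \<Longrightarrow> Digraph_Component.connected (fst (rb x (arcs_within x E g) g))"
  defines "S \<equiv> \<Union>x\<in>P. arcs_within x E g"
  shows "S \<subseteq> E" "blocks S = P" "\<And>e. e \<in> E - S \<Longrightarrow> comp S (t e) \<noteq> comp S (h e)"
proof -
  show S: "S \<subseteq> E" by (auto simp: S_def arcs_within_def)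
  have P': "V = \<Union>P" "\<And>x y. x \<in> P \<Longrightarrow> y \<in> P \<Longrightarrow> x \<noteq> y \<Longrightarrow> x \<inter> y = {}"
    using P by (auto simp: partition_on_def disjoint_def)
  have comp: "comp S u = x" if u: "u \<in> x" and x: "x \<in> P" for u x
  proof -
    have uV: "u \<in> V" using u x P' by auto
    have xV: "x \<subseteq> V" using x P' by auto
    have fin: "fin_digraph (fst (rb x (arcs_within x E g) g))"
      using xV finV finE by (auto simp: fin_digraph_iff arcs_within_def intro: finite_subset)
    have "v \<in> x" if "(u, v) \<in> conn S" for v
      using that unfolding conn_def
    proof induction
      case (step y z)
      then obtain e where e: "e \<in> S" "(y, z) = (t e, h e) \<or> (y, z) = (h e, t e)" by auto
      obtain x' where x': "x' \<in> P" "t e \<in> x'" "h e \<in> x'"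
        using e(1) by (auto simp: S_def arcs_within_def t_def h_def)
      then have "x' = x" using P'(2)[of x' x] x step e(2) by auto
      then show ?case using x' e(2) by auto
    qed (use u in simp)
    moreover have "(u, v) \<in> conn S" if "v \<in> x" for v
    proof -
      have "(u, v) \<in> (\<Union>e\<in>arcs_within x E g. {(t e, h e), (h e, t e)})\<^sup>*"
        using conn[OF x] that u unfolding connected_iff[OF fin] adj_rb by simp
      moreover have "(\<Union>e\<in>arcs_within x E g. {(t e, h e), (h e, t e)}) \<subseteq>
          (\<Union>e\<in>S. {(t e, h e), (h e, t e)})"
        using x by (auto simp: S_def)
      ultimately show ?thesis unfolding conn_def using rtrancl_mono by blast
    qed
    ultimately show ?thesis using uV S by (auto simp: comp_eq)
  qed
  show "blocks S = P"
  proof (intro equalityI subsetI)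
    fix x assume "x \<in> blocks S"
    then obtain u where "u \<in> V" "x = comp S u" by (auto simp: blocks_def)
    moreover from this obtain y where "y \<in> P" "u \<in> y" using P'(1) by blast
    ultimately show "x \<in> P" using comp by simp
  next
    fix x assume x: "x \<in> P"
    then obtain u where "u \<in> x" using P by (metis all_not_in_conv partition_on_def)
    moreover from this have "u \<in> V" using x P'(1) by blast
    ultimately show "x \<in> blocks S" using comp[of u x] x unfolding blocks_def by (metis imageI)
  qed
  fix e assume e: "e \<in> E - S"
  obtain x y where xy: "x \<in> P" "t e \<in> x" "y \<in> P" "h e \<in> y"
    using ends[of e] e P'(1) by (metis DiffD1 UnionE)
  have "x \<noteq> y" using xy e by (auto simp: S_def arcs_within_def t_def h_def)
  then show "comp S (t e) \<noteq> comp S (h e)" using comp xy by metis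
qed

abbreviation "red \<equiv> E - blue_arcs E g"

text \<open>
  The weight with which an arc \<open>e\<close> outside \<open>S\<close> enters \<^term>\<open>e_quiver\<close> of the contraction at \<open>\<beta> = 1\<close>
  (red) and \<open>\<beta> = -1\<close> (blue).
\<close>

definition chi :: "'e set \<Rightarrow> 'v set list \<Rightarrow> 'e \<Rightarrow> real" where
  "chi S xs e = arc_weight (list_order xs) (- beta_minus (color_beta g) e) (comp S (t e)) (comp S (h e))"

lemma e_quiver_contract_rb:
  assumes "S \<subseteq> K" "K \<subseteq> E"
  shows "e_quiver (color_beta g) (contract (fst (rb V K g)) S) =
    (\<Sum>xs\<in>permutations_of_set (blocks S). \<Prod>e\<in>K - S. chi S xs e) / fact (card (blocks S))"
  using e_quiver_eq[OF fin_digraph_contract[OF fin_sub[OF assms(2)]], of "color_beta g" S]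
  by (simp add: contract_def blocks_def chi_def comp_def t_def h_def)

text \<open>
  Reversing the blue arcs turns their weights \<open>\<chi>\<close> into \<open>1 - \<chi>\<close>; at \<open>\<beta> = -1\<close> a blue tadpole has
  \<open>\<chi> = 1\<close>, so tadpoles of either color get weight zero.
\<close>

lemma prod_chi_eq:
  assumes S: "S \<subseteq> E" and xs: "xs \<in> permutations_of_set (blocks S)"
  shows "(\<Prod>e\<in>red - S. chi S xs e) * (\<Prod>e\<in>blue_arcs E g - S. 1 - chi S xs e) =
    of_bool ((\<forall>e\<in>E - S. comp S (t e) \<noteq> comp S (h e)) \<and> compatible_blocks E g xs)"
proof -
  have xs': "set xs = blocks S" "distinct xs" using xs by (auto simp: permutations_of_set_def)
  have part: "partition_on V (blocks S)" by (rule partition_blocks[OF S])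
  have dis: "x = y" if "x \<in> blocks S" "y \<in> blocks S" "u \<in> x" "u \<in> y" for x y u
    using part that by (auto simp: partition_on_def disjoint_def)
  have self: "u \<in> comp S u" "comp S u \<in> blocks S" if "u \<in> V" for u
    using that S conn_refl by (auto simp: comp_self blocks_def)
  define ok where "ok e \<longleftrightarrow> comp S (t e) \<noteq> comp S (h e) \<and>
    (if e \<in> blue_arcs E g then (comp S (h e), comp S (t e)) \<in> list_order xs
     else (comp S (t e), comp S (h e)) \<in> list_order xs)" for e
  have 1: "(\<Prod>e\<in>red - S. chi S xs e) = (\<Prod>e\<in>red - S. of_bool (ok e))"
    by (rule prod.cong)
       (auto simp: chi_def arc_weight_def ok_def beta_minus_def color_beta_def blue_arcs_def split: color.splits)
  have 2: "(\<Prod>e\<in>blue_arcs E g - S. 1 - chi S xs e) = (\<Prod>e\<in>blue_arcs E g - S. of_bool (ok e))"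
  proof (rule prod.cong[OF refl])
    fix e assume e: "e \<in> blue_arcs E g - S"
    then have "e \<in> E" by (auto simp: blue_arcs_def)
    then have "comp S (t e) \<in> set xs" "comp S (h e) \<in> set xs" using self ends xs' by auto
    then show "1 - chi S xs e = of_bool (ok e)"
      using e list_order_total[of "comp S (t e)" xs "comp S (h e)"]
        list_order_antisym[OF xs'(2), of "comp S (t e)" "comp S (h e)"]
      by (auto simp: chi_def arc_weight_def ok_def beta_minus_def color_beta_def blue_arcs_def)
  qed
  have "(\<Prod>e\<in>red - S. chi S xs e) * (\<Prod>e\<in>blue_arcs E g - S. 1 - chi S xs e) =
      (\<Prod>e\<in>(red - S) \<union> (blue_arcs E g - S). of_bool (ok e))"
    unfolding 1 2 using finE by (subst prod.union_disjoint) (auto simp: blue_arcs_def)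
  also have "(red - S) \<union> (blue_arcs E g - S) = E - S" by (auto simp: blue_arcs_def)
  also have "(\<Prod>e\<in>E - S. of_bool (ok e)) = (of_bool (\<forall>e\<in>E - S. ok e) :: real)"
    using finE by (cases "\<forall>e\<in>E - S. ok e") (auto intro!: prod_zero)
  also have "(\<forall>e\<in>E - S. ok e) \<longleftrightarrow>
      (\<forall>e\<in>E - S. comp S (t e) \<noteq> comp S (h e)) \<and> compatible_blocks E g xs"
  proof -
    have in_S: "\<exists>x\<in>set xs. t e \<in> x \<and> h e \<in> x" if "e \<in> S" for e
    proof -
      have "e \<in> E" using that S by auto
      then show ?thesis
        using self[of "t e"] ends[of e] conn_arc[OF that] xs' comp_eq[OF S, of "t e"]
        by (intro bexI[of _ "comp S (t e)"]) auto
    qed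
    have out: "((\<exists>x\<in>set xs. t e \<in> x \<and> h e \<in> x) \<or>
        (\<exists>x y. x \<noteq> y \<and> (x, y) \<in> list_order xs \<and> crosses x y (g e))) \<longleftrightarrow> ok e"
      if e: "e \<in> E" "comp S (t e) \<noteq> comp S (h e)" for e
    proof -
      note te = self[OF ends(1)[OF e(1)]] and he = self[OF ends(2)[OF e(1)]]
      have "\<not> (\<exists>x\<in>set xs. t e \<in> x \<and> h e \<in> x)"
        using dis te he xs' e(2) by metis
      moreover have "(\<exists>x y. x \<noteq> y \<and> (x, y) \<in> list_order xs \<and> crosses x y (g e)) \<longleftrightarrow> ok e"
      proof
        assume "\<exists>x y. x \<noteq> y \<and> (x, y) \<in> list_order xs \<and> crosses x y (g e)"
        then obtain x y where xy: "x \<noteq> y" "(x, y) \<in> list_order xs" "crosses x y (g e)" by auto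
        have "x \<in> blocks S" "y \<in> blocks S" using list_order_in_set[OF xy(2)] xs' by auto
        then have *: "u \<in> V \<Longrightarrow> u \<in> x \<Longrightarrow> x = comp S u" "u \<in> V \<Longrightarrow> u \<in> y \<Longrightarrow> y = comp S u" for u
          using dis self by metis+
        show "ok e"
        proof (cases "snd (snd (g e))")
          case Red
          then have "t e \<in> x" "h e \<in> y" using xy(3) by (auto simp: crosses_def t_def h_def)
          then show ?thesis using * ends[OF e(1)] xy Red by (auto simp: ok_def blue_arcs_def)
        next
          case Blue
          then have "h e \<in> x" "t e \<in> y" using xy(3) by (auto simp: crosses_def t_def h_def)
          then show ?thesis using * ends[OF e(1)] xy Blue e by (auto simp: ok_def blue_arcs_def)
        qed
      next
        assume ok: "ok e"
        show "\<exists>x y. x \<noteq> y \<and> (x, y) \<in> list_order xs \<and> crosses x y (g e)"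
        proof (cases "snd (snd (g e))")
          case Red
          then show ?thesis using ok te he e
            by (intro exI[of _ "comp S (t e)"] exI[of _ "comp S (h e)"])
               (auto simp: ok_def blue_arcs_def crosses_def t_def h_def)
        next
          case Blue
          then show ?thesis using ok te he e
            by (intro exI[of _ "comp S (h e)"] exI[of _ "comp S (t e)"])
               (auto simp: ok_def blue_arcs_def crosses_def t_def h_def)
        qed
      qed
      ultimately show ?thesis by blast
    qed
    have "compatible_blocks E g xs \<longleftrightarrow> (\<forall>e\<in>E - S. (\<exists>x\<in>set xs. t e \<in> x \<and> h e \<in> x) \<or>
        (\<exists>x y. x \<noteq> y \<and> (x, y) \<in> list_order xs \<and> crosses x y (g e)))"
      unfolding compatible_blocks_def t_def[symmetric] h_def[symmetric] using in_S S by auto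
    moreover have "ok e \<Longrightarrow> comp S (t e) \<noteq> comp S (h e)" for e by (simp add: ok_def)
    ultimately show ?thesis using out by (metis DiffD1)
  qed
  finally show ?thesis .
qed

text \<open>
  Expanding the factors \<open>1 - \<chi>\<close> of the blue arcs gives a signed sum over the arc sets \<open>K\<close> that contain
  all red arcs and \<open>S\<close>.  For fixed \<open>K\<close> the sum over \<open>S\<close> is the defining sum of \<open>\<omega>\<close> for the
  cut-subquiver with arcs \<open>K\<close>, hence zero unless \<open>K\<close> is empty.
\<close>

lemma alternating_sum_omega:
  "(\<Sum>S\<in>Pow E. (-1) ^ card (blue_arcs S g) * omega (color_beta g) (fst (rb V S g)) *
      ((\<Sum>xs\<in>permutations_of_set (blocks S).
         (\<Prod>e\<in>red - S. chi S xs e) * (\<Prod>e\<in>blue_arcs E g - S. 1 - chi S xs e)) / fact (card (blocks S)))) =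
    of_bool (red = {})"
proof -
  let ?w = "\<lambda>S. omega (color_beta g) (fst (rb V S g))"
  let ?e = "\<lambda>K S. e_quiver (color_beta g) (contract (fst (rb V K g)) S)"
  let ?sgn = "\<lambda>S. (-1 :: real) ^ card (blue_arcs S g)"
  have blueE: "blue_arcs E g \<subseteq> E" by (auto simp: blue_arcs_def)
  have fin: "finite A" if "A \<subseteq> E" for A using that finE finite_subset by blast
  have inner: "(\<Sum>xs\<in>permutations_of_set (blocks S).
         (\<Prod>e\<in>red - S. chi S xs e) * (\<Prod>e\<in>blue_arcs E g - S. 1 - chi S xs e)) / fact (card (blocks S)) =
      (\<Sum>D\<in>Pow (blue_arcs E g - S). (-1) ^ card D * ?e (S \<union> red \<union> D) S)" if S: "S \<in> Pow E" for S
  proof -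
    have "(\<Prod>e\<in>red - S. chi S xs e) * (\<Prod>e\<in>blue_arcs E g - S. 1 - chi S xs e) =
        (\<Sum>D\<in>Pow (blue_arcs E g - S). (-1) ^ card D * (\<Prod>e\<in>(S \<union> red \<union> D) - S. chi S xs e))" for xs
    proof -
      have "(\<Prod>e\<in>red - S. chi S xs e) * (\<Prod>e\<in>blue_arcs E g - S. 1 - chi S xs e) =
          (\<Sum>D\<in>Pow (blue_arcs E g - S). (\<Prod>e\<in>red - S. chi S xs e) * ((-1) ^ card D * (\<Prod>e\<in>D. chi S xs e)))"
        by (subst prod_diff_conv_sum) (use fin blueE in \<open>auto simp: sum_distrib_left\<close>)
      also have "\<dots> = (\<Sum>D\<in>Pow (blue_arcs E g - S). (-1) ^ card D * (\<Prod>e\<in>(S \<union> red \<union> D) - S. chi S xs e))"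
      proof (rule sum.cong[OF refl])
        fix D assume D: "D \<in> Pow (blue_arcs E g - S)"
        then have "(S \<union> red \<union> D) - S = (red - S) \<union> D" by auto
        then have "(\<Prod>e\<in>(S \<union> red \<union> D) - S. chi S xs e) = (\<Prod>e\<in>red - S. chi S xs e) * (\<Prod>e\<in>D. chi S xs e)"
          using D blueE fin[of "red - S"] fin[of D] by (auto intro!: prod.union_disjoint)
        then show "(\<Prod>e\<in>red - S. chi S xs e) * ((-1) ^ card D * (\<Prod>e\<in>D. chi S xs e)) =
            (-1) ^ card D * (\<Prod>e\<in>(S \<union> red \<union> D) - S. chi S xs e)" by simp
      qed
      finally show ?thesis .
    qed
    then have "(\<Sum>xs\<in>permutations_of_set (blocks S).
         (\<Prod>e\<in>red - S. chi S xs e) * (\<Prod>e\<in>blue_arcs E g - S. 1 - chi S xs e)) / fact (card (blocks S)) =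
      (\<Sum>xs\<in>permutations_of_set (blocks S). \<Sum>D\<in>Pow (blue_arcs E g - S).
          (-1) ^ card D * (\<Prod>e\<in>(S \<union> red \<union> D) - S. chi S xs e)) / fact (card (blocks S))"
      by simp
    also have "\<dots> = (\<Sum>D\<in>Pow (blue_arcs E g - S). (-1) ^ card D *
        ((\<Sum>xs\<in>permutations_of_set (blocks S). \<Prod>e\<in>(S \<union> red \<union> D) - S. chi S xs e) / fact (card (blocks S))))"
      by (subst sum.swap) (simp add: sum_divide_distrib sum_distrib_left)
    also have "\<dots> = (\<Sum>D\<in>Pow (blue_arcs E g - S). (-1) ^ card D * ?e (S \<union> red \<union> D) S)"
      using S blueE by (intro sum.cong refl arg_cong2[where f = "(*)"] e_quiver_contract_rb[symmetric]) auto
    finally show ?thesis .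
  qed
  have "(\<Sum>S\<in>Pow E. ?sgn S * ?w S *
      ((\<Sum>xs\<in>permutations_of_set (blocks S).
         (\<Prod>e\<in>red - S. chi S xs e) * (\<Prod>e\<in>blue_arcs E g - S. 1 - chi S xs e)) / fact (card (blocks S)))) =
    (\<Sum>S\<in>Pow E. \<Sum>D\<in>Pow (blue_arcs E g - S). ?sgn S * ?w S * ((-1) ^ card D * ?e (S \<union> red \<union> D) S))"
    by (intro sum.cong refl) (simp add: inner sum_distrib_left)
  also have "\<dots> = (\<Sum>(S, D)\<in>(SIGMA S:Pow E. Pow (blue_arcs E g - S)).
      ?sgn S * ?w S * ((-1) ^ card D * ?e (S \<union> red \<union> D) S))"
    using finE fin blueE by (subst sum.Sigma) auto
  also have "\<dots> = (\<Sum>(K, S)\<in>(SIGMA K:{K. red \<subseteq> K \<and> K \<subseteq> E}. Pow K). ?sgn K * (?w S * ?e K S))"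
  proof (rule sum.reindex_bij_witness[of _ "\<lambda>(K, S). (S, (K - S) \<inter> blue_arcs E g)" "\<lambda>(S, D). (S \<union> red \<union> D, S)"])
    fix a assume a: "a \<in> (SIGMA S:Pow E. Pow (blue_arcs E g - S))"
    obtain S D where SD: "a = (S, D)" by (cases a)
    have "blue_arcs (S \<union> red \<union> D) g = blue_arcs S g \<union> D"
      using a SD by (auto simp: blue_arcs_def)
    moreover have "card (blue_arcs S g \<union> D) = card (blue_arcs S g) + card D"
      using a SD fin[of "blue_arcs S g"] fin[of D] blueE
      by (intro card_Un_disjoint) (auto simp: blue_arcs_def)
    ultimately have "?sgn (S \<union> red \<union> D) = ?sgn S * (-1) ^ card D" by (simp add: power_add)
    then show "(case case a of (S, D) \<Rightarrow> (S \<union> red \<union> D, S) of (K, S) \<Rightarrow> ?sgn K * (?w S * ?e K S)) =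
       (case a of (S, D) \<Rightarrow> ?sgn S * ?w S * ((-1) ^ card D * ?e (S \<union> red \<union> D) S))"
      using SD by simp
  qed (auto simp: blue_arcs_def)
  also have "\<dots> = (\<Sum>K\<in>{K. red \<subseteq> K \<and> K \<subseteq> E}. \<Sum>S\<in>Pow K. ?sgn K * (?w S * ?e K S))"
    using finE fin by (subst sum.Sigma) (auto intro: finite_subset[of _ "Pow E"])
  also have "\<dots> = (\<Sum>K\<in>{K. red \<subseteq> K \<and> K \<subseteq> E}. ?sgn K * of_bool (K = {}))"
  proof (rule sum.cong[OF refl])
    fix K assume "K \<in> {K. red \<subseteq> K \<and> K \<subseteq> E}"
    then have "(\<Sum>S\<in>Pow K. ?w S * ?e K S) = of_bool (K = {})"
      using omega_sum[OF fin_sub[of K], of "color_beta g"] by (simp add: counit_def)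
    then show "(\<Sum>S\<in>Pow K. ?sgn K * (?w S * ?e K S)) = ?sgn K * of_bool (K = {})"
      by (simp add: sum_distrib_left[symmetric])
  qed
  also have "\<dots> = (\<Sum>K\<in>{K. red \<subseteq> K \<and> K \<subseteq> E}. if K = {} then 1 else 0)"
    by (intro sum.cong) (auto simp: blue_arcs_def)
  also have "\<dots> = of_bool (red = {})"
    using finE finite_subset[of "{K. red \<subseteq> K \<and> K \<subseteq> E}" "Pow E"] by (auto simp: sum.delta)
  finally show ?thesis .
qed

text \<open>
  Connected ordered partitions are the same as subquivers with tadpole-free contraction together with
  an ordering of the components.
\<close>

theorem sum_ordered_partitions:
  "(\<Sum>xs\<in>ordered_partitions V. of_bool (compatible_blocks E g xs) *
      (\<Prod>x\<in>set xs. omega_RB_c (rb x (arcs_within x E g) g)) / fact (length xs)) =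
    of_bool (\<forall>e\<in>E. snd (snd (g e)) = Blue)"
proof -
  let ?conn = "\<lambda>x. Digraph_Component.connected (fst (rb x (arcs_within x E g) g))"
  let ?S = "\<lambda>P. \<Union>x\<in>P. arcs_within x E g"
  let ?w = "\<lambda>S. (-1) ^ card (blue_arcs S g) * omega (color_beta g) (fst (rb V S g))"
  let ?F = "\<lambda>xs. of_bool (compatible_blocks E g xs) *
      (\<Prod>x\<in>set xs. omega_RB_c (rb x (arcs_within x E g) g)) / fact (length xs)"
  define T where "T = {S \<in> Pow E. \<forall>e\<in>E - S. comp S (t e) \<noteq> comp S (h e)}"
  have finOP: "finite (ordered_partitions V)" by (rule finite_ordered_partitions[OF finV])
  have prod: "(\<Prod>x\<in>P. omega_RB_c (rb x (arcs_within x E g) g)) = (if \<forall>x\<in>P. ?conn x then ?w (?S P) else 0)"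
    if P: "partition_on V P" for P
  proof -
    have finP: "finite P" using P finV by (simp add: finite_elements)
    show ?thesis
    proof (cases "\<forall>x\<in>P. ?conn x")
      case True
      have "omega (color_beta g) (fst (rb (\<Union>P) (?S P) g)) =
          (\<Prod>x\<in>P. omega (color_beta g) (fst (rb x (arcs_within x E g) g)))
        \<and> (-1 :: real) ^ card (blue_arcs (?S P) g) = (\<Prod>x\<in>P. (-1) ^ card (blue_arcs (arcs_within x E g) g))"
        by (rule omega_rb_partition)
           (use P finP finV finE in \<open>auto simp: partition_on_def disjoint_def intro: finite_subset\<close>)
      moreover have "\<Union>P = V" using P by (simp add: partition_on_def)
      ultimately show ?thesis
        using True by (simp add: omega_RB_c_rb omega_c_def prod.distrib)
    next
      case False
      then show ?thesis using finP by (auto simp: omega_RB_c_rb omega_c_def intro!: prod_zero)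
    qed
  qed
  have "(\<Sum>xs\<in>ordered_partitions V. ?F xs) = (\<Sum>xs\<in>{xs \<in> ordered_partitions V. \<forall>x\<in>set xs. ?conn x}. ?F xs)"
    by (rule sum.mono_neutral_right) (use finOP prod in \<open>auto simp: ordered_partitions_def\<close>)
  also have "\<dots> = (\<Sum>(S, xs)\<in>(SIGMA S:T. permutations_of_set (blocks S)).
      ?w S * of_bool (compatible_blocks E g xs) / fact (card (blocks S)))"
  proof (rule sum.reindex_bij_witness[of _ snd "\<lambda>xs. (?S (set xs), xs)"])
    fix xs assume "xs \<in> {xs \<in> ordered_partitions V. \<forall>x\<in>set xs. ?conn x}"
    then have xs: "distinct xs" "partition_on V (set xs)" "\<And>x. x \<in> set xs \<Longrightarrow> ?conn x"
      by (auto simp: ordered_partitions_def)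
    note B = blocks_of_partition[OF xs(2,3), simplified]
    show "snd (?S (set xs), xs) = xs" by simp
    show "(?S (set xs), xs) \<in> (SIGMA S:T. permutations_of_set (blocks S))"
      using B xs by (auto simp: T_def permutations_of_set_def)
    show "(case (?S (set xs), xs) of (S, xs) \<Rightarrow> ?w S * of_bool (compatible_blocks E g xs) / fact (card (blocks S))) = ?F xs"
      using prod[OF xs(2)] xs B(2) by (simp add: distinct_card)
  next
    fix a assume "a \<in> (SIGMA S:T. permutations_of_set (blocks S))"
    then obtain S xs where a: "a = (S, xs)" "S \<in> T" "xs \<in> permutations_of_set (blocks S)" by auto
    then have S: "S \<subseteq> E" "\<And>e. e \<in> E - S \<Longrightarrow> comp S (t e) \<noteq> comp S (h e)"
      and xs: "set xs = blocks S" "distinct xs"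
      by (auto simp: T_def permutations_of_set_def)
    show "(?S (set (snd a)), snd a) = a"
      using arcs_within_blocks[OF S] a xs by simp
    show "snd a \<in> {xs \<in> ordered_partitions V. \<forall>x\<in>set xs. ?conn x}"
      using a xs partition_blocks[OF S(1)] connected_block[OF S(1)] by (auto simp: ordered_partitions_def)
  qed
  also have "\<dots> = (\<Sum>S\<in>T. \<Sum>xs\<in>permutations_of_set (blocks S).
      ?w S * of_bool (compatible_blocks E g xs) / fact (card (blocks S)))"
    by (subst sum.Sigma) (use finE in \<open>auto simp: T_def\<close>)
  also have "\<dots> = (\<Sum>S\<in>Pow E. ?w S *
      ((\<Sum>xs\<in>permutations_of_set (blocks S).
         (\<Prod>e\<in>red - S. chi S xs e) * (\<Prod>e\<in>blue_arcs E g - S. 1 - chi S xs e)) / fact (card (blocks S))))"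
  proof (rule sum.mono_neutral_cong_left)
    show "finite (Pow E)" "T \<subseteq> Pow E" using finE by (auto simp: T_def)
    show "\<forall>S\<in>Pow E - T. ?w S *
      ((\<Sum>xs\<in>permutations_of_set (blocks S).
         (\<Prod>e\<in>red - S. chi S xs e) * (\<Prod>e\<in>blue_arcs E g - S. 1 - chi S xs e)) / fact (card (blocks S))) = 0"
    proof
      fix S assume S: "S \<in> Pow E - T"
      then have "(\<Prod>e\<in>red - S. chi S xs e) * (\<Prod>e\<in>blue_arcs E g - S. 1 - chi S xs e) = 0"
        if "xs \<in> permutations_of_set (blocks S)" for xs
        using prod_chi_eq[OF _ that] by (auto simp: T_def)
      then show "?w S *
      ((\<Sum>xs\<in>permutations_of_set (blocks S).
         (\<Prod>e\<in>red - S. chi S xs e) * (\<Prod>e\<in>blue_arcs E g - S. 1 - chi S xs e)) / fact (card (blocks S))) = 0"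
        by (simp only: sum.neutral[rule_format] div_0 mult_zero_right)
    qed
    fix S assume S: "S \<in> T"
    then have "(\<Prod>e\<in>red - S. chi S xs e) * (\<Prod>e\<in>blue_arcs E g - S. 1 - chi S xs e) =
        of_bool (compatible_blocks E g xs)"
      if "xs \<in> permutations_of_set (blocks S)" for xs
      using prod_chi_eq[OF _ that] by (auto simp: T_def)
    then have "(\<Sum>xs\<in>permutations_of_set (blocks S).
         (\<Prod>e\<in>red - S. chi S xs e) * (\<Prod>e\<in>blue_arcs E g - S. 1 - chi S xs e)) =
        (\<Sum>xs\<in>permutations_of_set (blocks S). of_bool (compatible_blocks E g xs))"
      by (intro sum.cong refl)
    then show "(\<Sum>xs\<in>permutations_of_set (blocks S).
        ?w S * of_bool (compatible_blocks E g xs) / fact (card (blocks S))) = ?w S *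
      ((\<Sum>xs\<in>permutations_of_set (blocks S).
         (\<Prod>e\<in>red - S. chi S xs e) * (\<Prod>e\<in>blue_arcs E g - S. 1 - chi S xs e)) / fact (card (blocks S)))"
      by (simp only: sum_distrib_left sum_divide_distrib times_divide_eq_right)
  qed
  also have "\<dots> = of_bool (red = {})" by (rule alternating_sum_omega)
  also have "red = {} \<longleftrightarrow> (\<forall>e\<in>E. snd (snd (g e)) = Blue)" by (auto simp: blue_arcs_def)
  finally show ?thesis .
qed

end

section \<open>Integrals over cubes of times\<close>

text \<open>
  Functions of the times \<open>x v\<close>, \<open>v \<in> V\<close>, generated by \<open>f\<close>, its conjugate and step functions of time
  differences.
\<close>

inductive tame :: "(real \<Rightarrow> complex) \<Rightarrow> 'v set \<Rightarrow> (('v \<Rightarrow> real) \<Rightarrow> complex) \<Rightarrow> bool" for f V where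
  tame_const: "tame f V (\<lambda>x. c)"
| tame_f: "i \<in> V \<Longrightarrow> tame f V (\<lambda>x. f (x i))"
| tame_cnj_f: "i \<in> V \<Longrightarrow> tame f V (\<lambda>x. cnj (f (x i)))"
| tame_theta: "i \<in> V \<Longrightarrow> j \<in> V \<Longrightarrow> tame f V (\<lambda>x. theta (x i - x j))"
| tame_add: "tame f V a \<Longrightarrow> tame f V b \<Longrightarrow> tame f V (\<lambda>x. a x + b x)"
| tame_mult: "tame f V a \<Longrightarrow> tame f V b \<Longrightarrow> tame f V (\<lambda>x. a x * b x)"

lemma tame_sum: "(\<And>i. i \<in> A \<Longrightarrow> tame f V (a i)) \<Longrightarrow> tame f V (\<lambda>x. \<Sum>i\<in>A. a i x)"
  by (induction A rule: infinite_finite_induct) (auto intro: tame_const tame_add)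

lemma tame_prod: "(\<And>i. i \<in> A \<Longrightarrow> tame f V (a i)) \<Longrightarrow> tame f V (\<lambda>x. \<Prod>i\<in>A. a i x)"
  by (induction A rule: infinite_finite_induct) (auto intro: tame_const tame_mult)

lemma tame_power: "tame f V a \<Longrightarrow> tame f V (\<lambda>x. a x ^ n)"
  by (induction n) (auto intro: tame_const tame_mult)

lemma tame_divide: "tame f V a \<Longrightarrow> tame f V (\<lambda>x. a x / c)"
  unfolding divide_inverse by (intro tame_mult tame_const)

lemma tame_W: "i \<in> V \<Longrightarrow> j \<in> V \<Longrightarrow> tame f V (\<lambda>x. W_contraction f (x i) (x j))"
  unfolding W_contraction_def by (intro tame_mult tame_f tame_cnj_f)

lemmas tame_intros = tame_const tame_f tame_cnj_f tame_theta tame_add tame_mult tame_sum tame_prod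
  tame_power tame_divide tame_W

lemma tame_mono: "tame f V a \<Longrightarrow> V \<subseteq> V' \<Longrightarrow> tame f V' a"
  by (induction rule: tame.induct) (auto intro: tame.intros)

lemma tame_cong: "tame f V a \<Longrightarrow> (\<And>v. v \<in> V \<Longrightarrow> x v = y v) \<Longrightarrow> a x = a y"
  by (induction rule: tame.induct) auto

interpretation PL: product_sigma_finite "\<lambda>_. lborel :: real measure"
  by (rule product_sigma_finite.intro) (rule sigma_finite_lborel)

text \<open>Renaming the coordinates preserves Lebesgue measure.\<close>

lemma PiM_lborel_reindex:
  assumes \<phi>: "bij_betw \<phi> V V'" and fin: "finite V"
  shows "distr (\<Pi>\<^sub>M v\<in>V'. lborel) (\<Pi>\<^sub>M v\<in>V. lborel) (\<lambda>x. \<lambda>v\<in>V. x (\<phi> v)) = (\<Pi>\<^sub>M v\<in>V. lborel :: real measure)"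
proof (rule PL.PiM_eqI[OF fin])
  have fin': "finite V'" using \<phi> fin bij_betw_finite by blast
  have im: "\<phi> v \<in> V'" if "v \<in> V" for v using \<phi> that by (auto simp: bij_betw_def)
  have meas: "(\<lambda>x. \<lambda>v\<in>V. x (\<phi> v)) \<in> measurable (\<Pi>\<^sub>M v\<in>V'. lborel :: real measure) (\<Pi>\<^sub>M v\<in>V. lborel)"
    using im by (intro measurable_restrict measurable_component_singleton)
  fix A :: "'a \<Rightarrow> real set" assume A: "\<And>i. i \<in> V \<Longrightarrow> A i \<in> sets lborel"
  let ?B = "\<lambda>w. A (inv_into V \<phi> w)"
  have inv: "inv_into V \<phi> (\<phi> v) = v" if "v \<in> V" for v
    using \<phi> that by (auto simp: bij_betw_def)
  have B: "?B w \<in> sets lborel" if "w \<in> V'" for w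
    using that \<phi> by (intro A) (metis bij_betw_def inv_into_into)
  have "(\<lambda>x. \<lambda>v\<in>V. x (\<phi> v)) -` (Pi\<^sub>E V A) \<inter> space (\<Pi>\<^sub>M v\<in>V'. lborel) = Pi\<^sub>E V' ?B"
    using \<phi> inv by (auto simp: space_PiM PiE_def Pi_def bij_betw_def extensional_def)
  then have "emeasure (distr (\<Pi>\<^sub>M v\<in>V'. lborel) (\<Pi>\<^sub>M v\<in>V. lborel) (\<lambda>x. \<lambda>v\<in>V. x (\<phi> v))) (Pi\<^sub>E V A) =
      emeasure (\<Pi>\<^sub>M v\<in>V'. lborel) (Pi\<^sub>E V' ?B)"
    using A fin by (subst emeasure_distr[OF meas]) (auto intro!: sets_PiM_I_finite)
  also have "\<dots> = (\<Prod>w\<in>V'. emeasure lborel (?B w))"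
    using B by (intro PL.emeasure_PiM[OF fin']) auto
  also have "\<dots> = (\<Prod>v\<in>V. emeasure lborel (?B (\<phi> v)))"
    by (rule prod.reindex_bij_betw[OF \<phi>, symmetric])
  also have "\<dots> = (\<Prod>v\<in>V. emeasure lborel (A v))"
    by (intro prod.cong) (auto simp: inv)
  finally show "emeasure (distr (\<Pi>\<^sub>M v\<in>V'. lborel) (\<Pi>\<^sub>M v\<in>V. lborel) (\<lambda>x. \<lambda>v\<in>V. x (\<phi> v))) (Pi\<^sub>E V A) =
    (\<Prod>v\<in>V. emeasure lborel (A v))" .
qed simp

text \<open>Almost all times are pairwise different and different from a given time.\<close>

lemma AE_PiM_lborel_neq:
  fixes k :: "('v \<Rightarrow> real) \<Rightarrow> real"
  assumes V: "finite V" "i \<in> V"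
    and k: "k \<in> borel_measurable (\<Pi>\<^sub>M v\<in>V. lborel)" and k_upd: "\<And>x y. k (x(i := y)) = k x"
  shows "AE x in (\<Pi>\<^sub>M v\<in>V. lborel). x i \<noteq> k x"
proof -
  let ?M = "\<Pi>\<^sub>M v\<in>V. lborel :: real measure"
  have meas: "{x \<in> space ?M. x i = k x} \<in> sets ?M"
  proof -
    have "(\<lambda>x. x i) \<in> borel_measurable ?M"
      using measurable_component_singleton[OF V(2), of "\<lambda>_. lborel"] by simp
    then show ?thesis using k by (intro borel_measurable_eq)
  qed
  have VI: "V = insert i (V - {i})" using V by auto
  have "emeasure ?M {x \<in> space ?M. x i = k x} = (\<integral>\<^sup>+x. indicator {x \<in> space ?M. x i = k x} x \<partial>?M)"
    using meas by simp
  also have "\<dots> = (\<integral>\<^sup>+ x. (\<integral>\<^sup>+ y. indicator {x \<in> space ?M. x i = k x} (x(i := y)) \<partial>lborel) \<partial>(\<Pi>\<^sub>M v\<in>V - {i}. lborel))"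
    using PL.product_nn_integral_insert[of "V - {i}" i "indicator {x \<in> space ?M. x i = k x}"] V meas
    by (simp add: VI[symmetric] insert_absorb)
  also have "\<dots> \<le> (\<integral>\<^sup>+ x. (\<integral>\<^sup>+ y. indicator {k x} y \<partial>lborel) \<partial>(\<Pi>\<^sub>M v\<in>V - {i}. lborel))"
    by (intro nn_integral_mono) (auto simp: indicator_def k_upd)
  also have "\<dots> = 0" by simp
  finally have "emeasure ?M {x \<in> space ?M. x i = k x} = 0" by simp
  then have "{x \<in> space ?M. x i = k x} \<in> null_sets ?M" using meas by auto
  then show ?thesis by (auto simp: AE_iff_null_sets meas elim!: AE_I' )
qed

lemma AE_PiM_lborel_inj:
  assumes "finite V"
  shows "AE x in (\<Pi>\<^sub>M v\<in>V. lborel :: real measure). inj_on x V"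
proof -
  have "AE x in (\<Pi>\<^sub>M v\<in>V. lborel :: real measure). i \<noteq> j \<longrightarrow> x i \<noteq> x j" if "i \<in> V" "j \<in> V" for i j
  proof (cases "i = j")
    case False
    have "(\<lambda>x. x j) \<in> borel_measurable (\<Pi>\<^sub>M v\<in>V. lborel :: real measure)"
      using measurable_component_singleton[OF that(2), of "\<lambda>_. lborel"] by simp
    from AE_PiM_lborel_neq[OF assms that(1) this] False show ?thesis by simp
  qed simp
  then have "AE x in (\<Pi>\<^sub>M v\<in>V. lborel :: real measure). \<forall>i\<in>V. \<forall>j\<in>V. i \<noteq> j \<longrightarrow> x i \<noteq> x j"
    using assms by (simp add: AE_finite_all)
  then show ?thesis by eventually_elim (auto simp: inj_on_def)
qed

text \<open>
  A driving function \<open>f\<close> with finite moments on \<open>[0,t]\<close>.  It is measurable on the whole line, so that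
  the integrands are measurable without reference to the interval.
\<close>

locale drive =
  fixes f :: "real \<Rightarrow> complex" and t :: real
  assumes f_measurable [measurable]: "f \<in> borel_measurable borel"
    and f_integrable: "\<And>k. set_integrable lborel {0..t} (\<lambda>s. norm (f s) ^ k)"
begin

text \<open>The cube of all times in \<open>[0,t]\<close>.\<close>

definition cube :: "'v set \<Rightarrow> ('v \<Rightarrow> real) set" where
  "cube V = (\<Pi>\<^sub>E v\<in>V. {0..t})"

lemma cube_sets: "finite V \<Longrightarrow> cube V \<in> sets (\<Pi>\<^sub>M v\<in>V. lborel)"
  unfolding cube_def by (intro sets_PiM_I_finite) auto

text \<open>The integral over the cube.\<close>

definition J :: "'v set \<Rightarrow> (('v \<Rightarrow> real) \<Rightarrow> complex) \<Rightarrow> complex" where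
  "J V g = (LINT x:cube V|(\<Pi>\<^sub>M v\<in>V. lborel). g x)"

lemma tame_measurable:
  assumes "tame f V g"
  shows "g \<in> borel_measurable (\<Pi>\<^sub>M v\<in>V. lborel)"
  using assms
proof (induction rule: tame.induct)
  case (tame_f i)
  then have [measurable]: "(\<lambda>x. x i) \<in> borel_measurable (\<Pi>\<^sub>M v\<in>V. lborel)"
    using measurable_component_singleton[of i V "\<lambda>_. lborel"] by simp
  show ?case by measurable
next
  case (tame_cnj_f i)
  then have [measurable]: "(\<lambda>x. x i) \<in> borel_measurable (\<Pi>\<^sub>M v\<in>V. lborel)"
    using measurable_component_singleton[of i V "\<lambda>_. lborel"] by simp
  have "(\<lambda>x. f (x i)) \<in> borel_measurable (\<Pi>\<^sub>M v\<in>V. lborel)" by measurable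
  then show ?case by (rule borel_measurable_continuous_on[OF continuous_on_cnj[OF continuous_on_id], simplified])
next
  case (tame_theta i j)
  then have [measurable]: "(\<lambda>x. x i) \<in> borel_measurable (\<Pi>\<^sub>M v\<in>V. lborel)"
    "(\<lambda>x. x j) \<in> borel_measurable (\<Pi>\<^sub>M v\<in>V. lborel)"
    using measurable_component_singleton[of i V "\<lambda>_. lborel"]
      measurable_component_singleton[of j V "\<lambda>_. lborel"] by simp_all
  show ?case unfolding theta_def by measurable
qed simp_all

lemma tame_bound:
  assumes "tame f V g" and V: "finite V"
  shows "\<exists>C N. \<forall>x. norm (g x) \<le> C * (\<Prod>v\<in>V. 1 + norm (f (x v))) ^ N"
proof -
  define B where "B x = (\<Prod>v\<in>V. 1 + norm (f (x v)))" for x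
  have B1: "B x \<ge> 1" for x unfolding B_def by (intro prod_ge_1) simp
  have Bi: "norm (f (x i)) \<le> B x" if "i \<in> V" for i x
  proof -
    have "1 * (1 + norm (f (x i))) \<le> (\<Prod>v\<in>V - {i}. 1 + norm (f (x v))) * (1 + norm (f (x i)))"
      by (intro mult_right_mono prod_ge_1) auto
    also have "\<dots> = B x" unfolding B_def using prod.remove[OF V that, of "\<lambda>v. 1 + norm (f (x v))"] by (simp add: mult.commute)
    finally show ?thesis by simp
  qed
  have "\<exists>C N. C \<ge> 0 \<and> (\<forall>x. norm (g x) \<le> C * B x ^ N)"
    using assms(1)
  proof (induction rule: tame.induct)
    case (tame_const c)
    show ?case by (rule exI[of _ "norm c"], rule exI[of _ 0]) simp
  next
    case (tame_f i)
    then show ?case using Bi by (intro exI[of _ 1]) simp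
  next
    case (tame_cnj_f i)
    then show ?case using Bi by (intro exI[of _ 1]) simp
  next
    case (tame_theta i j)
    show ?case by (rule exI[of _ 1], rule exI[of _ 0]) (simp add: theta_def)
  next
    case (tame_add a b)
    then obtain C N D M where a: "C \<ge> 0" "\<And>x. norm (a x) \<le> C * B x ^ N"
      and b: "D \<ge> 0" "\<And>x. norm (b x) \<le> D * B x ^ M" by blast
    have "norm (a x + b x) \<le> (C + D) * B x ^ (N + M)" for x
    proof -
      have "norm (a x + b x) \<le> C * B x ^ N + D * B x ^ M"
        using norm_triangle_le[OF add_mono[OF a(2)[of x] b(2)[of x]]] .
      also have "\<dots> \<le> C * B x ^ (N + M) + D * B x ^ (N + M)"
        using a b B1[of x] by (intro add_mono mult_left_mono power_increasing) auto
      finally show ?thesis by (simp add: algebra_simps)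
    qed
    then show ?case using a b by (intro exI[of _ "C + D"] exI[of _ "N + M"]) auto
  next
    case (tame_mult a b)
    then obtain C N D M where a: "C \<ge> 0" "\<And>x. norm (a x) \<le> C * B x ^ N"
      and b: "D \<ge> 0" "\<And>x. norm (b x) \<le> D * B x ^ M" by blast
    have "norm (a x * b x) \<le> (C * D) * B x ^ (N + M)" for x
      using mult_mono[OF a(2)[of x] b(2)[of x]] a B1[of x]
      by (simp add: norm_mult power_add mult_ac)
    then show ?case using a b by (intro exI[of _ "C * D"] exI[of _ "N + M"]) auto
  qed
  then show ?thesis unfolding B_def by blast
qed

lemma integrable_one_plus_norm_power:
  "integrable lborel (\<lambda>s. indicator {0..t} s * (1 + norm (f s)) ^ N)"
proof -
  have "integrable lborel (\<lambda>s. \<Sum>k\<le>N. of_nat (N choose k) * (indicator {0..t} s * norm (f s) ^ k))"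
    by (intro Bochner_Integration.integrable_sum integrable_mult_right)
       (use f_integrable in \<open>simp add: set_integrable_def\<close>)
  moreover have "(\<Sum>k\<le>N. of_nat (N choose k) * (indicator {0..t} s * norm (f s) ^ k)) =
      indicator {0..t} s * (1 + norm (f s)) ^ N" for s
    using binomial_ring[of "norm (f s)" 1 N]
    by (simp add: sum_distrib_left mult_ac add.commute)
  ultimately show ?thesis by simp
qed

lemma indicator_cube:
  assumes "finite V" "x \<in> space (\<Pi>\<^sub>M v\<in>V. lborel :: real measure)"
  shows "indicator (cube V) x = (\<Prod>v\<in>V. indicator {0..t} (x v) :: real)"
proof (cases "x \<in> cube V")
  case True
  then have "\<And>v. v \<in> V \<Longrightarrow> x v \<in> {0..t}" unfolding cube_def by blast
  with True show ?thesis by simp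
next
  case False
  then have "\<not> (\<forall>v\<in>V. x v \<in> {0..t})" using assms(2) by (auto simp: cube_def space_PiM PiE_def)
  then obtain v where "v \<in> V" "x v \<notin> {0..t}" by blast
  with False assms(1) show ?thesis by (auto intro!: prod_zero[symmetric] bexI[of _ v])
qed

text \<open>A tame function is bounded by a power of \<open>\<Prod>\<^sub>v (1 + |f(x\<^sub>v)|)\<close>, which has a finite integral.\<close>

lemma tame_integrable:
  assumes g: "tame f V g" and V: "finite V"
  shows "set_integrable (\<Pi>\<^sub>M v\<in>V. lborel) (cube V) g"
proof -
  obtain C N where CN: "\<And>x. norm (g x) \<le> C * (\<Prod>v\<in>V. 1 + norm (f (x v))) ^ N"
    using tame_bound[OF g V] by blast
  have "integrable (\<Pi>\<^sub>M v\<in>V. lborel) (\<lambda>x. C * (\<Prod>v\<in>V. indicator {0..t} (x v) * (1 + norm (f (x v))) ^ N))"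
    by (intro integrable_mult_right PL.product_integrable_prod[OF V] integrable_one_plus_norm_power)
  then show ?thesis
    unfolding set_integrable_def
  proof (rule Bochner_Integration.integrable_bound)
    show "(\<lambda>x. indicat_real (cube V) x *\<^sub>R g x) \<in> borel_measurable (\<Pi>\<^sub>M v\<in>V. lborel)"
      using tame_measurable[OF g] cube_sets[OF V] by (intro borel_measurable_scaleR borel_measurable_indicator)
    show "AE x in \<Pi>\<^sub>M v\<in>V. lborel. norm (indicat_real (cube V) x *\<^sub>R g x)
       \<le> norm (C * (\<Prod>v\<in>V. indicator {0..t} (x v) * (1 + norm (f (x v))) ^ N))"
    proof (rule AE_I2)
      fix x assume x: "x \<in> space (\<Pi>\<^sub>M v\<in>V. lborel :: real measure)"
      have "norm (indicat_real (cube V) x *\<^sub>R g x) \<le> indicat_real (cube V) x * (C * (\<Prod>v\<in>V. 1 + norm (f (x v))) ^ N)"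
        using CN by (auto simp: indicator_def)
      also have "\<dots> = C * (\<Prod>v\<in>V. indicator {0..t} (x v) * (1 + norm (f (x v))) ^ N)"
        unfolding indicator_cube[OF V x] by (simp add: prod.distrib prod_power_distrib)
      finally show "norm (indicat_real (cube V) x *\<^sub>R g x)
       \<le> norm (C * (\<Prod>v\<in>V. indicator {0..t} (x v) * (1 + norm (f (x v))) ^ N))" by simp
    qed
  qed
qed

lemma J_cmult: "J V (\<lambda>x. c * g x) = c * J V g"
  unfolding J_def by (rule set_integral_mult_right)

lemma J_sum:
  assumes "finite V" "\<And>i. i \<in> A \<Longrightarrow> tame f V (g i)"
  shows "J V (\<lambda>x. \<Sum>i\<in>A. g i x) = (\<Sum>i\<in>A. J V (g i))"
  using tame_integrable[OF assms(2) assms(1)]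
  unfolding J_def set_lebesgue_integral_def set_integrable_def
  by (simp add: scaleR_sum_right Bochner_Integration.integral_sum)

text \<open>Integrands need only agree at pairwise different times.\<close>

lemma J_cong:
  assumes V: "finite V" and g: "tame f V g" "tame f V h" and eq: "\<And>x. inj_on x V \<Longrightarrow> g x = h x"
  shows "J V g = J V h"
  unfolding J_def set_lebesgue_integral_def
proof (rule integral_cong_AE)
  show "AE x in \<Pi>\<^sub>M v\<in>V. lborel. indicat_real (cube V) x *\<^sub>R g x = indicat_real (cube V) x *\<^sub>R h x"
    using AE_PiM_lborel_inj[OF V] by eventually_elim (simp add: eq)
qed (use tame_measurable g cube_sets[OF V] in \<open>auto intro!: borel_measurable_scaleR borel_measurable_indicator\<close>)

lemma J_reindex:
  assumes \<phi>: "bij_betw \<phi> V V'" and V: "finite V" and g: "tame f V g"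
  shows "J V' (\<lambda>x. g (x \<circ> \<phi>)) = J V g"
proof -
  let ?M = "\<Pi>\<^sub>M v\<in>V. lborel :: real measure" and ?M' = "\<Pi>\<^sub>M v\<in>V'. lborel :: real measure"
  let ?r = "\<lambda>x. \<lambda>v\<in>V. x (\<phi> v)"
  have im: "\<phi> v \<in> V'" if "v \<in> V" for v using \<phi> that by (auto simp: bij_betw_def)
  have meas: "?r \<in> measurable ?M' ?M"
    using im by (intro measurable_restrict measurable_component_singleton)
  have gm: "(\<lambda>x. indicat_real (cube V) x *\<^sub>R g x) \<in> borel_measurable ?M"
    using tame_measurable[OF g] cube_sets[OF V] by (intro borel_measurable_scaleR borel_measurable_indicator)
  have "J V g = (\<integral>x. indicat_real (cube V) x *\<^sub>R g x \<partial>distr ?M' ?M ?r)"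
    unfolding PiM_lborel_reindex[OF \<phi> V] J_def set_lebesgue_integral_def ..
  also have "\<dots> = (\<integral>x. indicat_real (cube V) (?r x) *\<^sub>R g (?r x) \<partial>?M')"
    by (rule integral_distr[OF meas gm])
  also have "\<dots> = (\<integral>x. indicat_real (cube V') x *\<^sub>R g (x \<circ> \<phi>) \<partial>?M')"
  proof (rule Bochner_Integration.integral_cong[OF refl])
    fix x assume "x \<in> space ?M'"
    then have "?r x \<in> cube V \<longleftrightarrow> x \<in> cube V'"
      using \<phi> by (auto simp: cube_def space_PiM PiE_iff bij_betw_def)
    moreover have "g (?r x) = g (x \<circ> \<phi>)" by (rule tame_cong[OF g]) simp
    ultimately show "indicat_real (cube V) (?r x) *\<^sub>R g (?r x) = indicat_real (cube V') x *\<^sub>R g (x \<circ> \<phi>)"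
      by (simp add: indicator_def)
  qed
  finally show ?thesis by (simp add: J_def set_lebesgue_integral_def)
qed

text \<open>Integrals over disjoint sets of times multiply, by Fubini's theorem.\<close>

lemma J_mult:
  assumes V: "finite V1" "finite V2" "V1 \<inter> V2 = {}" and g: "tame f V1 g" and h: "tame f V2 h"
  shows "J V1 g * J V2 h = J (V1 \<union> V2) (\<lambda>x. g x * h x)"
proof -
  let ?M = "\<lambda>V. \<Pi>\<^sub>M v\<in>V. lborel :: real measure"
  let ?F = "\<lambda>x. indicat_real (cube (V1 \<union> V2)) x *\<^sub>R (g x * h x)"
  have "tame f (V1 \<union> V2) (\<lambda>x. g x * h x)"
    using g h by (auto intro: tame_mult tame_mono)
  then have int: "integrable (?M (V1 \<union> V2)) ?F"
    using tame_integrable V unfolding set_integrable_def by blast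
  have "J (V1 \<union> V2) (\<lambda>x. g x * h x) = (\<integral>x. (\<integral>y. ?F (merge V1 V2 (x, y)) \<partial>?M V2) \<partial>?M V1)"
    unfolding J_def set_lebesgue_integral_def by (rule PL.product_integral_fold[OF V(3,1,2) int])
  also have "\<dots> = (\<integral>x. (\<integral>y. (indicat_real (cube V1) x *\<^sub>R g x) * (indicat_real (cube V2) y *\<^sub>R h y) \<partial>?M V2) \<partial>?M V1)"
  proof (intro Bochner_Integration.integral_cong refl)
    fix x y assume xy: "x \<in> space (?M V1)" "y \<in> space (?M V2)"
    have "g (merge V1 V2 (x, y)) = g x" by (rule tame_cong[OF g]) (use V in \<open>simp add: merge_def\<close>)
    moreover have "h (merge V1 V2 (x, y)) = h y" by (rule tame_cong[OF h]) (use V in \<open>auto simp: merge_def\<close>)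
    moreover have "merge V1 V2 (x, y) \<in> cube (V1 \<union> V2) \<longleftrightarrow> x \<in> cube V1 \<and> y \<in> cube V2"
      using xy V by (auto simp: cube_def space_PiM PiE_iff merge_def extensional_def)
    ultimately show "?F (merge V1 V2 (x, y)) = (indicat_real (cube V1) x *\<^sub>R g x) * (indicat_real (cube V2) y *\<^sub>R h y)"
      by (auto simp: indicator_def)
  qed
  also have "\<dots> = J V1 g * J V2 h"
    by (simp only: J_def set_lebesgue_integral_def integral_mult_right_zero integral_mult_left_zero)
  finally show ?thesis by simp
qed

end

section \<open>Symbols given by integrals\<close>

lemma exp_adag_add: "exp_adag (c + d) = exp_adag c * exp_adag d"
  by (simp add: exp_adag_def fps_exp_add_mult)

lemma exp_a_add: "exp_a (c + d) = exp_a c * exp_a d"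
  by (rule fps_ext) (simp add: exp_a_def fps_mult_nth fps_exp_add_mult sum_fps_const)

lemma exp_symbol_nth: "(exp_adag u * exp_a w) $ j $ k = (w ^ j / fact j) * (u ^ k / fact k)"
  by (simp add: exp_adag_def exp_a_def mult.commute)

lemma prod_A_symbol:
  "(\<Prod>v\<in>V. A_symbol f (x v)) = exp_adag (\<Sum>v\<in>V. f (x v)) * exp_a (\<Sum>v\<in>V. cnj (f (x v)))"
proof (induction V rule: infinite_finite_induct)
  case (insert v V)
  then show ?case by (simp add: A_symbol_def exp_adag_add exp_a_add mult_ac)
qed (rule symbol_eqI, simp only: exp_symbol_nth, simp add: power_0_left)+

lemma sum_exp_binomial:
  fixes a b :: complex
  shows "(\<Sum>i\<le>n. (a ^ i / fact i) * (b ^ (n - i) / fact (n - i))) = (a + b) ^ n / fact n"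
proof -
  have "fps_exp (a + b) $ n = (fps_exp a * fps_exp b) $ n" by (simp add: fps_exp_add_mult)
  then show ?thesis by (simp add: fps_mult_nth atLeast0AtMost)
qed

context drive
begin

text \<open>The exponents of \<open>exp(u a\<dagger>)\<close> and \<open>exp(w a)\<close> in the product of the \<open>A(x\<^sub>v)\<close>.\<close>

definition fsum :: "'v set \<Rightarrow> ('v \<Rightarrow> real) \<Rightarrow> complex" where
  "fsum V x = (\<Sum>v\<in>V. f (x v))"

definition cfsum :: "'v set \<Rightarrow> ('v \<Rightarrow> real) \<Rightarrow> complex" where
  "cfsum V x = (\<Sum>v\<in>V. cnj (f (x v)))"

lemma tame_fsum: "tame f V (fsum V)" and tame_cfsum: "tame f V (cfsum V)"
  unfolding fsum_def cfsum_def by (intro tame_intros; assumption)+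

text \<open>The symbol \<open>\<integral> g(x) \<Prod>\<^sub>v A(x\<^sub>v) dx\<close> over the cube \<open>[0,t]\<^sup>V\<close>.\<close>

definition Sym :: "'v set \<Rightarrow> (('v \<Rightarrow> real) \<Rightarrow> complex) \<Rightarrow> symbol" where
  "Sym V g = symbol_integral (\<Pi>\<^sub>M v\<in>V. lborel) (cube V) (\<lambda>x. sconst (g x) * (\<Prod>v\<in>V. A_symbol f (x v)))"

lemma Sym_nth: "Sym V g $ j $ k = J V (\<lambda>x. g x * ((cfsum V x ^ j / fact j) * (fsum V x ^ k / fact k)))"
  unfolding Sym_def symbol_integral_def J_def fps_nth_Abs_fps sconst_mult_nth prod_A_symbol exp_symbol_nth
    fsum_def cfsum_def ..

lemma tame_Sym_coeff:
  "tame f V g \<Longrightarrow> tame f V (\<lambda>x. g x * ((cfsum V x ^ j / fact j) * (fsum V x ^ k / fact k)))"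
  by (intro tame_intros tame_fsum tame_cfsum)

lemma Sym_cong:
  assumes "finite V" "tame f V g" "tame f V h" "\<And>x. inj_on x V \<Longrightarrow> g x = h x"
  shows "Sym V g = Sym V h"
  by (rule symbol_eqI, unfold Sym_nth, rule J_cong)
     (use assms in \<open>simp_all only: tame_Sym_coeff\<close>)

lemma Sym_scale: "Sym V (\<lambda>x. c * g x) = sconst c * Sym V g"
  by (rule symbol_eqI) (simp only: Sym_nth mult.assoc J_cmult sconst_mult_nth)

lemma Sym_sum:
  assumes "finite V" "\<And>i. i \<in> A \<Longrightarrow> tame f V (g i)"
  shows "Sym V (\<lambda>x. \<Sum>i\<in>A. g i x) = (\<Sum>i\<in>A. Sym V (g i))"
proof (rule symbol_eqI)
  fix j k
  have "Sym V (\<lambda>x. \<Sum>i\<in>A. g i x) $ j $ k =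
      J V (\<lambda>x. \<Sum>i\<in>A. g i x * ((cfsum V x ^ j / fact j) * (fsum V x ^ k / fact k)))"
    by (simp only: Sym_nth sum_distrib_right)
  also have "\<dots> = (\<Sum>i\<in>A. Sym V (g i) $ j $ k)"
    unfolding Sym_nth by (rule J_sum[OF assms(1) tame_Sym_coeff[OF assms(2)]])
  finally show "Sym V (\<lambda>x. \<Sum>i\<in>A. g i x) $ j $ k = (\<Sum>i\<in>A. Sym V (g i)) $ j $ k"
    by (simp add: fps_sum_nth)
qed

lemma Sym_reindex:
  assumes \<phi>: "bij_betw \<phi> V V'" and V: "finite V" and g: "tame f V g"
  shows "Sym V' (\<lambda>x. g (x \<circ> \<phi>)) = Sym V g"
proof (rule symbol_eqI)
  fix j k
  have "cfsum V (x \<circ> \<phi>) = cfsum V' x" "fsum V (x \<circ> \<phi>) = fsum V' x" for x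
    unfolding cfsum_def fsum_def
    using sum.reindex_bij_betw[OF \<phi>, of "\<lambda>v. cnj (f (x v))"] sum.reindex_bij_betw[OF \<phi>, of "\<lambda>v. f (x v)"]
    by simp_all
  then show "Sym V' (\<lambda>x. g (x \<circ> \<phi>)) $ j $ k = Sym V g $ j $ k"
    unfolding Sym_nth using J_reindex[OF \<phi> V tame_Sym_coeff[OF g]] by simp
qed

lemma deriv_a_Sym: "(deriv_a ^^ r) (Sym V g) = Sym V (\<lambda>x. g x * cfsum V x ^ r)"
proof (induction r)
  case (Suc r)
  have "deriv_a (Sym V h) = Sym V (\<lambda>x. h x * cfsum V x)" for h
  proof (rule symbol_eqI)
    fix j k
    have eq: "of_nat (Suc j) * (h x * ((cfsum V x ^ Suc j / fact (Suc j)) * (fsum V x ^ k / fact k))) =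
        h x * cfsum V x * ((cfsum V x ^ j / fact j) * (fsum V x ^ k / fact k))" for x
      by (simp add: field_simps del: of_nat_Suc)
    show "deriv_a (Sym V h) $ j $ k = Sym V (\<lambda>x. h x * cfsum V x) $ j $ k"
      unfolding deriv_a_nth Sym_nth J_cmult[symmetric] eq ..
  qed
  then show ?case using Suc by (simp add: mult_ac)
qed simp

lemma deriv_adag_Sym: "(deriv_adag ^^ r) (Sym V g) = Sym V (\<lambda>x. g x * fsum V x ^ r)"
proof (induction r)
  case (Suc r)
  have "deriv_adag (Sym V h) = Sym V (\<lambda>x. h x * fsum V x)" for h
  proof (rule symbol_eqI)
    fix j k
    have eq: "of_nat (Suc k) * (h x * ((cfsum V x ^ j / fact j) * (fsum V x ^ Suc k / fact (Suc k)))) =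
        h x * fsum V x * ((cfsum V x ^ j / fact j) * (fsum V x ^ k / fact k))" for x
      by (simp add: field_simps del: of_nat_Suc)
    show "deriv_adag (Sym V h) $ j $ k = Sym V (\<lambda>x. h x * fsum V x) $ j $ k"
      unfolding deriv_adag_nth Sym_nth J_cmult[symmetric] eq ..
  qed
  then show ?case using Suc by (simp add: mult_ac)
qed simp

lemma Sym_mult:
  assumes V: "finite V1" "finite V2" "V1 \<inter> V2 = {}" and g: "tame f V1 g" and h: "tame f V2 h"
  shows "Sym V1 g * Sym V2 h = Sym (V1 \<union> V2) (\<lambda>x. g x * h x)"
proof (rule symbol_eqI)
  fix j k
  let ?c = "\<lambda>V x i l. (cfsum V x ^ i / fact i) * (fsum V x ^ l / fact l)"
  have sums: "cfsum (V1 \<union> V2) x = cfsum V1 x + cfsum V2 x" "fsum (V1 \<union> V2) x = fsum V1 x + fsum V2 x" for x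
    using V by (simp_all add: cfsum_def fsum_def sum.union_disjoint)
  have "(Sym V1 g * Sym V2 h) $ j $ k = (\<Sum>i\<le>j. \<Sum>l\<le>k. Sym V1 g $ i $ l * Sym V2 h $ (j - i) $ (k - l))"
    by (simp add: fps_mult_nth fps_sum_nth atLeast0AtMost)
  also have "\<dots> = (\<Sum>i\<le>j. \<Sum>l\<le>k. J (V1 \<union> V2) (\<lambda>x. (g x * ?c V1 x i l) * (h x * ?c V2 x (j - i) (k - l))))"
    unfolding Sym_nth by (intro sum.cong refl J_mult V tame_Sym_coeff g h)
  also have "\<dots> = J (V1 \<union> V2) (\<lambda>x. \<Sum>i\<le>j. \<Sum>l\<le>k. (g x * ?c V1 x i l) * (h x * ?c V2 x (j - i) (k - l)))"
  proof -
    have tm: "tame f (V1 \<union> V2) (\<lambda>x. (g x * ?c V1 x i l) * (h x * ?c V2 x (j - i) (k - l)))" for i l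
      by (rule tame_mult[OF tame_mono[OF tame_Sym_coeff[OF g]] tame_mono[OF tame_Sym_coeff[OF h]]]) auto
    show ?thesis
      using V(1,2) by (subst J_sum, simp, intro tame_sum tm) (intro sum.cong refl J_sum[symmetric] tm, simp)
  qed
  also have "(\<lambda>x. \<Sum>i\<le>j. \<Sum>l\<le>k. (g x * ?c V1 x i l) * (h x * ?c V2 x (j - i) (k - l))) =
      (\<lambda>x. g x * h x * ?c (V1 \<union> V2) x j k)"
  proof
    fix x
    have "(\<Sum>i\<le>j. \<Sum>l\<le>k. (g x * ?c V1 x i l) * (h x * ?c V2 x (j - i) (k - l))) =
       g x * h x * ((\<Sum>i\<le>j. (cfsum V1 x ^ i / fact i) * (cfsum V2 x ^ (j - i) / fact (j - i))) *
         (\<Sum>l\<le>k. (fsum V1 x ^ l / fact l) * (fsum V2 x ^ (k - l) / fact (k - l))))"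
      unfolding sum_product unfolding sum_distrib_left by (intro sum.cong refl) (simp only: mult_ac)
    then show "(\<Sum>i\<le>j. \<Sum>l\<le>k. (g x * ?c V1 x i l) * (h x * ?c V2 x (j - i) (k - l))) = g x * h x * ?c (V1 \<union> V2) x j k"
      by (simp only: sum_exp_binomial sums)
  qed
  finally show "(Sym V1 g * Sym V2 h) $ j $ k = Sym (V1 \<union> V2) (\<lambda>x. g x * h x) $ j $ k"
    by (simp add: Sym_nth)
qed

text \<open>The sum of all contractions of a vertex of \<open>V1\<close> with one of \<open>V2\<close>.\<close>

definition Wsum :: "'v set \<Rightarrow> 'v set \<Rightarrow> ('v \<Rightarrow> real) \<Rightarrow> complex" where
  "Wsum V1 V2 x = (\<Sum>i\<in>V1. \<Sum>j\<in>V2. W_contraction f (x i) (x j))"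

lemma Wsum_eq: "Wsum V1 V2 x = cfsum V1 x * fsum V2 x"
  by (simp add: Wsum_def cfsum_def fsum_def sum_product W_contraction_def)

lemma tame_Wsum: "V1 \<subseteq> V \<Longrightarrow> V2 \<subseteq> V \<Longrightarrow> tame f V (Wsum V1 V2)"
  unfolding Wsum_eq by (intro tame_mult tame_mono[OF tame_fsum] tame_mono[OF tame_cfsum])

text \<open>
  Differentiating by \<open>a\<close> and \<open>a\<dagger>\<close> multiplies the integrands by the sums of the \<open>cnj (f(x\<^sub>v))\<close> and \<open>f(x\<^sub>v)\<close>,
  so \<open>r\<close> contractions produce the \<open>r\<close>-th power of the product of these two sums.
\<close>

lemma contr_Sym:
  assumes V: "finite V1" "finite V2" "V1 \<inter> V2 = {}" and g: "tame f V1 g" and h: "tame f V2 h"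
  shows "contr r (Sym V1 g) (Sym V2 h) =
    sconst (1 / fact r) * Sym (V1 \<union> V2) (\<lambda>x. g x * h x * Wsum V1 V2 x ^ r)"
proof -
  have "(deriv_a ^^ r) (Sym V1 g) * (deriv_adag ^^ r) (Sym V2 h) =
      Sym (V1 \<union> V2) (\<lambda>x. (g x * cfsum V1 x ^ r) * (h x * fsum V2 x ^ r))"
    unfolding deriv_a_Sym deriv_adag_Sym
    by (intro Sym_mult V tame_mult tame_power g h tame_fsum tame_cfsum)
  also have "(\<lambda>x. (g x * cfsum V1 x ^ r) * (h x * fsum V2 x ^ r)) = (\<lambda>x. g x * h x * Wsum V1 V2 x ^ r)"
    by (simp add: Wsum_eq power_mult_distrib mult_ac)
  finally show ?thesis by (simp add: contr_def mult.assoc)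
qed

end

section \<open>Series of kernels\<close>

lemma sum_Pow_card:
  fixes h :: "nat \<Rightarrow> 'a :: comm_ring_1"
  assumes "finite A"
  shows "(\<Sum>B\<in>Pow A. h (card B)) = (\<Sum>i\<le>card A. of_nat (card A choose i) * h i)"
proof -
  have "(\<Sum>B\<in>Pow A. h (card B)) = (\<Sum>i\<in>{..card A}. \<Sum>B\<in>{B \<in> Pow A. card B = i}. h (card B))"
    using assms by (intro sum.group[symmetric]) (auto intro: card_mono)
  also have "\<dots> = (\<Sum>i\<le>card A. of_nat (card A choose i) * h i)"
  proof (rule sum.cong[OF refl])
    fix i
    have "(\<Sum>B\<in>{B \<in> Pow A. card B = i}. h (card B)) = (\<Sum>B\<in>{B. B \<subseteq> A \<and> card B = i}. h i)"
      by (intro sum.cong) auto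
    then show "(\<Sum>B\<in>{B \<in> Pow A. card B = i}. h (card B)) = of_nat (card A choose i) * h i"
      using n_subsets[OF assms, of i] by simp
  qed
  finally show ?thesis .
qed

text \<open>
  A kernel assigns to finite sets \<open>V\<close> of vertex labels and \<open>E\<close> of arc labels a function of the times
  \<open>x v\<close>, \<open>v \<in> V\<close>, in the applications a weighted sum of the integrands of the graphs on \<open>V\<close> with
  arc set \<open>E\<close>.
\<close>

type_synonym kernel = "nat set \<Rightarrow> nat set \<Rightarrow> (nat \<Rightarrow> real) \<Rightarrow> complex"

context drive
begin

text \<open>Integrability, and independence of the choice of labels.\<close>

definition good_kernel :: "kernel \<Rightarrow> bool" where
  "good_kernel K \<longleftrightarrow> (\<forall>V E. finite V \<longrightarrow> finite E \<longrightarrow> tame f V (K V E)) \<and>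
     (\<forall>\<phi> \<psi> V V' E E' x. finite V \<longrightarrow> finite E \<longrightarrow> bij_betw \<phi> V V' \<longrightarrow> bij_betw \<psi> E E' \<longrightarrow>
        K V' E' x = K V E (x \<circ> \<phi>))"

lemma good_kernel_tame: "good_kernel K \<Longrightarrow> finite V \<Longrightarrow> finite E \<Longrightarrow> tame f V (K V E)"
  by (simp add: good_kernel_def)

lemma good_kernel_relabel:
  "good_kernel K \<Longrightarrow> finite V \<Longrightarrow> finite E \<Longrightarrow> bij_betw \<phi> V V' \<Longrightarrow> bij_betw \<psi> E E' \<Longrightarrow>
     K V' E' x = K V E (x \<circ> \<phi>)"
  unfolding good_kernel_def
  by (drule conjunct2, drule spec[of _ \<phi>], drule spec[of _ \<psi>], drule spec[of _ V], drule spec[of _ V'],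
      drule spec[of _ E], drule spec[of _ E'], drule spec[of _ x]) simp

text \<open>
  The symbol series of a kernel.  Dividing by \<open>n! m!\<close> removes the labels.
\<close>

definition ser :: "kernel \<Rightarrow> symbol_series" where
  "ser K = Abs_fps (\<lambda>n. Abs_fps (\<lambda>m.
     sconst (1 / (fact n * fact m)) * Sym {..<n} (K {..<n} {..<m})))"

lemma ser_nth: "ser K $ n $ m = sconst (1 / (fact n * fact m)) * Sym {..<n} (K {..<n} {..<m})"
  by (simp add: ser_def)

lemma Sym_kernel_card:
  assumes K: "good_kernel K" and fin: "finite V" "finite E"
  shows "Sym V (K V E) = Sym {..<card V} (K {..<card V} {..<card E})"
proof -
  obtain \<phi> where \<phi>: "bij_betw \<phi> V {..<card V}"
    using finite_same_card_bij[OF fin(1), of "{..<card V}"] by auto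
  obtain \<psi> where \<psi>: "bij_betw \<psi> E {..<card E}"
    using finite_same_card_bij[OF fin(2), of "{..<card E}"] by auto
  have "Sym V (K V E) = Sym {..<card V} (\<lambda>x. K V E (x \<circ> \<phi>))"
    by (rule Sym_reindex[OF \<phi> fin(1) good_kernel_tame[OF K fin], symmetric])
  also have "(\<lambda>x. K V E (x \<circ> \<phi>)) = K {..<card V} {..<card E}"
    using good_kernel_relabel[OF K fin \<phi> \<psi>] by auto
  finally show ?thesis .
qed

text \<open>
  The kernel of a star product: the labels are distributed over the two factors and the contractions
  between them.
\<close>

definition conv :: "kernel \<Rightarrow> kernel \<Rightarrow> kernel" where
  "conv K L V E x = (\<Sum>V1\<in>Pow V. \<Sum>E1\<in>Pow E. \<Sum>E2\<in>Pow (E - E1).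
     K V1 E1 x * L (V - V1) E2 x * Wsum V1 (V - V1) x ^ card (E - E1 - E2))"

lemma tame_conv_term:
  assumes K: "good_kernel K" and L: "good_kernel L" and fin: "finite V" "finite E"
    and sub: "V1 \<subseteq> V" "E1 \<subseteq> E" "E2 \<subseteq> E"
  shows "tame f V (\<lambda>x. K V1 E1 x * L (V - V1) E2 x * Wsum V1 (V - V1) x ^ r)"
proof -
  have "finite V1" "finite E1" "finite (V - V1)" "finite E2"
    using fin sub finite_subset by auto
  then have "tame f V (K V1 E1)" "tame f V (L (V - V1) E2)"
    using good_kernel_tame[OF K, of V1 E1] good_kernel_tame[OF L, of "V - V1" E2] sub
    by (auto intro: tame_mono)
  then show ?thesis using sub by (intro tame_mult tame_power tame_Wsum) auto
qed

lemma good_conv: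
  assumes K: "good_kernel K" and L: "good_kernel L"
  shows "good_kernel (conv K L)"
  unfolding good_kernel_def
proof (intro conjI allI impI)
  fix V E :: "nat set" assume "finite V" "finite E"
  then show "tame f V (conv K L V E)"
    unfolding conv_def by (intro tame_sum tame_conv_term[OF K L, where E = E]) auto
next
  fix \<phi> \<psi> :: "nat \<Rightarrow> nat" and V V' E E' x
  assume fin: "finite V" "finite E" and \<phi>: "bij_betw \<phi> V V'" and \<psi>: "bij_betw \<psi> E E'"
  have "conv K L V' E' x = (\<Sum>V1\<in>Pow V. \<Sum>E1\<in>Pow E. \<Sum>E2\<in>Pow (E' - \<psi> ` E1).
     K (\<phi> ` V1) (\<psi> ` E1) x * L (V' - \<phi> ` V1) E2 x * Wsum (\<phi> ` V1) (V' - \<phi> ` V1) x ^ card (E' - \<psi> ` E1 - E2))"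
    unfolding conv_def
    by (subst sum.reindex_bij_betw[OF bij_betw_Pow[OF \<phi>], symmetric], rule sum.cong[OF refl],
        subst sum.reindex_bij_betw[OF bij_betw_Pow[OF \<psi>], symmetric], rule refl)
  also have "\<dots> = (\<Sum>V1\<in>Pow V. \<Sum>E1\<in>Pow E. \<Sum>E2\<in>Pow (E - E1).
     K (\<phi> ` V1) (\<psi> ` E1) x * L (V' - \<phi> ` V1) (\<psi> ` E2) x *
       Wsum (\<phi> ` V1) (V' - \<phi> ` V1) x ^ card (E' - \<psi> ` E1 - \<psi> ` E2))"
  proof (rule sum.cong[OF refl], rule sum.cong[OF refl])
    fix V1 E1 assume E1: "E1 \<in> Pow E"
    then have "bij_betw \<psi> (E - E1) (E' - \<psi> ` E1)"
      using bij_betw_subset[OF \<psi> _ refl, of E1] \<psi> by (intro bij_betw_DiffI) (auto dest: bij_betw_apply)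
    then have bij: "bij_betw (image \<psi>) (Pow (E - E1)) (Pow (E' - \<psi> ` E1))" by (rule bij_betw_Pow)
    show "(\<Sum>E2\<in>Pow (E' - \<psi> ` E1).
       K (\<phi> ` V1) (\<psi> ` E1) x * L (V' - \<phi> ` V1) E2 x * Wsum (\<phi> ` V1) (V' - \<phi> ` V1) x ^ card (E' - \<psi> ` E1 - E2)) =
     (\<Sum>E2\<in>Pow (E - E1). K (\<phi> ` V1) (\<psi> ` E1) x * L (V' - \<phi> ` V1) (\<psi> ` E2) x *
       Wsum (\<phi> ` V1) (V' - \<phi> ` V1) x ^ card (E' - \<psi> ` E1 - \<psi> ` E2))"
      by (rule sum.reindex_bij_betw[OF bij, symmetric])
  qed
  also have "\<dots> = conv K L V E (x \<circ> \<phi>)"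
    unfolding conv_def
  proof (intro sum.cong refl)
    fix V1 E1 E2 assume sub: "V1 \<in> Pow V" "E1 \<in> Pow E" "E2 \<in> Pow (E - E1)"
    have V1: "bij_betw \<phi> V1 (\<phi> ` V1)" and E1: "bij_betw \<psi> E1 (\<psi> ` E1)" and E2: "bij_betw \<psi> E2 (\<psi> ` E2)"
      using bij_betw_subset[OF \<phi> _ refl, of V1] bij_betw_subset[OF \<psi> _ refl, of E1]
        bij_betw_subset[OF \<psi> _ refl, of E2] sub by auto
    have V2: "bij_betw \<phi> (V - V1) (V' - \<phi> ` V1)"
      using \<phi> sub by (intro bij_betw_DiffI V1) (auto dest: bij_betw_apply)
    have E3: "bij_betw \<psi> (E - E1) (E' - \<psi> ` E1)"
      using \<psi> sub by (intro bij_betw_DiffI E1) (auto dest: bij_betw_apply)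
    have "bij_betw \<psi> (E - E1 - E2) (E' - \<psi> ` E1 - \<psi> ` E2)"
      by (rule bij_betw_DiffI[OF E3 E2]) (use sub bij_betw_imp_surj_on[OF E3] in blast)+
    then have c: "card (E' - \<psi> ` E1 - \<psi> ` E2) = card (E - E1 - E2)"
      by (simp add: bij_betw_same_card)
    have "finite V1" "finite E1" "finite (V - V1)" "finite E2"
      using fin sub by (auto intro: finite_subset[of _ V] finite_subset[of _ E])
    then have "K (\<phi> ` V1) (\<psi> ` E1) x = K V1 E1 (x \<circ> \<phi>)" "L (V' - \<phi> ` V1) (\<psi> ` E2) x = L (V - V1) E2 (x \<circ> \<phi>)"
      using good_kernel_relabel[OF K _ _ V1 E1] good_kernel_relabel[OF L _ _ V2 E2] by auto
    moreover have "Wsum (\<phi> ` V1) (V' - \<phi> ` V1) x = Wsum V1 (V - V1) (x \<circ> \<phi>)"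
      unfolding Wsum_def by (simp add: sum.reindex_bij_betw[OF V1, symmetric] sum.reindex_bij_betw[OF V2, symmetric])
    ultimately show "K (\<phi> ` V1) (\<psi> ` E1) x * L (V' - \<phi> ` V1) (\<psi> ` E2) x *
        Wsum (\<phi> ` V1) (V' - \<phi> ` V1) x ^ card (E' - \<psi> ` E1 - \<psi> ` E2) =
      K V1 E1 (x \<circ> \<phi>) * L (V - V1) E2 (x \<circ> \<phi>) * Wsum V1 (V - V1) (x \<circ> \<phi>) ^ card (E - E1 - E2)"
      by (simp add: c)
  qed
  finally show "conv K L V' E' x = conv K L V E (x \<circ> \<phi>)" .
qed

text \<open>
  The number of ways to distribute the labels is a product of binomial coefficients, which cancels
  against the factorials in \<^const>\<open>ser\<close> and the factorial of the number of contractions.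
\<close>

lemma ser_conv:
  assumes K: "good_kernel K" and L: "good_kernel L"
  shows "ser K \<star>\<^sub>\<lambda> ser L = ser (conv K L)"
proof (rule fps_ext, rule fps_ext)
  fix n m :: nat
  let ?V = "{..<n}" and ?E = "{..<m}"
  define S where "S i p = Sym {..<i} (K {..<i} {..<p})" for i p
  define R where "R i p = Sym {..<i} (L {..<i} {..<p})" for i p
  define T where "T i p q = contr (m - p - q) (S i p) (R (n - i) q)" for i p q
  have "Sym ?V (conv K L ?V ?E) = (\<Sum>V1\<in>Pow ?V. \<Sum>E1\<in>Pow ?E. \<Sum>E2\<in>Pow (?E - E1).
     Sym ?V (\<lambda>x. K V1 E1 x * L (?V - V1) E2 x * Wsum V1 (?V - V1) x ^ card (?E - E1 - E2)))"
  proof -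
    have tm: "tame f ?V (\<lambda>x. K V1 E1 x * L (?V - V1) E2 x * Wsum V1 (?V - V1) x ^ r)"
      if "V1 \<in> Pow ?V" "E1 \<in> Pow ?E" "E2 \<in> Pow (?E - E1)" for V1 E1 E2 r
      using that by (intro tame_conv_term[OF K L, where E = ?E]) auto
    have "Sym ?V (conv K L ?V ?E) = Sym ?V (\<lambda>x. \<Sum>V1\<in>Pow ?V. \<Sum>E1\<in>Pow ?E. \<Sum>E2\<in>Pow (?E - E1).
       K V1 E1 x * L (?V - V1) E2 x * Wsum V1 (?V - V1) x ^ card (?E - E1 - E2))"
      by (simp only: conv_def[abs_def])
    also have "\<dots> = (\<Sum>V1\<in>Pow ?V. Sym ?V (\<lambda>x. \<Sum>E1\<in>Pow ?E. \<Sum>E2\<in>Pow (?E - E1).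
       K V1 E1 x * L (?V - V1) E2 x * Wsum V1 (?V - V1) x ^ card (?E - E1 - E2)))"
      by (intro Sym_sum tame_sum tm) auto
    also have "\<dots> = (\<Sum>V1\<in>Pow ?V. \<Sum>E1\<in>Pow ?E. Sym ?V (\<lambda>x. \<Sum>E2\<in>Pow (?E - E1).
       K V1 E1 x * L (?V - V1) E2 x * Wsum V1 (?V - V1) x ^ card (?E - E1 - E2)))"
      by (intro sum.cong refl Sym_sum tame_sum tm) auto
    also have "\<dots> = (\<Sum>V1\<in>Pow ?V. \<Sum>E1\<in>Pow ?E. \<Sum>E2\<in>Pow (?E - E1). Sym ?V (\<lambda>x.
       K V1 E1 x * L (?V - V1) E2 x * Wsum V1 (?V - V1) x ^ card (?E - E1 - E2)))"
      by (intro sum.cong refl Sym_sum tm) auto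
    finally show ?thesis .
  qed
  also have "\<dots> = (\<Sum>V1\<in>Pow ?V. \<Sum>E1\<in>Pow ?E. \<Sum>E2\<in>Pow (?E - E1).
      sconst (fact (m - card E1 - card E2)) * T (card V1) (card E1) (card E2))"
  proof (intro sum.cong refl)
    fix V1 E1 E2 assume sub: "V1 \<in> Pow ?V" "E1 \<in> Pow ?E" "E2 \<in> Pow (?E - E1)"
    then have fin: "finite V1" "finite (?V - V1)" "finite E1" "finite E2"
      by (auto intro: finite_subset)
    have cards: "card (?E - E1 - E2) = m - card E1 - card E2" "card (?V - V1) = n - card V1"
      using sub fin by (auto simp: card_Diff_subset)
    let ?r = "m - card E1 - card E2"
    have "T (card V1) (card E1) (card E2) = contr ?r (Sym V1 (K V1 E1)) (Sym (?V - V1) (L (?V - V1) E2))"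
      unfolding T_def S_def R_def Sym_kernel_card[OF K fin(1,3)] Sym_kernel_card[OF L fin(2,4)] cards ..
    also have "\<dots> = sconst (1 / fact ?r) * Sym (V1 \<union> (?V - V1)) (\<lambda>x. K V1 E1 x * L (?V - V1) E2 x * Wsum V1 (?V - V1) x ^ ?r)"
      by (rule contr_Sym) (use fin good_kernel_tame[OF K] good_kernel_tame[OF L] in auto)
    also have "V1 \<union> (?V - V1) = ?V" using sub by auto
    finally have "sconst (fact ?r) * T (card V1) (card E1) (card E2) =
      (sconst (fact ?r) * sconst (1 / fact ?r)) * Sym ?V (\<lambda>x. K V1 E1 x * L (?V - V1) E2 x * Wsum V1 (?V - V1) x ^ ?r)"
      by (simp only: mult.assoc)
    also have "sconst (fact ?r) * sconst (1 / fact ?r) = 1"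
      by (simp add: sconst_mult[symmetric])
    finally show "Sym ?V (\<lambda>x. K V1 E1 x * L (?V - V1) E2 x * Wsum V1 (?V - V1) x ^ card (?E - E1 - E2)) =
      sconst (fact ?r) * T (card V1) (card E1) (card E2)"
      by (simp add: cards)
  qed
  also have "\<dots> = (\<Sum>V1\<in>Pow ?V. \<Sum>E1\<in>Pow ?E. \<Sum>q\<le>m - card E1. of_nat ((m - card E1) choose q) *
      (sconst (fact (m - card E1 - q)) * T (card V1) (card E1) q))"
  proof (rule sum.cong[OF refl], rule sum.cong[OF refl])
    fix V1 E1 assume "E1 \<in> Pow ?E"
    then have "card (?E - E1) = m - card E1" by (auto simp: card_Diff_subset finite_subset)
    then show "(\<Sum>E2\<in>Pow (?E - E1). sconst (fact (m - card E1 - card E2)) * T (card V1) (card E1) (card E2)) =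
      (\<Sum>q\<le>m - card E1. of_nat ((m - card E1) choose q) *
        (sconst (fact (m - card E1 - q)) * T (card V1) (card E1) q))"
      using sum_Pow_card[of "?E - E1" "\<lambda>q. sconst (fact (m - card E1 - q)) * T (card V1) (card E1) q"] by simp
  qed
  also have "\<dots> = (\<Sum>V1\<in>Pow ?V. \<Sum>p\<le>m. of_nat (m choose p) * (\<Sum>q\<le>m - p. of_nat ((m - p) choose q) *
      (sconst (fact (m - p - q)) * T (card V1) p q)))"
    using sum_Pow_card[of ?E "\<lambda>p. \<Sum>q\<le>m - p. of_nat ((m - p) choose q) *
      (sconst (fact (m - p - q)) * T _ p q)"] by simp
  also have "\<dots> = (\<Sum>i\<le>n. of_nat (n choose i) * (\<Sum>p\<le>m. of_nat (m choose p) *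
      (\<Sum>q\<le>m - p. of_nat ((m - p) choose q) * (sconst (fact (m - p - q)) * T i p q))))"
    using sum_Pow_card[of ?V "\<lambda>i. \<Sum>p\<le>m. of_nat (m choose p) *
      (\<Sum>q\<le>m - p. of_nat ((m - p) choose q) * (sconst (fact (m - p - q)) * T i p q))"] by simp
  finally have "sconst (1 / (fact n * fact m)) * Sym ?V (conv K L ?V ?E) =
    (\<Sum>i\<le>n. \<Sum>p\<le>m. \<Sum>q\<le>m - p. sconst (1 / (fact n * fact m)) * (of_nat (n choose i) * (of_nat (m choose p) *
      (of_nat ((m - p) choose q) * (sconst (fact (m - p - q)) * T i p q)))))"
    by (simp only: sum_distrib_left)
  also have "\<dots> = (\<Sum>i\<le>n. \<Sum>p\<le>m. \<Sum>q\<le>m - p.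
      sconst (1 / (fact i * fact p)) * (sconst (1 / (fact (n - i) * fact q)) * T i p q))"
  proof (intro sum.cong refl)
    fix i p q assume ipq: "i \<in> {..n}" "p \<in> {..m}" "q \<in> {..m - p}"
    have "(1 / (fact n * fact m) * (of_nat (n choose i) * (of_nat (m choose p) *
        (of_nat ((m - p) choose q) * fact (m - p - q)))) :: complex) =
      1 / (fact i * fact p) * (1 / (fact (n - i) * fact q))"
      using ipq by (simp add: binomial_fact)
    then show "sconst (1 / (fact n * fact m)) * (of_nat (n choose i) * (of_nat (m choose p) *
      (of_nat ((m - p) choose q) * (sconst (fact (m - p - q)) * T i p q)))) =
      sconst (1 / (fact i * fact p)) * (sconst (1 / (fact (n - i) * fact q)) * T i p q)"
      by (simp only: sconst_of_nat[symmetric] sconst_mult[symmetric] mult.assoc[symmetric])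
  qed
  also have "\<dots> = (\<Sum>i\<le>n. \<Sum>r\<le>m. \<Sum>p\<le>m - r. contr r (ser K $ i $ p) (ser L $ (n - i) $ (m - r - p)))"
  proof (rule sum.cong[OF refl])
    fix i
    let ?g = "\<lambda>p q. sconst (1 / (fact i * fact p)) * (sconst (1 / (fact (n - i) * fact q)) * T i p q)"
    have "(\<Sum>p\<le>m. \<Sum>q\<le>m - p. ?g p q) = (\<Sum>r\<le>m. \<Sum>p\<le>m - r. ?g p (m - r - p))"
      unfolding sum.Sigma[OF finite_atMost ballI[OF finite_atMost]]
      by (rule sum.reindex_bij_witness[of _ "\<lambda>(r, p). (p, m - r - p)" "\<lambda>(p, q). (m - p - q, p)"]) auto
    also have "\<dots> = (\<Sum>r\<le>m. \<Sum>p\<le>m - r. contr r (ser K $ i $ p) (ser L $ (n - i) $ (m - r - p)))"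
    proof (intro sum.cong refl)
      fix r p assume "r \<in> {..m}" "p \<in> {..m - r}"
      then have "m - p - (m - r - p) = r" by auto
      then show "?g p (m - r - p) = contr r (ser K $ i $ p) (ser L $ (n - i) $ (m - r - p))"
        by (simp add: ser_nth contr_scale_left contr_scale_right T_def S_def R_def)
    qed
    finally show "(\<Sum>p\<le>m. \<Sum>q\<le>m - p. ?g p q) =
      (\<Sum>r\<le>m. \<Sum>p\<le>m - r. contr r (ser K $ i $ p) (ser L $ (n - i) $ (m - r - p)))" .
  qed
  finally show "(ser K \<star>\<^sub>\<lambda> ser L) $ n $ m = ser (conv K L) $ n $ m"
    by (simp add: star_series_nth star_nth fps_sum_nth ser_nth[of "conv K L"])
qed

text \<open>The kernel of the unit series.\<close>

definition unit_kernel :: kernel where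
  "unit_kernel V E x = of_bool (V = {} \<and> E = {})"

text \<open>The kernel of a star power.\<close>

primrec conv_power :: "kernel \<Rightarrow> nat \<Rightarrow> kernel" where
  "conv_power K 0 = unit_kernel"
| "conv_power K (Suc k) = conv K (conv_power K k)"

lemma good_unit_kernel: "good_kernel unit_kernel"
  unfolding good_kernel_def unit_kernel_def
proof (intro conjI allI impI)
  fix \<phi> \<psi> :: "nat \<Rightarrow> nat" and V V' E E' :: "nat set"
  assume "bij_betw \<phi> V V'" "bij_betw \<psi> E E'"
  then have "V' = {} \<longleftrightarrow> V = {}" "E' = {} \<longleftrightarrow> E = {}" by (auto simp: bij_betw_def)
  then show "(of_bool (V' = {} \<and> E' = {}) :: complex) = of_bool (V = {} \<and> E = {})" by simp
qed (rule tame_const)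

lemma good_conv_power: "good_kernel K \<Longrightarrow> good_kernel (conv_power K k)"
  by (induction k) (auto intro: good_unit_kernel good_conv)

lemma ser_unit_kernel: "ser unit_kernel = 1"
proof (rule fps_ext, rule fps_ext, rule symbol_eqI)
  fix n m j k
  show "ser unit_kernel $ n $ m $ j $ k = (1 :: symbol_series) $ n $ m $ j $ k"
  proof (cases "n = 0 \<and> m = 0")
    case True
    have "J {} (\<lambda>x. g x) = g (\<lambda>_. undefined)" for g :: "(nat \<Rightarrow> real) \<Rightarrow> complex"
      by (simp add: J_def set_lebesgue_integral_def PiM_empty cube_def lebesgue_integral_count_space_finite)
    then show ?thesis using True
      by (simp add: ser_nth Sym_nth unit_kernel_def cfsum_def fsum_def power_0_left)
  next
    case False
    have "Sym {..<n} (\<lambda>x. 0) $ j $ k = 0" by (simp add: Sym_nth J_def set_lebesgue_integral_def)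
    moreover have "unit_kernel {..<n} {..<m} = (\<lambda>x. 0)" using False by (auto simp: unit_kernel_def fun_eq_iff)
    ultimately show ?thesis using False by (auto simp: ser_nth)
  qed
qed

lemma star_power_ser: "good_kernel K \<Longrightarrow> star_power (ser K) k = ser (conv_power K k)"
  by (induction k) (simp_all add: ser_unit_kernel ser_conv good_conv_power)

lemma exp_star_ser:
  assumes K: "good_kernel K"
  shows "exp_star (ser K) $ n $ m = sconst (1 / (fact n * fact m)) *
    Sym {..<n} (\<lambda>x. \<Sum>k\<le>n. 1 / fact k * conv_power K k {..<n} {..<m} x)"
proof -
  have "Sym {..<n} (\<lambda>x. \<Sum>k\<le>n. 1 / fact k * conv_power K k {..<n} {..<m} x) =
      (\<Sum>k\<le>n. Sym {..<n} (\<lambda>x. 1 / fact k * conv_power K k {..<n} {..<m} x))"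
    using good_kernel_tame[OF good_conv_power[OF K]] by (intro Sym_sum tame_mult tame_const) auto
  also have "\<dots> = (\<Sum>k\<le>n. sconst (1 / fact k) * Sym {..<n} (conv_power K k {..<n} {..<m}))"
    by (simp only: Sym_scale)
  finally show ?thesis
    by (simp add: exp_star_def fps_sum_nth star_power_ser[OF K] ser_nth sum_distrib_left mult.left_commute)
qed

end

section \<open>The Dyson series as a series of a kernel\<close>

lemma deriv_a_pow_exp: "(deriv_a ^^ r) (exp_adag u * exp_a w) = sconst (w ^ r) * (exp_adag u * exp_a w)"
proof (induction r)
  case (Suc r)
  have D: "deriv_a (exp_adag u * exp_a w) = sconst w * (exp_adag u * exp_a w)"
    by (rule symbol_eqI, simp only: deriv_a_nth exp_symbol_nth sconst_mult_nth)
       (simp add: field_simps del: of_nat_Suc)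
  show ?case
    unfolding funpow.simps comp_apply Suc.IH a.scale D power_Suc sconst_mult by (simp only: mult_ac)
qed simp

lemma deriv_adag_pow_exp: "(deriv_adag ^^ r) (exp_adag u * exp_a w) = sconst (u ^ r) * (exp_adag u * exp_a w)"
proof (induction r)
  case (Suc r)
  have D: "deriv_adag (exp_adag u * exp_a w) = sconst u * (exp_adag u * exp_a w)"
    by (rule symbol_eqI, simp only: deriv_adag_nth exp_symbol_nth sconst_mult_nth)
       (simp add: field_simps del: of_nat_Suc)
  show ?case
    unfolding funpow.simps comp_apply Suc.IH adag.scale D power_Suc sconst_mult by (simp only: mult_ac)
qed simp

lemma contr_exp:
  "contr r (exp_adag u * exp_a w) (exp_adag u' * exp_a w') =
     sconst ((w * u') ^ r / fact r) * (exp_adag (u + u') * exp_a (w + w'))"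
  unfolding contr_def deriv_a_pow_exp deriv_adag_pow_exp exp_adag_add exp_a_add
  by (simp add: power_mult_distrib divide_inverse sconst_mult mult_ac)

text \<open>The sum of the contractions of pairs of list entries.\<close>

primrec pair_sum :: "(real \<Rightarrow> complex) \<Rightarrow> ('v \<Rightarrow> real) \<Rightarrow> 'v list \<Rightarrow> complex" where
  "pair_sum f x [] = 0"
| "pair_sum f x (i # is) = (\<Sum>j\<in>set is. W_contraction f (x i) (x j)) + pair_sum f x is"

lemma foldr_star_A:
  assumes "distinct is"
  shows "foldr (\<star>) (map (\<lambda>i. fps_const (A_symbol f (x i))) is) 1 $ m =
    sconst (pair_sum f x is ^ m / fact m) * (\<Prod>i\<in>set is. A_symbol f (x i))"
  using assms
proof (induction "is" arbitrary: m)
  case Nil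
  show ?case by (cases m) auto
next
  case (Cons i "is")
  let ?G = "foldr (\<star>) (map (\<lambda>i. fps_const (A_symbol f (x i))) is) 1"
  let ?u = "\<Sum>v\<in>set is. f (x v)" and ?w = "\<Sum>v\<in>set is. cnj (f (x v))"
  let ?c = "pair_sum f x is" and ?d = "cnj (f (x i)) * ?u"
  have "foldr (\<star>) (map (\<lambda>i. fps_const (A_symbol f (x i))) (i # is)) 1 $ m =
      (\<Sum>r\<le>m. \<Sum>p\<le>m - r. if p = 0 then contr r (A_symbol f (x i)) (?G $ (m - r)) else 0)"
    unfolding list.map foldr.simps comp_apply star_nth by (intro sum.cong refl) auto
  also have "\<dots> = (\<Sum>r\<le>m. contr r (A_symbol f (x i)) (?G $ (m - r)))"
    by simp
  also have "\<dots> = (\<Sum>r\<le>m. sconst ((?d ^ r / fact r) * (?c ^ (m - r) / fact (m - r))) *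
      (exp_adag (f (x i) + ?u) * exp_a (cnj (f (x i)) + ?w)))"
  proof (rule sum.cong[OF refl])
    fix r
    have "contr r (A_symbol f (x i)) (?G $ (m - r)) =
        sconst (?c ^ (m - r) / fact (m - r)) * contr r (exp_adag (f (x i)) * exp_a (cnj (f (x i)))) (exp_adag ?u * exp_a ?w)"
    proof -
      have IH: "?G $ (m - r) = sconst (?c ^ (m - r) / fact (m - r)) * (exp_adag ?u * exp_a ?w)"
        using Cons by (simp only: prod_A_symbol distinct.simps)
      show ?thesis unfolding IH contr_scale_right by (simp only: A_symbol_def)
    qed
    then show "contr r (A_symbol f (x i)) (?G $ (m - r)) =
        sconst ((?d ^ r / fact r) * (?c ^ (m - r) / fact (m - r))) *
        (exp_adag (f (x i) + ?u) * exp_a (cnj (f (x i)) + ?w))"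
      by (simp only: contr_exp sconst_mult mult_ac)
  qed
  also have "\<dots> = sconst ((?d + ?c) ^ m / fact m) * (exp_adag (f (x i) + ?u) * exp_a (cnj (f (x i)) + ?w))"
    by (simp only: sum_distrib_right[symmetric] sconst_sum[symmetric] sum_exp_binomial)
  also have "exp_adag (f (x i) + ?u) * exp_a (cnj (f (x i)) + ?w) = (\<Prod>i\<in>set (i # is). A_symbol f (x i))"
    using Cons.prems by (simp add: prod_A_symbol)
  also have "?d + ?c = pair_sum f x (i # is)"
    by (simp add: W_contraction_def sum_distrib_left)
  finally show ?case .
qed

text \<open>At decreasing times exactly the pairs in list order have step function one.\<close>

lemma pair_sum_sorted:
  assumes "distinct is" "sorted_wrt (\<lambda>i j. x j < x i) is"
  shows "pair_sum f x is = (\<Sum>i\<in>set is. \<Sum>j\<in>set is. W_contraction f (x i) (x j) * theta (x i - x j))"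
  using assms
proof (induction "is")
  case (Cons i "is")
  let ?g = "\<lambda>i j. W_contraction f (x i) (x j) * theta (x i - x j)"
  have "(\<Sum>a\<in>set (i # is). \<Sum>b\<in>set (i # is). ?g a b) =
      (?g i i + (\<Sum>b\<in>set is. ?g i b)) + (\<Sum>a\<in>set is. ?g a i + (\<Sum>b\<in>set is. ?g a b))"
    using Cons.prems by simp
  also have "(\<Sum>b\<in>set is. ?g i b) = (\<Sum>b\<in>set is. W_contraction f (x i) (x b))"
    using Cons.prems by (intro sum.cong) (auto simp: theta_def)
  also have "(\<Sum>a\<in>set is. ?g a i + (\<Sum>b\<in>set is. ?g a b)) = (\<Sum>a\<in>set is. \<Sum>b\<in>set is. ?g a b)"
    using Cons.prems by (intro sum.cong) (auto simp: theta_def)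
  finally show ?case using Cons by (simp add: theta_def)
qed simp

lemma time_ordered_antimono:
  assumes x: "x \<in> time_ordered t n" and ij: "1 \<le> i" "i < j" "j \<le> n"
  shows "x j < x i"
  using ij(2,3)
proof (induction j)
  case (Suc j)
  have step: "x (Suc j) < x j" if "1 \<le> j"
    using x that Suc.prems by (auto simp: time_ordered_def)
  show ?case
  proof (cases "i = j")
    case False
    then have "x j < x i" using Suc by simp
    then show ?thesis using step Suc.prems False ij(1) by simp
  qed (use step ij in simp)
qed simp

lemma time_ordered_bounds:
  assumes x: "x \<in> time_ordered t n" and i: "i \<in> {1..n}"
  shows "0 < x i \<and> x i < t"
proof -
  have "x n \<le> x i" using time_ordered_antimono[OF x, of i n] i by (cases "i = n") auto
  moreover have "x i \<le> x 1" using time_ordered_antimono[OF x, of 1 i] i by (cases "i = 1") auto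
  moreover have "0 < x n" "x 1 < t" using x by (auto simp: time_ordered_def)
  ultimately show ?thesis by simp
qed

lemma time_ordered_sets:
  assumes "n \<ge> 1"
  shows "time_ordered t n \<in> sets (\<Pi>\<^sub>M i\<in>{1..n}. lborel)"
proof -
  let ?M = "\<Pi>\<^sub>M i\<in>{1..n}. lborel :: real measure"
  have m: "(\<lambda>x. x i) \<in> borel_measurable ?M" if "i \<in> {1..n}" for i
    using measurable_component_singleton[OF that, of "\<lambda>_. lborel"] by simp
  have "time_ordered t n = {x \<in> space ?M. 0 < x n \<and> (\<forall>i\<in>{1..<n}. x (i + 1) < x i) \<and> x 1 < t}"
    by (auto simp: time_ordered_def space_PiM)
  also have "\<dots> \<in> sets ?M"
    using assms
    by (intro sets.sets_Collect_conj sets.sets_Collect_finite_All borel_measurable_less borel_measurable_const m) auto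
  finally show ?thesis .
qed

text \<open>
  Up to coincidences of times the cube is the disjoint union of the \<open>n!\<close> permuted images of the
  time-ordered simplex.
\<close>

lemma sum_perm_time_ordered:
  fixes x :: "nat \<Rightarrow> real"
  assumes n: "n \<ge> 1" and inj: "inj_on x {1..n}" and ext: "x \<in> extensional {1..n}"
    and neq: "\<And>i. i \<in> {1..n} \<Longrightarrow> x i \<noteq> 0 \<and> x i \<noteq> t"
  shows "(\<Sum>xs\<in>permutations_of_set {1..n}. indicat_real (time_ordered t n) (\<lambda>i\<in>{1..n}. x (xs ! (i - 1)))) =
    indicat_real (\<Pi>\<^sub>E i\<in>{1..n}. {0..t}) x"
proof -
  let ?r = "\<lambda>xs. \<lambda>i\<in>{1..n}. x (xs ! (i - 1))"
  let ?P = "permutations_of_set {1..n}"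
  have nth: "xs ! (i - 1) \<in> {1..n}" if "xs \<in> ?P" "i \<in> {1..n}" for xs i
  proof -
    have "set xs = {1..n}" "length xs = n"
      using that length_finite_permutations_of_set[of xs "{1..n}"] by (auto simp: permutations_of_set_def)
    then show ?thesis using that nth_mem[of "i - 1" xs] by auto
  qed
  show ?thesis
  proof (cases "x \<in> (\<Pi>\<^sub>E i\<in>{1..n}. {0..t})")
    case False
    have "?r xs \<notin> time_ordered t n" if xs: "xs \<in> ?P" for xs
    proof
      assume T: "?r xs \<in> time_ordered t n"
      have "x i \<in> {0..t}" if "i \<in> {1..n}" for i
      proof -
        have "i \<in> set xs" "length xs = n"
          using xs that length_finite_permutations_of_set[of xs "{1..n}"] by (auto simp: permutations_of_set_def)
        then obtain k where "k < n" "xs ! k = i" by (metis in_set_conv_nth)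
        then show ?thesis using time_ordered_bounds[OF T, of "Suc k"] by auto
      qed
      then show False using False ext by (auto simp: PiE_def)
    qed
    then show ?thesis using False by simp
  next
    case True
    have bounds: "0 < x i" "x i < t" if "i \<in> {1..n}" for i
      using neq[OF that] PiE_mem[OF True that] by auto
    have iff: "?r xs \<in> time_ordered t n \<longleftrightarrow> sorted (map (\<lambda>i. - x i) xs)" if xs: "xs \<in> ?P" for xs
    proof -
      have len: "length xs = n" and dist: "distinct xs" and set: "set xs = {1..n}"
        using xs length_finite_permutations_of_set[of xs "{1..n}"] by (auto simp: permutations_of_set_def)
      have neq': "x (xs ! Suc k) \<noteq> x (xs ! k)" if "Suc k < n" for k
      proof
        assume "x (xs ! Suc k) = x (xs ! k)"
        then have "xs ! Suc k = xs ! k"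
          using inj nth[OF xs, of "Suc k"] nth[OF xs, of "Suc (Suc k)"] that by (auto dest: inj_onD)
        then show False using dist that len nth_eq_iff_index_eq[of xs "Suc k" k] by simp
      qed
      have "sorted (map (\<lambda>i. - x i) xs) \<longleftrightarrow> (\<forall>k. Suc k < n \<longrightarrow> x (xs ! Suc k) \<le> x (xs ! k))"
        by (simp add: sorted_iff_nth_Suc len)
      also have "\<dots> \<longleftrightarrow> (\<forall>k. Suc k < n \<longrightarrow> x (xs ! Suc k) < x (xs ! k))"
        using neq' by (auto simp: less_le)
      also have "\<dots> \<longleftrightarrow> (\<forall>i\<in>{1..<n}. x (xs ! i) < x (xs ! (i - 1)))"
      proof safe
        fix i assume "\<forall>k. Suc k < n \<longrightarrow> x (xs ! Suc k) < x (xs ! k)" "i \<in> {1..<n}"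
        then show "x (xs ! i) < x (xs ! (i - 1))" by (cases i) auto
      next
        fix k assume "\<forall>i\<in>{1..<n}. x (xs ! i) < x (xs ! (i - 1))" "Suc k < n"
        from bspec[OF this(1), of "Suc k"] this(2) show "x (xs ! Suc k) < x (xs ! k)" by simp
      qed
      also have "\<dots> \<longleftrightarrow> ?r xs \<in> time_ordered t n"
        using n bounds nth[OF xs, of n] nth[OF xs, of 1] by (auto simp: time_ordered_def)
      finally show ?thesis by simp
    qed
    obtain s where s: "s \<in> ?P" and sorted: "sorted (map (\<lambda>i. - x i) s)"
      by (rule that[of "sort_key (\<lambda>i. - x i) (sorted_list_of_set {1..n})"])
         (simp_all add: permutations_of_set_def)
    have "(\<Sum>xs\<in>?P. indicat_real (time_ordered t n) (?r xs)) = (\<Sum>xs\<in>?P. if xs = s then 1 else 0)"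
    proof (rule sum.cong[OF refl])
      fix xs assume xs: "xs \<in> ?P"
      have inj': "inj_on (\<lambda>i. - x i) {1..n}"
        by (rule inj_onI) (use inj_onD[OF inj] in simp)
      have "xs = s" if "sorted (map (\<lambda>i. - x i) xs)"
      proof (rule map_sorted_distinct_set_unique[of "\<lambda>i. - x i"])
        have xs': "set xs = {1..n}" "distinct xs" and s': "set s = {1..n}" "distinct s"
          using xs s by (simp_all add: permutations_of_set_def)
        show "set xs = set s" by (simp only: xs' s')
        show "inj_on (\<lambda>i. - x i) (set xs \<union> set s)"
          unfolding xs' s' Un_absorb by (rule inj')
        show "distinct (map (\<lambda>i. - x i) xs)" "distinct (map (\<lambda>i. - x i) s)"
          unfolding distinct_map xs'(1) s'(1) using xs' s' inj' by simp_all
      qed (fact that, fact sorted)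
      then have "sorted (map (\<lambda>i. - x i) xs) \<longleftrightarrow> xs = s" using sorted by blast
      then show "indicat_real (time_ordered t n) (?r xs) = (if xs = s then 1 else 0)"
        unfolding indicator_def iff[OF xs] by (simp only: of_bool_def)
    qed
    also have "\<dots> = 1" using s by (subst sum.delta) auto
    finally show ?thesis using True by simp
  qed
qed

context drive
begin

text \<open>
  The sum over all blue labelled graphs: each arc contributes a contraction with the later time on the
  left.
\<close>

definition dyson_kernel :: kernel where
  "dyson_kernel V E x =
     (\<Sum>i\<in>V. \<Sum>j\<in>V. W_contraction f (x i) (x j) * theta (x i - x j)) ^ card E"

lemma good_dyson_kernel: "good_kernel dyson_kernel"
  unfolding good_kernel_def
proof (intro conjI allI impI)
  fix V E :: "nat set"
  show "tame f V (dyson_kernel V E)"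
    unfolding dyson_kernel_def by (intro tame_intros)
next
  fix \<phi> \<psi> :: "nat \<Rightarrow> nat" and V V' E E' :: "nat set" and x
  assume \<phi>: "bij_betw \<phi> V V'" and \<psi>: "bij_betw \<psi> E E'"
  show "dyson_kernel V' E' x = dyson_kernel V E (x \<circ> \<phi>)"
    unfolding dyson_kernel_def
    by (simp add: sum.reindex_bij_betw[OF \<phi>, symmetric] bij_betw_same_card[OF \<psi>])
qed

lemma integral_time_ordered:
  fixes h :: "(nat \<Rightarrow> real) \<Rightarrow> complex"
  assumes n: "n \<ge> 1" and h: "tame f {1..n} h"
    and sym: "\<And>\<phi> x. bij_betw \<phi> {1..n} {1..n} \<Longrightarrow> h (x \<circ> \<phi>) = h x"
  shows "J {1..n} h = fact n * (LINT x:time_ordered t n|(\<Pi>\<^sub>M i\<in>{1..n}. lborel). h x)"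
proof -
  let ?V = "{1..n}" and ?M = "\<Pi>\<^sub>M i\<in>{1..n}. lborel :: real measure"
  let ?T = "time_ordered t n"
  let ?r = "\<lambda>xs x. \<lambda>i\<in>{1..n}. x (xs ! (i - 1))"
  let ?P = "permutations_of_set ?V"
  define F where "F x = indicat_real ?T x *\<^sub>R h x" for x
  have TC: "?T \<subseteq> cube ?V"
  proof
    fix x assume x: "x \<in> ?T"
    then have "x \<in> extensional ?V" by (auto simp: time_ordered_def PiE_def)
    then show "x \<in> cube ?V" using time_ordered_bounds[OF x] by (auto simp: cube_def PiE_def less_imp_le)
  qed
  have "set_integrable ?M ?T h"
    by (rule set_integrable_subset[OF tame_integrable[OF h]]) (use TC time_ordered_sets[OF n] in auto)
  then have F_int: "integrable ?M F" unfolding set_integrable_def F_def[abs_def] .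
  have bij: "bij_betw (\<lambda>i. xs ! (i - 1)) ?V ?V" if "xs \<in> ?P" for xs
  proof -
    have "length xs = n" "distinct xs" "set xs = ?V"
      using that length_finite_permutations_of_set[of xs ?V] by (auto simp: permutations_of_set_def)
    then have "bij_betw ((!) xs) {..<n} ?V" using bij_betw_nth[of xs "{..<n}" ?V] by auto
    moreover have "bij_betw (\<lambda>i. i - 1) ?V {..<n}"
      by (rule bij_betw_byWitness[where f' = Suc]) auto
    ultimately have "bij_betw ((!) xs \<circ> (\<lambda>i. i - 1)) ?V ?V" by (rule bij_betw_trans[rotated])
    then show ?thesis by (simp add: comp_def)
  qed
  have meas: "?r xs \<in> measurable ?M ?M" if "xs \<in> ?P" for xs
    using bij[OF that] by (intro measurable_restrict measurable_component_singleton) (auto dest: bij_betw_apply)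
  have comp: "integrable ?M (\<lambda>x. F (?r xs x)) \<and> (\<integral>x. F (?r xs x) \<partial>?M) = (\<integral>x. F x \<partial>?M)"
    if xs: "xs \<in> ?P" for xs
  proof -
    have d: "distr ?M ?M (?r xs) = ?M" by (rule PiM_lborel_reindex[OF bij[OF xs]]) simp
    have F_meas: "F \<in> borel_measurable ?M" using F_int by (rule borel_measurable_integrable)
    show ?thesis
      using integrable_distr[OF meas[OF xs], of F, unfolded d, OF F_int]
        integral_distr[OF meas[OF xs] F_meas, unfolded d, symmetric] by (rule conjI)
  qed
  have F_r: "F (?r xs x) = indicat_real ?T (?r xs x) *\<^sub>R h x" if "xs \<in> ?P" for xs x
  proof -
    have "h (?r xs x) = h (x \<circ> (\<lambda>i. xs ! (i - 1)))" by (rule tame_cong[OF h]) simp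
    then show ?thesis using sym[OF bij[OF that]] by (simp add: F_def)
  qed
  have "AE x in ?M. \<forall>i\<in>?V. x i \<noteq> 0 \<and> x i \<noteq> t"
  proof (rule AE_finite_allI)
    fix i assume i: "i \<in> ?V"
    have "AE x in ?M. x i \<noteq> c" for c :: real
      by (rule AE_PiM_lborel_neq[OF _ i, where k = "\<lambda>_. c"]) auto
    from this[of 0] this[of t] show "AE x in ?M. x i \<noteq> 0 \<and> x i \<noteq> t" by eventually_elim simp
  qed simp
  then have AE: "AE x in ?M. indicat_real (cube ?V) x *\<^sub>R h x = (\<Sum>xs\<in>?P. F (?r xs x))"
    using AE_PiM_lborel_inj[OF finite_atLeastAtMost, of 1 n] AE_space
  proof eventually_elim
    case (elim x)
    have "(\<Sum>xs\<in>?P. F (?r xs x)) = (\<Sum>xs\<in>?P. indicat_real ?T (?r xs x)) *\<^sub>R h x"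
      unfolding scaleR_sum_left by (intro sum.cong refl F_r)
    also have "(\<Sum>xs\<in>?P. indicat_real ?T (?r xs x)) = indicat_real (cube ?V) x"
      unfolding cube_def using elim by (intro sum_perm_time_ordered n) (auto simp: space_PiM PiE_def)
    finally have "(\<Sum>xs\<in>?P. F (?r xs x)) = indicat_real (cube ?V) x *\<^sub>R h x" .
    from this[symmetric] show ?case .
  qed
  have "J ?V h = (\<integral>x. (\<Sum>xs\<in>?P. F (?r xs x)) \<partial>?M)"
    unfolding J_def set_lebesgue_integral_def
  proof (rule integral_cong_AE[OF _ _ AE])
    show "(\<lambda>x. indicat_real (cube ?V) x *\<^sub>R h x) \<in> borel_measurable ?M"
      using tame_measurable[OF h] cube_sets[of ?V] by (intro borel_measurable_scaleR borel_measurable_indicator) auto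
    show "(\<lambda>x. \<Sum>xs\<in>?P. F (?r xs x)) \<in> borel_measurable ?M"
      using comp by (intro borel_measurable_sum borel_measurable_integrable) auto
  qed
  also have "\<dots> = (\<Sum>xs\<in>?P. \<integral>x. F (?r xs x) \<partial>?M)"
    using comp by (intro Bochner_Integration.integral_sum) auto
  also have "\<dots> = (\<Sum>xs\<in>?P. \<integral>x. F x \<partial>?M)"
    using comp by (intro sum.cong) auto
  also have "\<dots> = fact n * (\<integral>x. F x \<partial>?M)" by simp
  finally show ?thesis by (simp add: set_lebesgue_integral_def F_def)
qed

text \<open>
  On the time-ordered simplex the kernel is a power of the sum of the contractions of all ordered
  pairs.  It is symmetric in the times, so the simplex can be replaced by the cube at the cost of \<open>n!\<close>.
\<close>

theorem Dyson_eq_ser: "Dyson f t = ser dyson_kernel"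
proof (rule fps_ext)
  fix n
  show "Dyson f t $ n = ser dyson_kernel $ n"
  proof (cases "n = 0")
    case True
    have "dyson_kernel {} {..<m} = unit_kernel {} {..<m}" for m
      by (auto simp: dyson_kernel_def unit_kernel_def fun_eq_iff power_0_left lessThan_empty_iff)
    then have "ser dyson_kernel $ 0 = ser unit_kernel $ 0"
      by (simp add: fps_eq_iff ser_nth)
    then show ?thesis using True by (simp add: ser_unit_kernel Dyson_def)
  next
    case False
    then have n: "n \<ge> 1" by simp
    show ?thesis
    proof (rule fps_ext, rule symbol_eqI)
      fix m j k
      let ?V = "{1..n}" and ?M = "\<Pi>\<^sub>M i\<in>{1..n}. lborel :: real measure"
      let ?c = "\<lambda>x. (cfsum ?V x ^ j / fact j) * (fsum ?V x ^ k / fact k)"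
      let ?h = "\<lambda>x. dyson_kernel ?V {..<m} x * ?c x"
      have set: "set [1..<n + 1] = ?V" by auto
      have tm: "tame f ?V ?h"
        by (intro tame_Sym_coeff good_kernel_tame[OF good_dyson_kernel]) auto
      have sym: "?h (x \<circ> \<phi>) = ?h x" if \<phi>: "bij_betw \<phi> ?V ?V" for \<phi> x
        using good_kernel_relabel[OF good_dyson_kernel _ _ \<phi> bij_betw_id[of "{..<m}"], of x]
          sum.reindex_bij_betw[OF \<phi>, of "\<lambda>v. cnj (f (x v))"] sum.reindex_bij_betw[OF \<phi>, of "\<lambda>v. f (x v)"]
        by (simp add: cfsum_def fsum_def)
      have "Dyson f t $ n $ m $ j $ k =
          (LINT x:time_ordered t n|?M. foldr (\<star>) (map (\<lambda>i. fps_const (A_symbol f (x i))) [1..<n + 1]) 1 $ m $ j $ k)"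
        using n by (simp add: Dyson_def symbol_integral_def)
      also have "\<dots> = (LINT x:time_ordered t n|?M. 1 / fact m * ?h x)"
      proof (rule set_lebesgue_integral_cong)
        show "time_ordered t n \<in> sets ?M" by (rule time_ordered_sets[OF n])
        show "\<forall>x. x \<in> time_ordered t n \<longrightarrow>
          foldr (\<star>) (map (\<lambda>i. fps_const (A_symbol f (x i))) [1..<n + 1]) 1 $ m $ j $ k = 1 / fact m * ?h x"
        proof (intro allI impI)
          fix x assume x: "x \<in> time_ordered t n"
          have "sorted_wrt (\<lambda>i j. x j < x i) [1..<n + 1]"
            unfolding sorted_wrt_iff_nth_less using time_ordered_antimono[OF x]
            by (auto simp del: upt_Suc)
          then have "pair_sum f x [1..<n + 1] ^ m = dyson_kernel ?V {..<m} x"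
            unfolding dyson_kernel_def set[symmetric] by (subst pair_sum_sorted) auto
          then show "foldr (\<star>) (map (\<lambda>i. fps_const (A_symbol f (x i))) [1..<n + 1]) 1 $ m $ j $ k = 1 / fact m * ?h x"
            by (subst foldr_star_A)
               (simp_all only: set distinct_upt sconst_mult_nth prod_A_symbol exp_symbol_nth cfsum_def fsum_def, simp)
        qed
      qed
      also have "\<dots> = 1 / fact m * (LINT x:time_ordered t n|?M. ?h x)"
        by (rule set_integral_mult_right)
      also have "(LINT x:time_ordered t n|?M. ?h x) = 1 / fact n * J ?V ?h"
        using integral_time_ordered[OF n tm sym] by simp
      also have "J ?V ?h = Sym ?V (dyson_kernel ?V {..<m}) $ j $ k"
        by (simp only: Sym_nth)
      also have "Sym ?V (dyson_kernel ?V {..<m}) = Sym {..<n} (dyson_kernel {..<n} {..<m})"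
        using Sym_kernel_card[OF good_dyson_kernel, of ?V "{..<m}"] by simp
      finally show "Dyson f t $ n $ m $ j $ k = ser dyson_kernel $ n $ m $ j $ k"
        by (simp add: ser_nth mult_ac)
    qed
  qed
qed

end

section \<open>Counting labelled graphs\<close>

lemma is_rb_isomorphism_quiver_iso:
  "is_rb_isomorphism \<phi> \<psi> H K \<Longrightarrow> quiver_iso \<phi> \<psi> (fst H) (fst K)"
  by (simp add: is_rb_isomorphism_def quiver_iso_def)

lemma bij_betw_arcs_of_color:
  assumes "is_rb_isomorphism \<phi> \<psi> H K"
  shows "bij_betw \<psi> (arcs_of_color k H) (arcs_of_color k K)"
proof -
  have \<psi>: "bij_betw \<psi> (arcs (fst H)) (arcs (fst K))"
    and col: "\<And>e. e \<in> arcs (fst H) \<Longrightarrow> snd K (\<psi> e) = snd H e"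
    using assms by (auto simp: is_rb_isomorphism_def)
  have "\<psi> ` arcs_of_color k H = arcs_of_color k K"
    using bij_betw_imp_surj_on[OF \<psi>] col by (force simp: arcs_of_color_def)
  then show ?thesis
    by (intro bij_betw_subset[OF \<psi>]) (auto simp: arcs_of_color_def)
qed

lemma omega_RB_c_iso:
  assumes H: "fin_digraph (fst H)" and K: "fin_digraph (fst K)" and iso: "is_rb_isomorphism \<phi> \<psi> H K"
  shows "omega_RB_c H = omega_RB_c K"
proof -
  note q = is_rb_isomorphism_quiver_iso[OF iso]
  have col: "snd K (\<psi> e) = snd H e" if "e \<in> arcs (fst H)" for e
    using iso that by (simp add: is_rb_isomorphism_def)
  have "omega (\<lambda>e. case snd H e of Red \<Rightarrow> 1 | Blue \<Rightarrow> - 1) (fst H) =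
      omega (\<lambda>e. case snd K e of Red \<Rightarrow> 1 | Blue \<Rightarrow> - 1) (fst K)"
    by (rule omega_iso[OF H K q]) (simp add: col)
  moreover have "Digraph_Component.connected (fst H) \<longleftrightarrow> Digraph_Component.connected (fst K)"
    using connected_iso[OF H K q] connected_iso[OF K H quiver_iso_inv[OF q H]] by blast
  ultimately show ?thesis
    using bij_betw_same_card[OF bij_betw_arcs_of_color[OF iso]] by (simp add: omega_RB_c_def omega_c_def)
qed

text \<open>Labelled RB graphs with vertex set \<open>V\<close> and arc set \<open>E\<close>.\<close>

definition labelled_graphs :: "'v set \<Rightarrow> 'e set \<Rightarrow> ('e \<Rightarrow> 'v \<times> 'v \<times> color) set" where
  "labelled_graphs V E = (E \<rightarrow>\<^sub>E V \<times> V \<times> UNIV)"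

lemma UNIV_color: "UNIV = {Red, Blue}"
  by (rule UNIV_eq_I) (metis color.exhaust insertCI)

lemma finite_labelled_graphs: "finite V \<Longrightarrow> finite E \<Longrightarrow> finite (labelled_graphs V E)"
  unfolding labelled_graphs_def UNIV_color by (intro finite_PiE finite_cartesian_product) auto

lemma fin_digraph_rb: "finite V \<Longrightarrow> finite E \<Longrightarrow> g \<in> E \<rightarrow> V \<times> V \<times> UNIV \<Longrightarrow> fin_digraph (fst (rb V E g))"
  by (auto simp: fin_digraph_iff Pi_iff mem_Times_iff)

lemma labelled_graphs_Pi: "g \<in> labelled_graphs V E \<Longrightarrow> g \<in> E \<rightarrow> V \<times> V \<times> UNIV"
  by (auto simp: labelled_graphs_def PiE_def)

text \<open>Bijections, with default value outside \<open>A\<close> so that there are finitely many.\<close>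

definition bijections :: "'a set \<Rightarrow> 'b set \<Rightarrow> ('a \<Rightarrow> 'b) set" where
  "bijections A B = {\<phi> \<in> extensional A. bij_betw \<phi> A B}"

text \<open>Bijections between two sets are a torsor for the permutations of the first set.\<close>

lemma bij_betw_permutes_bijections:
  assumes \<phi>: "bij_betw \<phi> A B"
  shows "bij_betw (\<lambda>\<pi>. restrict (\<phi> \<circ> \<pi>) A) {\<pi>. \<pi> permutes A} (bijections A B)"
  unfolding bij_betw_def
proof (intro conjI inj_onI equalityI subsetI)
  have inj: "inj_on \<phi> A" using \<phi> by (rule bij_betw_imp_inj_on)
  fix \<pi> \<rho> assume pr: "\<pi> \<in> {\<pi>. \<pi> permutes A}" "\<rho> \<in> {\<pi>. \<pi> permutes A}"
    and eq: "restrict (\<phi> \<circ> \<pi>) A = restrict (\<phi> \<circ> \<rho>) A"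
  show "\<pi> = \<rho>"
  proof
    fix a
    show "\<pi> a = \<rho> a"
    proof (cases "a \<in> A")
      case True
      then have "\<phi> (\<pi> a) = \<phi> (\<rho> a)" using fun_cong[OF eq, of a] by simp
      then show ?thesis using inj pr True by (auto dest!: inj_onD simp: permutes_in_image)
    next
      case False
      then show ?thesis using pr by (simp add: permutes_not_in)
    qed
  qed
next
  fix \<chi> assume "\<chi> \<in> (\<lambda>\<pi>. restrict (\<phi> \<circ> \<pi>) A) ` {\<pi>. \<pi> permutes A}"
  then obtain \<pi> where \<pi>: "\<pi> permutes A" "\<chi> = restrict (\<phi> \<circ> \<pi>) A" by auto
  have "bij_betw (\<phi> \<circ> \<pi>) A B" by (rule bij_betw_trans[OF permutes_imp_bij[OF \<pi>(1)] \<phi>])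
  moreover have "bij_betw (\<phi> \<circ> \<pi>) A B \<longleftrightarrow> bij_betw \<chi> A B" by (rule bij_betw_cong) (simp add: \<pi>(2))
  ultimately have "bij_betw \<chi> A B" by blast
  then show "\<chi> \<in> bijections A B" by (simp add: bijections_def \<pi>(2))
next
  fix \<chi> assume "\<chi> \<in> bijections A B"
  then have \<chi>: "\<chi> \<in> extensional A" "bij_betw \<chi> A B" by (auto simp: bijections_def)
  define \<pi> where "\<pi> a = (if a \<in> A then inv_into A \<phi> (\<chi> a) else a)" for a
  have "bij_betw (inv_into A \<phi> \<circ> \<chi>) A A"
    by (rule bij_betw_trans[OF \<chi>(2) bij_betw_inv_into[OF \<phi>]])
  moreover have "bij_betw (inv_into A \<phi> \<circ> \<chi>) A A \<longleftrightarrow> bij_betw \<pi> A A"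
    by (rule bij_betw_cong) (simp add: \<pi>_def)
  ultimately have "bij_betw \<pi> A A" by blast
  then have "\<pi> permutes A" by (rule bij_imp_permutes) (simp add: \<pi>_def)
  moreover have "\<chi> = restrict (\<phi> \<circ> \<pi>) A"
  proof
    fix a show "\<chi> a = restrict (\<phi> \<circ> \<pi>) A a"
    proof (cases "a \<in> A")
      case True
      then have "\<chi> a \<in> \<phi> ` A" using \<chi>(2) \<phi> by (metis bij_betw_apply bij_betw_imp_surj_on)
      then show ?thesis using True by (simp add: \<pi>_def f_inv_into_f)
    qed (use \<chi>(1) in \<open>simp add: extensional_def\<close>)
  qed
  ultimately show "\<chi> \<in> (\<lambda>\<pi>. restrict (\<phi> \<circ> \<pi>) A) ` {\<pi>. \<pi> permutes A}" by blast
qed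

lemma card_bijections:
  assumes "finite A" "finite B" "card A = card B"
  shows "card (bijections A B) = fact (card A)" "finite (bijections A B)"
proof -
  obtain \<phi> where "bij_betw \<phi> A B" using finite_same_card_bij[OF assms] by blast
  note b = bij_betw_permutes_bijections[OF this]
  show "card (bijections A B) = fact (card A)"
    using bij_betw_same_card[OF b] card_permutations[OF refl assms(1)] by simp
  show "finite (bijections A B)"
    using bij_betw_finite[OF b] finite_permutations[OF assms(1)] by simp
qed

text \<open>Isomorphisms of RB graphs, with default values outside the vertices and arcs of \<open>H\<close>.\<close>

definition isomorphisms ::
  "('v, 'e) rb_graph \<Rightarrow> ('w, 'd) rb_graph \<Rightarrow> (('v \<Rightarrow> 'w) \<times> ('e \<Rightarrow> 'd)) set" where
  "isomorphisms H K = {(\<phi>, \<psi>). \<phi> \<in> bijections (verts (fst H)) (verts (fst K)) \<and>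
     \<psi> \<in> bijections (arcs (fst H)) (arcs (fst K)) \<and> is_rb_isomorphism \<phi> \<psi> H K}"

lemma is_rb_isomorphism_restrict:
  assumes "fin_digraph (fst H)"
  shows "is_rb_isomorphism (restrict \<phi> (verts (fst H))) (restrict \<psi> (arcs (fst H))) H K \<longleftrightarrow>
    is_rb_isomorphism \<phi> \<psi> H K"
  using assms bij_betw_cong[of "verts (fst H)" "restrict \<phi> (verts (fst H))" \<phi> "verts (fst K)"]
    bij_betw_cong[of "arcs (fst H)" "restrict \<psi> (arcs (fst H))" \<psi> "arcs (fst K)"]
  by (auto simp: is_rb_isomorphism_def fin_digraph_iff)

lemma isomorphisms_nonempty:
  assumes "fin_digraph (fst H)" "is_rb_isomorphism \<phi> \<psi> H K"
  shows "isomorphisms H K \<noteq> {}"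
proof -
  have "(restrict \<phi> (verts (fst H)), restrict \<psi> (arcs (fst H))) \<in> isomorphisms H K"
    using assms is_rb_isomorphism_restrict[OF assms(1), of \<phi> \<psi> K]
    by (auto simp: isomorphisms_def bijections_def is_rb_isomorphism_def)
  then show ?thesis by blast
qed

lemma is_rb_isomorphism_comp_iff:
  assumes H: "fin_digraph (fst H)" and iso: "is_rb_isomorphism \<phi> \<psi> H K"
    and \<pi>: "\<pi> permutes verts (fst H)" and \<rho>: "\<rho> permutes arcs (fst H)"
  shows "is_rb_isomorphism (\<phi> \<circ> \<pi>) (\<psi> \<circ> \<rho>) H K \<longleftrightarrow> is_rb_isomorphism \<pi> \<rho> H H"
proof -
  have \<phi>: "bij_betw \<phi> (verts (fst H)) (verts (fst K))" and \<psi>: "bij_betw \<psi> (arcs (fst H)) (arcs (fst K))"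
    and ends: "\<And>e. e \<in> arcs (fst H) \<Longrightarrow> tail (fst K) (\<psi> e) = \<phi> (tail (fst H) e) \<and>
        head (fst K) (\<psi> e) = \<phi> (head (fst H) e) \<and> snd K (\<psi> e) = snd H e"
    using iso by (auto simp: is_rb_isomorphism_def)
  have inj: "\<phi> u = \<phi> v \<longleftrightarrow> u = v" if "u \<in> verts (fst H)" "v \<in> verts (fst H)" for u v
    using bij_betw_imp_inj_on[OF \<phi>] that by (auto dest: inj_onD)
  have "bij_betw (\<phi> \<circ> \<pi>) (verts (fst H)) (verts (fst K))" "bij_betw (\<psi> \<circ> \<rho>) (arcs (fst H)) (arcs (fst K))"
    by (rule bij_betw_trans[OF permutes_imp_bij[OF \<pi>] \<phi>], rule bij_betw_trans[OF permutes_imp_bij[OF \<rho>] \<psi>])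
  moreover have "(tail (fst K) ((\<psi> \<circ> \<rho>) e) = (\<phi> \<circ> \<pi>) (tail (fst H) e) \<and>
       head (fst K) ((\<psi> \<circ> \<rho>) e) = (\<phi> \<circ> \<pi>) (head (fst H) e) \<and> snd K ((\<psi> \<circ> \<rho>) e) = snd H e) \<longleftrightarrow>
     (tail (fst H) (\<rho> e) = \<pi> (tail (fst H) e) \<and> head (fst H) (\<rho> e) = \<pi> (head (fst H) e) \<and> snd H (\<rho> e) = snd H e)"
    if e: "e \<in> arcs (fst H)" for e
  proof -
    have r: "\<rho> e \<in> arcs (fst H)" using \<rho> e by (simp add: permutes_in_image)
    have v: "tail (fst H) d \<in> verts (fst H)" "head (fst H) d \<in> verts (fst H)" if "d \<in> arcs (fst H)" for d
      using H that by (auto simp: fin_digraph_iff)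
    have p: "\<pi> u \<in> verts (fst H)" if "u \<in> verts (fst H)" for u using \<pi> that by (simp add: permutes_in_image)
    show ?thesis
      using ends[OF r] by (simp add: inj v[OF r] v[OF e] p)
  qed
  ultimately show ?thesis
    using permutes_imp_bij[OF \<pi>] permutes_imp_bij[OF \<rho>] by (simp add: is_rb_isomorphism_def)
qed

text \<open>Composition with a given isomorphism identifies automorphisms of \<open>H\<close> with isomorphisms.\<close>

lemma card_isomorphisms:
  assumes H: "fin_digraph (fst H)" and iso: "is_rb_isomorphism \<phi> \<psi> H K"
  shows "card (isomorphisms H K) = sigma_aut H"
proof -
  let ?V = "verts (fst H)" and ?E = "arcs (fst H)"
  let ?P = "{\<pi>. \<pi> permutes ?V} \<times> {\<rho>. \<rho> permutes ?E}"
  let ?F = "map_prod (\<lambda>\<pi>. restrict (\<phi> \<circ> \<pi>) ?V) (\<lambda>\<rho>. restrict (\<psi> \<circ> \<rho>) ?E)"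
  have \<phi>: "bij_betw \<phi> ?V (verts (fst K))" and \<psi>: "bij_betw \<psi> ?E (arcs (fst K))"
    using iso by (auto simp: is_rb_isomorphism_def)
  have b: "bij_betw ?F ?P (bijections ?V (verts (fst K)) \<times> bijections ?E (arcs (fst K)))"
    by (rule bij_betw_map_prod[OF bij_betw_permutes_bijections[OF \<phi>] bij_betw_permutes_bijections[OF \<psi>]])
  have iff: "is_rb_isomorphism (restrict (\<phi> \<circ> \<pi>) ?V) (restrict (\<psi> \<circ> \<rho>) ?E) H K \<longleftrightarrow> is_rb_isomorphism \<pi> \<rho> H H"
    if "\<pi> permutes ?V" "\<rho> permutes ?E" for \<pi> \<rho>
    unfolding is_rb_isomorphism_restrict[OF H] by (rule is_rb_isomorphism_comp_iff[OF H iso that])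
  have "bij_betw ?F {(\<pi>, \<rho>). \<pi> permutes ?V \<and> \<rho> permutes ?E \<and> is_rb_isomorphism \<pi> \<rho> H H} (isomorphisms H K)"
  proof (rule bij_betw_subset[OF b])
    show "?F ` {(\<pi>, \<rho>). \<pi> permutes ?V \<and> \<rho> permutes ?E \<and> is_rb_isomorphism \<pi> \<rho> H H} = isomorphisms H K"
    proof (intro equalityI subsetI)
      fix a assume "a \<in> ?F ` {(\<pi>, \<rho>). \<pi> permutes ?V \<and> \<rho> permutes ?E \<and> is_rb_isomorphism \<pi> \<rho> H H}"
      then obtain \<pi> \<rho> where pr: "\<pi> permutes ?V" "\<rho> permutes ?E" "is_rb_isomorphism \<pi> \<rho> H H" "a = ?F (\<pi>, \<rho>)" by auto
      then have "a \<in> bijections ?V (verts (fst K)) \<times> bijections ?E (arcs (fst K))"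
        using bij_betw_apply[OF b, of "(\<pi>, \<rho>)"] by simp
      then show "a \<in> isomorphisms H K" using pr iff[OF pr(1,2)] by (auto simp: isomorphisms_def)
    next
      fix a assume a: "a \<in> isomorphisms H K"
      then have "a \<in> ?F ` ?P" unfolding bij_betw_imp_surj_on[OF b] by (auto simp: isomorphisms_def)
      then obtain \<pi> \<rho> where pr: "\<pi> permutes ?V" "\<rho> permutes ?E" "a = ?F (\<pi>, \<rho>)" by auto
      then have "is_rb_isomorphism \<pi> \<rho> H H" using a iff[OF pr(1,2)] by (auto simp: isomorphisms_def)
      then show "a \<in> ?F ` {(\<pi>, \<rho>). \<pi> permutes ?V \<and> \<rho> permutes ?E \<and> is_rb_isomorphism \<pi> \<rho> H H}"
        using pr by blast
    qed
  qed auto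
  from bij_betw_same_card[OF this] show ?thesis by (simp add: sigma_aut_def)
qed

text \<open>
  The labelled copy of \<open>H\<close> for given bijections of its vertices and arcs with the label sets.
\<close>

definition relabel :: "('v \<Rightarrow> 'w) \<Rightarrow> ('e \<Rightarrow> 'd) \<Rightarrow> ('v, 'e) rb_graph \<Rightarrow> 'd set \<Rightarrow> 'd \<Rightarrow> 'w \<times> 'w \<times> color" where
  "relabel \<phi> \<psi> H E = (\<lambda>d\<in>E. let e = inv_into (arcs (fst H)) \<psi> d
     in (\<phi> (tail (fst H) e), \<phi> (head (fst H) e), snd H e))"

lemma relabel_iso:
  assumes H: "fin_digraph (fst H)" and \<phi>: "bij_betw \<phi> (verts (fst H)) V" and \<psi>: "bij_betw \<psi> (arcs (fst H)) E"
  shows "relabel \<phi> \<psi> H E \<in> labelled_graphs V E"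
    "is_rb_isomorphism \<phi> \<psi> H (rb V E (relabel \<phi> \<psi> H E))"
proof -
  have inv: "inv_into (arcs (fst H)) \<psi> d \<in> arcs (fst H)" if "d \<in> E" for d
    using \<psi> that by (metis bij_betw_imp_surj_on inv_into_into)
  show "relabel \<phi> \<psi> H E \<in> labelled_graphs V E"
    using H bij_betw_apply[OF \<phi>] inv
    by (auto simp: labelled_graphs_def relabel_def Let_def fin_digraph_iff)
  show "is_rb_isomorphism \<phi> \<psi> H (rb V E (relabel \<phi> \<psi> H E))"
    using \<phi> \<psi> bij_betw_apply[OF \<psi>] bij_betw_imp_inj_on[OF \<psi>]
    by (simp add: is_rb_isomorphism_def relabel_def Let_def inv_into_f_f)
qed

lemma relabel_unique:
  assumes iso: "is_rb_isomorphism \<phi> \<psi> H (rb V E g)" and g: "g \<in> labelled_graphs V E"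
  shows "g = relabel \<phi> \<psi> H E"
proof
  fix d
  have \<psi>: "bij_betw \<psi> (arcs (fst H)) E" using iso by (simp add: is_rb_isomorphism_def)
  show "g d = relabel \<phi> \<psi> H E d"
  proof (cases "d \<in> E")
    case True
    let ?e = "inv_into (arcs (fst H)) \<psi> d"
    have e: "?e \<in> arcs (fst H)" "\<psi> ?e = d"
      using True \<psi> by (metis bij_betw_imp_surj_on inv_into_into, metis True \<psi> bij_betw_imp_surj_on f_inv_into_f)
    then have "fst (g d) = \<phi> (tail (fst H) ?e) \<and> fst (snd (g d)) = \<phi> (head (fst H) ?e) \<and> snd (snd (g d)) = snd H ?e"
      using iso by (fastforce simp: is_rb_isomorphism_def)
    then show ?thesis using True by (simp add: relabel_def Let_def prod_eq_iff)
  next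
    case False
    then show ?thesis using g by (simp add: relabel_def labelled_graphs_def PiE_def extensional_def)
  qed
qed

text \<open>
  There are \<open>n! m! / \<sigma>(H)\<close> labelled graphs isomorphic to \<open>H\<close>.
\<close>

lemma card_labelled_copies:
  assumes H: "fin_digraph (fst H)" and V: "finite V" "card V = card (verts (fst H))"
    and E: "finite E" "card E = card (arcs (fst H))"
  shows "card {g \<in> labelled_graphs V E. isomorphisms H (rb V E g) \<noteq> {}} * sigma_aut H =
    fact (card V) * fact (card E)"
proof -
  let ?L = "{g \<in> labelled_graphs V E. isomorphisms H (rb V E g) \<noteq> {}}"
  let ?B = "bijections (verts (fst H)) V \<times> bijections (arcs (fst H)) E"
  have fin: "finite (verts (fst H))" "finite (arcs (fst H))" using H by (auto simp: fin_digraph_iff)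
  have finB: "finite ?B" and cardB: "card ?B = fact (card V) * fact (card E)"
    using card_bijections[OF fin(1) V(1)] card_bijections[OF fin(2) E(1)] V E
    by (auto simp: card_cartesian_product)
  have finL: "finite ?L" using finite_labelled_graphs[OF V(1) E(1)] by simp
  have sub: "isomorphisms H (rb V E g) \<subseteq> ?B" for g by (auto simp: isomorphisms_def)
  have UN: "?B = (\<Union>g\<in>?L. isomorphisms H (rb V E g))"
  proof (intro equalityI subsetI)
    fix a assume "a \<in> ?B"
    then obtain \<phi> \<psi> where a: "a = (\<phi>, \<psi>)" "\<phi> \<in> bijections (verts (fst H)) V" "\<psi> \<in> bijections (arcs (fst H)) E" by auto
    then have b: "bij_betw \<phi> (verts (fst H)) V" "bij_betw \<psi> (arcs (fst H)) E" by (auto simp: bijections_def)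
    have "a \<in> isomorphisms H (rb V E (relabel \<phi> \<psi> H E))"
      using a relabel_iso(2)[OF H b] by (simp add: isomorphisms_def)
    then show "a \<in> (\<Union>g\<in>?L. isomorphisms H (rb V E g))" using relabel_iso(1)[OF H b] by blast
  qed (use sub in blast)
  have "card ?B = (\<Sum>g\<in>?L. card (isomorphisms H (rb V E g)))"
    unfolding UN
  proof (rule card_UN_disjoint[OF finL])
    show "\<forall>g\<in>?L. finite (isomorphisms H (rb V E g))" using finite_subset[OF sub finB] by blast
    show "\<forall>g\<in>?L. \<forall>g'\<in>?L. g \<noteq> g' \<longrightarrow> isomorphisms H (rb V E g) \<inter> isomorphisms H (rb V E g') = {}"
    proof (intro ballI impI)
      fix g g' assume gg: "g \<in> ?L" "g' \<in> ?L" "g \<noteq> g'"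
      have False if "a \<in> isomorphisms H (rb V E g)" "a \<in> isomorphisms H (rb V E g')" for a
      proof -
        obtain \<phi> \<psi> where a: "a = (\<phi>, \<psi>)" by (cases a)
        then have "is_rb_isomorphism \<phi> \<psi> H (rb V E g)" "is_rb_isomorphism \<phi> \<psi> H (rb V E g')"
          using that by (simp_all add: isomorphisms_def)
        then have "g = relabel \<phi> \<psi> H E" "g' = relabel \<phi> \<psi> H E" using gg relabel_unique by blast+
        then show False using gg(3) by simp
      qed
      then show "isomorphisms H (rb V E g) \<inter> isomorphisms H (rb V E g') = {}" by blast
    qed
  qed
  also have "\<dots> = (\<Sum>g\<in>?L. sigma_aut H)"
  proof (rule sum.cong[OF refl])
    fix g assume "g \<in> ?L"
    then obtain a where "a \<in> isomorphisms H (rb V E g)" by blast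
    then have "is_rb_isomorphism (fst a) (snd a) H (rb V E g)" by (cases a) (simp add: isomorphisms_def)
    then show "card (isomorphisms H (rb V E g)) = sigma_aut H" by (rule card_isomorphisms[OF H])
  qed
  finally show ?thesis using cardB by simp
qed

lemma is_rb_isomorphism_trans:
  assumes "is_rb_isomorphism \<phi> \<psi> H K" "is_rb_isomorphism \<phi>' \<psi>' K L"
  shows "is_rb_isomorphism (\<phi>' \<circ> \<phi>) (\<psi>' \<circ> \<psi>) H L"
  using assms bij_betw_trans[of \<phi> "verts (fst H)" "verts (fst K)" \<phi>' "verts (fst L)"]
    bij_betw_trans[of \<psi> "arcs (fst H)" "arcs (fst K)" \<psi>' "arcs (fst L)"]
  by (auto simp: is_rb_isomorphism_def bij_betw_apply)

lemma is_rb_isomorphism_inv: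
  assumes "fin_digraph (fst H)" "is_rb_isomorphism \<phi> \<psi> H K"
  shows "is_rb_isomorphism (inv_into (verts (fst H)) \<phi>) (inv_into (arcs (fst H)) \<psi>) K H"
proof -
  note q = quiver_iso_inv[OF is_rb_isomorphism_quiver_iso[OF assms(2)] assms(1)]
  have "snd H (inv_into (arcs (fst H)) \<psi> e) = snd K e" if "e \<in> arcs (fst K)" for e
  proof -
    have "e \<in> \<psi> ` arcs (fst H)" using that assms(2) by (auto simp: is_rb_isomorphism_def bij_betw_def)
    then show ?thesis using assms(2) by (metis f_inv_into_f inv_into_into is_rb_isomorphism_def)
  qed
  then show ?thesis using q by (simp add: is_rb_isomorphism_def quiver_iso_def)
qed

lemma equiv_rb_iso: "equiv {H. fin_digraph (fst H)} rb_iso"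
proof (rule equivI)
  show "rb_iso \<subseteq> {H. fin_digraph (fst H)} \<times> {H. fin_digraph (fst H)}" by (auto simp: rb_iso_def)
  have "(H, H) \<in> rb_iso" if "fin_digraph (fst H)" for H :: "('a, 'b) rb_graph"
  proof -
    have "is_rb_isomorphism id id H H" by (simp add: is_rb_isomorphism_def)
    then have "\<exists>\<phi> \<psi>. is_rb_isomorphism \<phi> \<psi> H H" by blast
    then show ?thesis using that by (simp add: rb_iso_def)
  qed
  then show "refl_on {H :: ('a, 'b) rb_graph. fin_digraph (fst H)} rb_iso"
    by (simp add: refl_on_def)
  show "sym rb_iso" using is_rb_isomorphism_inv by (fastforce simp: sym_def rb_iso_def)
  show "trans rb_iso" using is_rb_isomorphism_trans by (fastforce simp: trans_def rb_iso_def)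
qed

lemma acyclic_iso:
  assumes H: "fin_digraph (fst H)" and iso: "is_rb_isomorphism \<phi> \<psi> H K"
    and K: "acyclic (arcs_ends (fst K))"
  shows "acyclic (arcs_ends (fst H))"
proof -
  have arc: "(\<phi> u, \<phi> v) \<in> arcs_ends (fst K)" if "(u, v) \<in> arcs_ends (fst H)" for u v
  proof -
    from that obtain e where e: "e \<in> arcs (fst H)" "u = tail (fst H) e" "v = head (fst H) e"
      by (auto simp: arcs_ends_def arc_to_ends_def)
    then have "\<psi> e \<in> arcs (fst K)" "tail (fst K) (\<psi> e) = \<phi> u" "head (fst K) (\<psi> e) = \<phi> v"
      using iso by (auto simp: is_rb_isomorphism_def bij_betw_apply)
    then show ?thesis by (force simp: arcs_ends_def arc_to_ends_def)
  qed
  have "(\<phi> u, \<phi> v) \<in> (arcs_ends (fst K))\<^sup>+" if "(u, v) \<in> (arcs_ends (fst H))\<^sup>+" for u v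
    using that by induction (auto dest: arc intro: trancl_into_trancl)
  then show ?thesis using K unfolding acyclic_def by blast
qed

lemma sum_rb_classes:
  fixes F :: "(nat, nat) rb_graph \<Rightarrow> complex"
  assumes inv: "\<And>H K. (H, K) \<in> rb_iso \<Longrightarrow> F H = F K"
    and zero: "\<And>H. fin_digraph (fst H) \<Longrightarrow>
      \<not> (Digraph_Component.connected (fst H) \<and> acyclic (arcs_ends (fst H))) \<Longrightarrow> F H = 0"
  shows "(\<Sum>C\<in>rb_classes n m. F (SOME H. H \<in> C) / of_nat (sigma_aut (SOME H. H \<in> C))) =
    (\<Sum>g\<in>labelled_graphs {..<n} {..<m}. F (rb {..<n} {..<m} g)) / (fact n * fact m)"
proof -
  let ?V = "{..<n}" and ?E = "{..<m}"
  let ?X = "{H :: (nat, nat) rb_graph. fin_digraph (fst H) \<and> Digraph_Component.connected (fst H) \<and>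
         acyclic (arcs_ends (fst H)) \<and> card (verts (fst H)) = n \<and> card (arcs (fst H)) = m}"
  let ?G = "{g \<in> labelled_graphs ?V ?E. rb ?V ?E g \<in> ?X}"
  let ?q = "\<lambda>g. rb_iso `` {rb ?V ?E g}"
  have fin_rb: "fin_digraph (fst (rb ?V ?E g))" if "g \<in> labelled_graphs ?V ?E" for g
    using that by (intro fin_digraph_rb labelled_graphs_Pi) auto
  have X_iso: "K \<in> ?X" if "H \<in> ?X" "(H, K) \<in> rb_iso" for H K
  proof -
    from that obtain \<phi> \<psi> where iso: "is_rb_isomorphism \<phi> \<psi> H K" and HK: "fin_digraph (fst H)" "fin_digraph (fst K)"
      by (auto simp: rb_iso_def)
    have "Digraph_Component.connected (fst K)"
      using that(1) by (intro connected_iso[OF HK is_rb_isomorphism_quiver_iso[OF iso]]) simp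
    moreover have "acyclic (arcs_ends (fst K))"
      using that(1) by (intro acyclic_iso[OF HK(2) is_rb_isomorphism_inv[OF HK(1) iso]]) simp
    moreover have "card (verts (fst K)) = card (verts (fst H))" "card (arcs (fst K)) = card (arcs (fst H))"
      using iso bij_betw_same_card unfolding is_rb_isomorphism_def by metis+
    ultimately show ?thesis using that HK by simp
  qed
  have finG: "finite ?G" using finite_labelled_graphs[of ?V ?E] by simp
  have classes: "rb_classes n m = ?q ` ?G"
  proof (intro equalityI subsetI)
    fix C assume "C \<in> rb_classes n m"
    then obtain H where H: "H \<in> ?X" "C = rb_iso `` {H}" by (auto simp: rb_classes_def quotient_def)
    then have fH: "fin_digraph (fst H)" "finite (verts (fst H))" "finite (arcs (fst H))" by (auto simp: fin_digraph_iff)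
    obtain \<phi> where \<phi>: "bij_betw \<phi> (verts (fst H)) ?V" using finite_same_card_bij[OF fH(2), of ?V] H by auto
    obtain \<psi> where \<psi>: "bij_betw \<psi> (arcs (fst H)) ?E" using finite_same_card_bij[OF fH(3), of ?E] H by auto
    let ?g = "relabel \<phi> \<psi> H ?E"
    note r = relabel_iso[OF fH(1) \<phi> \<psi>]
    have HK: "(H, rb ?V ?E ?g) \<in> rb_iso" using r fH fin_rb[OF r(1)] by (auto simp: rb_iso_def)
    have "?g \<in> ?G" using r(1) X_iso[OF H(1) HK] by simp
    moreover have "C = ?q ?g" using equiv_class_eq[OF equiv_rb_iso HK] H by simp
    ultimately show "C \<in> ?q ` ?G" by blast
  next
    fix C assume "C \<in> ?q ` ?G"
    then obtain g where "rb ?V ?E g \<in> ?X" "C = rb_iso `` {rb ?V ?E g}" by blast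
    then show "C \<in> rb_classes n m" unfolding rb_classes_def by (auto intro: quotientI)
  qed
  have "(\<Sum>g\<in>labelled_graphs ?V ?E. F (rb ?V ?E g)) = (\<Sum>g\<in>?G. F (rb ?V ?E g))"
    by (rule sum.mono_neutral_right) (use finite_labelled_graphs[of ?V ?E] zero fin_rb in auto)
  also have "\<dots> = (\<Sum>C\<in>rb_classes n m. \<Sum>g\<in>{g \<in> ?G. ?q g = C}. F (rb ?V ?E g))"
    unfolding classes by (rule sum.image_gen[OF finG])
  also have "\<dots> = (\<Sum>C\<in>rb_classes n m. fact n * fact m * (F (SOME H. H \<in> C) / of_nat (sigma_aut (SOME H. H \<in> C))))"
  proof (rule sum.cong[OF refl])
    fix C assume "C \<in> rb_classes n m"
    then obtain H0 where H0: "H0 \<in> ?X" "C = rb_iso `` {H0}" by (auto simp: rb_classes_def quotient_def)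
    define H where "H = (SOME H. H \<in> C)"
    have "H0 \<in> C" using H0 equiv_class_self[OF equiv_rb_iso, of H0] by simp
    then have "H \<in> C" unfolding H_def by (rule someI)
    then have H0H: "(H0, H) \<in> rb_iso" using H0 by simp
    have HX: "H \<in> ?X" by (rule X_iso[OF H0(1) H0H])
    have C: "C = rb_iso `` {H}" unfolding H0(2) by (rule equiv_class_eq[OF equiv_rb_iso H0H])
    have fH: "fin_digraph (fst H)" using HX by simp
    have q_iff: "rb_iso `` {rb ?V ?E g} = C \<longleftrightarrow> (H, rb ?V ?E g) \<in> rb_iso" if "g \<in> labelled_graphs ?V ?E" for g
    proof -
      have "rb_iso `` {H} = rb_iso `` {rb ?V ?E g} \<longleftrightarrow> (H, rb ?V ?E g) \<in> rb_iso"
        by (rule eq_equiv_class_iff[OF equiv_rb_iso]) (simp_all add: fH fin_rb[OF that] del: rb_simps)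
      then show ?thesis unfolding C by (subst eq_commute)
    qed
    have set: "{g \<in> ?G. ?q g = C} = {g \<in> labelled_graphs ?V ?E. isomorphisms H (rb ?V ?E g) \<noteq> {}}" (is "?L = ?R")
    proof (intro equalityI subsetI)
      fix g assume "g \<in> ?L"
      then have "g \<in> labelled_graphs ?V ?E" "(H, rb ?V ?E g) \<in> rb_iso" using q_iff by auto
      moreover from this obtain \<phi> \<psi> where "is_rb_isomorphism \<phi> \<psi> H (rb ?V ?E g)" by (auto simp: rb_iso_def)
      ultimately show "g \<in> ?R" using isomorphisms_nonempty[OF fH] by blast
    next
      fix g assume g: "g \<in> ?R"
      then have "(H, rb ?V ?E g) \<in> rb_iso"
        using fH fin_rb by (auto simp: rb_iso_def isomorphisms_def)
      then show "g \<in> ?L" using g q_iff X_iso[OF HX] by auto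
    qed
    have cop: "card ?R * sigma_aut H = fact n * fact m"
      using card_labelled_copies[OF fH, of ?V ?E] HX by simp
    then have s: "sigma_aut H \<noteq> 0" by (metis fact_nonzero mult_eq_0_iff mult_0_right)
    have "(\<Sum>g\<in>?L. F (rb ?V ?E g)) = (\<Sum>g\<in>?L. F H)"
    proof (rule sum.cong[OF refl])
      fix g assume "g \<in> ?L"
      then have "g \<in> labelled_graphs ?V ?E" "rb_iso `` {rb ?V ?E g} = C" by blast+
      then have "(H, rb ?V ?E g) \<in> rb_iso" by (simp only: q_iff)
      then show "F (rb ?V ?E g) = F H" by (rule inv[symmetric])
    qed
    also have "\<dots> = of_nat (card ?R) * F H" unfolding set by simp
    also have "of_nat (card ?R) = (fact n * fact m / of_nat (sigma_aut H) :: complex)"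
      using s arg_cong[OF cop, of "of_nat :: nat \<Rightarrow> complex"] by (simp add: field_simps)
    finally show "(\<Sum>g\<in>?L. F (rb ?V ?E g)) =
        fact n * fact m * (F (SOME H. H \<in> C) / of_nat (sigma_aut (SOME H. H \<in> C)))"
      by (simp add: H_def)
  qed
  finally have "(\<Sum>g\<in>labelled_graphs ?V ?E. F (rb ?V ?E g)) = fact n * fact m *
      (\<Sum>C\<in>rb_classes n m. F (SOME H. H \<in> C) / of_nat (sigma_aut (SOME H. H \<in> C)))"
    by (simp only: sum_distrib_left)
  then show ?thesis by (simp del: times_divide_eq_right)
qed

section \<open>The colored integrals\<close>

text \<open>The factor of an arc from \<open>j\<close> to \<open>i\<close> with color \<open>k\<close> in the integrand of a graph.\<close>

definition arc_integrand :: "(real \<Rightarrow> complex) \<Rightarrow> ('v \<Rightarrow> real) \<Rightarrow> 'v \<times> 'v \<times> color \<Rightarrow> complex" where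
  "arc_integrand f x a = (case a of (j, i, k) \<Rightarrow>
     (case k of Blue \<Rightarrow> W_contraction f (x i) (x j) | Red \<Rightarrow> W_contraction f (x j) (x i)) * theta (x i - x j))"

lemma tame_arc_integrand: "a \<in> V \<times> V \<times> UNIV \<Longrightarrow> tame f V (\<lambda>x. arc_integrand f x a)"
  by (cases a; cases "snd (snd a)")
     (auto simp: arc_integrand_def intro!: tame_mult tame_theta tame_W)

text \<open>
  A nonzero integrand forces times to increase along arcs.  Graphs with directed cycles therefore have
  zero integral and may be included in all sums.
\<close>

lemma prod_arc_integrand_acyclic:
  assumes fin: "fin_digraph G" and nz: "(\<Prod>e\<in>arcs G. arc_integrand f x (tail G e, head G e, k e)) \<noteq> 0"
  shows "acyclic (arcs_ends G)"
proof -
  have step: "x u < x v" if "(u, v) \<in> arcs_ends G" for u v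
  proof -
    from that obtain e where "e \<in> arcs G" "u = tail G e" "v = head G e"
      by (auto simp: arcs_ends_def arc_to_ends_def)
    moreover from this have "arc_integrand f x (tail G e, head G e, k e) \<noteq> 0"
      using nz fin by (auto simp: fin_digraph_iff)
    ultimately show ?thesis by (auto simp: arc_integrand_def theta_def split: if_splits)
  qed
  have "x u < x v" if "(u, v) \<in> (arcs_ends G)\<^sup>+" for u v
    using that by induction (use step in \<open>auto intro: less_trans\<close>)
  then show ?thesis by (fastforce simp: acyclic_def)
qed

text \<open>Coefficients of the labelled graphs with given vertices, arcs, and ends and colors of the arcs.\<close>

type_synonym graph_coeff = "nat set \<Rightarrow> nat set \<Rightarrow> (nat \<Rightarrow> nat \<times> nat \<times> color) \<Rightarrow> complex"

text \<open>The coefficients of the connected RB graphs in the claimed expansion of the Magnusian.\<close>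

definition rb_coeff :: graph_coeff where
  "rb_coeff V E g = of_real (omega_RB_c (rb V E g))"

context drive
begin

lemma I_color_eq_Sym:
  assumes H: "fin_digraph (fst H)"
  shows "I_color f t H = Sym (verts (fst H))
    (\<lambda>x. \<Prod>e\<in>arcs (fst H). arc_integrand f x (tail (fst H) e, head (fst H) e, snd H e))"
proof -
  have fin: "finite (arcs (fst H))" using H by (simp add: fin_digraph_iff)
  let ?B = "arcs_of_color Blue H" and ?R = "arcs_of_color Red H"
  let ?w = "\<lambda>x e. arc_integrand f x (tail (fst H) e, head (fst H) e, snd H e)"
  have part: "arcs (fst H) = ?B \<union> ?R" "?B \<inter> ?R = {}"
  proof -
    have "snd H e = Blue \<or> snd H e = Red" for e by (cases "snd H e") auto
    then show "arcs (fst H) = ?B \<union> ?R" "?B \<inter> ?R = {}" by (auto simp: arcs_of_color_def)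
  qed
  have finBR: "finite ?B" "finite ?R" using fin by (auto simp: arcs_of_color_def)
  have w: "(\<Prod>e\<in>arcs (fst H). ?w x e) =
     (\<Prod>e\<in>?B. W_contraction f (x (head (fst H) e)) (x (tail (fst H) e)) * theta (x (head (fst H) e) - x (tail (fst H) e))) *
     (\<Prod>e\<in>?R. W_contraction f (x (tail (fst H) e)) (x (head (fst H) e)) * theta (x (head (fst H) e) - x (tail (fst H) e)))" for x
    unfolding part(1) prod.union_disjoint[OF finBR part(2)]
    by (rule arg_cong2[where f = "(*)"]; rule prod.cong[OF refl]; simp add: arcs_of_color_def arc_integrand_def)
  show ?thesis
    unfolding I_color_def Let_def Sym_def cube_def w sconst_mult ..
qed

lemma tame_graph_integrand:
  assumes "fin_digraph (fst H)"
  shows "tame f (verts (fst H)) (\<lambda>x. \<Prod>e\<in>arcs (fst H). arc_integrand f x (tail (fst H) e, head (fst H) e, snd H e))"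
  using assms by (intro tame_prod tame_arc_integrand) (auto simp: fin_digraph_iff)

lemma I_color_iso:
  assumes H: "fin_digraph (fst H)" and K: "fin_digraph (fst K)" and iso: "is_rb_isomorphism \<phi> \<psi> H K"
  shows "I_color f t H = I_color f t K"
proof -
  have \<phi>: "bij_betw \<phi> (verts (fst H)) (verts (fst K))" and \<psi>: "bij_betw \<psi> (arcs (fst H)) (arcs (fst K))"
    and ends: "\<And>e. e \<in> arcs (fst H) \<Longrightarrow> tail (fst K) (\<psi> e) = \<phi> (tail (fst H) e) \<and>
        head (fst K) (\<psi> e) = \<phi> (head (fst H) e) \<and> snd K (\<psi> e) = snd H e"
    using iso by (auto simp: is_rb_isomorphism_def)
  have "(\<Prod>e\<in>arcs (fst K). arc_integrand f x (tail (fst K) e, head (fst K) e, snd K e)) =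
      (\<Prod>e\<in>arcs (fst H). arc_integrand f (x \<circ> \<phi>) (tail (fst H) e, head (fst H) e, snd H e))" for x
    unfolding prod.reindex_bij_betw[OF \<psi>, symmetric]
    by (intro prod.cong refl) (simp add: ends arc_integrand_def split: color.split)
  then show ?thesis
    unfolding I_color_eq_Sym[OF H] I_color_eq_Sym[OF K]
    using Sym_reindex[OF \<phi> _ tame_graph_integrand[OF H]] H by (simp add: fin_digraph_iff)
qed

text \<open>The kernel that sums the integrands of all labelled graphs with coefficients \<open>c\<close>.\<close>

definition graph_kernel :: "graph_coeff \<Rightarrow> kernel" where
  "graph_kernel c V E x = (\<Sum>g\<in>labelled_graphs V E. c V E g * (\<Prod>e\<in>E. arc_integrand f x (g e)))"

lemma tame_graph_kernel:
  assumes "finite V" "finite E"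
  shows "tame f V (graph_kernel c V E)"
  unfolding graph_kernel_def
  by (intro tame_sum tame_mult tame_const tame_prod tame_arc_integrand)
     (auto simp: labelled_graphs_def PiE_def Pi_def mem_Times_iff)

lemma good_rb_kernel: "good_kernel (graph_kernel rb_coeff)"
  unfolding good_kernel_def
proof (intro conjI allI impI)
  fix V E :: "nat set" assume "finite V" "finite E"
  then show "tame f V (graph_kernel rb_coeff V E)" by (rule tame_graph_kernel)
next
  fix \<phi> \<psi> :: "nat \<Rightarrow> nat" and V V' E E' :: "nat set" and x
  assume fin: "finite V" "finite E" and \<phi>: "bij_betw \<phi> V V'" and \<psi>: "bij_betw \<psi> E E'"
  have fin': "finite V'" "finite E'" using fin \<phi> \<psi> bij_betw_finite by auto
  let ?i = "inv_into V \<phi>" and ?j = "inv_into E \<psi>"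
  have \<phi>': "bij_betw ?i V' V" and \<psi>': "bij_betw ?j E' E" using \<phi> \<psi> by (auto intro: bij_betw_inv_into)
  have inv: "\<And>v. v \<in> V \<Longrightarrow> ?i (\<phi> v) = v" "\<And>v. v \<in> V' \<Longrightarrow> \<phi> (?i v) = v"
    "\<And>e. e \<in> E \<Longrightarrow> ?j (\<psi> e) = e" "\<And>e. e \<in> E' \<Longrightarrow> \<psi> (?j e) = e"
    using \<phi> \<psi> by (simp_all add: bij_betw_inv_into_left bij_betw_inv_into_right)
  let ?act = "\<lambda>\<phi> a. (\<phi> (fst a), \<phi> (fst (snd a)), snd (snd a))"
  have gE: "fst (g e) \<in> V" "fst (snd (g e)) \<in> V" if "g \<in> labelled_graphs V E" "e \<in> E" for g e V and E :: "nat set"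
    using that PiE_mem[of g E "\<lambda>_. V \<times> V \<times> UNIV" e] by (auto simp: labelled_graphs_def mem_Times_iff)
  show "graph_kernel rb_coeff V' E' x = graph_kernel rb_coeff V E (x \<circ> \<phi>)"
    unfolding graph_kernel_def
  proof (rule sum.reindex_bij_witness[of _ "\<lambda>g. \<lambda>d\<in>E'. ?act \<phi> (g (?j d))" "\<lambda>g. \<lambda>e\<in>E. ?act ?i (g (\<psi> e))"])
    fix g assume g: "g \<in> labelled_graphs V' E'"
    let ?g = "\<lambda>e\<in>E. ?act ?i (g (\<psi> e))"
    have \<psi>E: "\<psi> e \<in> E'" if "e \<in> E" for e using that \<psi> by (rule bij_betw_apply[rotated])
    show g': "?g \<in> labelled_graphs V E"
      using gE[OF g \<psi>E] \<phi>' by (auto simp: labelled_graphs_def bij_betw_apply)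
    show "(\<lambda>d\<in>E'. ?act \<phi> (?g (?j d))) = g"
    proof
      fix d show "(\<lambda>d\<in>E'. ?act \<phi> (?g (?j d))) d = g d"
        using gE[OF g, of d] g bij_betw_apply[OF \<psi>', of d]
        by (cases "d \<in> E'") (auto simp: inv labelled_graphs_def PiE_def extensional_def)
    qed
    have iso: "is_rb_isomorphism \<phi> \<psi> (rb V E ?g) (rb V' E' g)"
      using \<phi> \<psi> gE[OF g \<psi>E] by (auto simp: is_rb_isomorphism_def inv)
    have "omega_RB_c (rb V E ?g) = omega_RB_c (rb V' E' g)"
      by (rule omega_RB_c_iso[OF _ _ iso]) (intro fin_digraph_rb fin fin' labelled_graphs_Pi g g')+
    moreover have "(\<Prod>e\<in>E'. arc_integrand f x (g e)) = (\<Prod>e\<in>E. arc_integrand f (x \<circ> \<phi>) (?g e))"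
      unfolding prod.reindex_bij_betw[OF \<psi>, symmetric]
    proof (rule prod.cong[OF refl])
      fix e assume e: "e \<in> E"
      then show "arc_integrand f x (g (\<psi> e)) = arc_integrand f (x \<circ> \<phi>) (?g e)"
        using gE[OF g \<psi>E[OF e]] by (simp add: arc_integrand_def inv case_prod_unfold split: color.split)
    qed
    ultimately show "rb_coeff V E ?g * (\<Prod>e\<in>E. arc_integrand f (x \<circ> \<phi>) (?g e)) =
        rb_coeff V' E' g * (\<Prod>e\<in>E'. arc_integrand f x (g e))"
      by (simp add: rb_coeff_def)
  next
    fix g assume g: "g \<in> labelled_graphs V E"
    let ?g = "\<lambda>d\<in>E'. ?act \<phi> (g (?j d))"
    have jE: "?j d \<in> E" if "d \<in> E'" for d using that \<psi>' by (rule bij_betw_apply[rotated])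
    show "?g \<in> labelled_graphs V' E'"
      using gE[OF g jE] \<phi> by (auto simp: labelled_graphs_def bij_betw_apply)
    show "(\<lambda>e\<in>E. ?act ?i (?g (\<psi> e))) = g"
    proof
      fix e show "(\<lambda>e\<in>E. ?act ?i (?g (\<psi> e))) e = g e"
        using gE[OF g, of e] g bij_betw_apply[OF \<psi>, of e]
        by (cases "e \<in> E") (auto simp: inv labelled_graphs_def PiE_def extensional_def)
    qed
  qed
qed

theorem Omega_RB_eq_ser: "Omega_RB f t = ser (graph_kernel rb_coeff)"
proof (rule fps_ext, rule fps_ext, rule symbol_eqI)
  fix n m j k :: nat
  let ?V = "{..<n}" and ?E = "{..<m}"
  let ?F = "\<lambda>H. complex_of_real (omega_RB_c H) * I_color f t H $ j $ k"
  have "Omega_RB f t $ n $ m $ j $ k =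
      (\<Sum>C\<in>rb_classes n m. ?F (SOME H. H \<in> C) / of_nat (sigma_aut (SOME H. H \<in> C)))"
    by (simp add: Omega_RB_def Let_def fps_sum_nth)
  also have "\<dots> = (\<Sum>g\<in>labelled_graphs ?V ?E. ?F (rb ?V ?E g)) / (fact n * fact m)"
  proof (rule sum_rb_classes)
    fix H K :: "(nat, nat) rb_graph" assume "(H, K) \<in> rb_iso"
    then obtain \<phi> \<psi> where "fin_digraph (fst H)" "fin_digraph (fst K)" "is_rb_isomorphism \<phi> \<psi> H K"
      by (auto simp: rb_iso_def)
    then have "omega_RB_c H = omega_RB_c K" "I_color f t H = I_color f t K"
      using omega_RB_c_iso[of H K \<phi> \<psi>] I_color_iso[of H K \<phi> \<psi>] by simp_all
    then show "?F H = ?F K" by (simp only:)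
  next
    fix H :: "(nat, nat) rb_graph"
    assume H: "fin_digraph (fst H)" "\<not> (Digraph_Component.connected (fst H) \<and> acyclic (arcs_ends (fst H)))"
    show "?F H = 0"
    proof (cases "Digraph_Component.connected (fst H)")
      case True
      then have "(\<Prod>e\<in>arcs (fst H). arc_integrand f x (tail (fst H) e, head (fst H) e, snd H e)) = 0" for x
        using prod_arc_integrand_acyclic[OF H(1)] H(2) by blast
      then have "I_color f t H $ j $ k = 0"
        unfolding I_color_eq_Sym[OF H(1)] by (simp add: Sym_nth J_def set_lebesgue_integral_def)
      then show ?thesis by simp
    next
      case False
      then show ?thesis by (simp add: omega_RB_c_def omega_c_def)
    qed
  qed
  also have "(\<Sum>g\<in>labelled_graphs ?V ?E. ?F (rb ?V ?E g)) =
      (\<Sum>g\<in>labelled_graphs ?V ?E. Sym ?V (\<lambda>x. rb_coeff ?V ?E g * (\<Prod>e\<in>?E. arc_integrand f x (g e))) $ j $ k)"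
  proof (rule sum.cong[OF refl])
    fix g assume "g \<in> labelled_graphs ?V ?E"
    then have "fin_digraph (fst (rb ?V ?E g))" by (intro fin_digraph_rb labelled_graphs_Pi) auto
    then show "?F (rb ?V ?E g) = Sym ?V (\<lambda>x. rb_coeff ?V ?E g * (\<Prod>e\<in>?E. arc_integrand f x (g e))) $ j $ k"
      by (simp add: I_color_eq_Sym Sym_scale rb_coeff_def)
  qed
  also have "\<dots> = Sym ?V (graph_kernel rb_coeff ?V ?E) $ j $ k"
  proof -
    have "Sym ?V (graph_kernel rb_coeff ?V ?E) =
        (\<Sum>g\<in>labelled_graphs ?V ?E. Sym ?V (\<lambda>x. rb_coeff ?V ?E g * (\<Prod>e\<in>?E. arc_integrand f x (g e))))"
      unfolding graph_kernel_def[abs_def]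
      by (intro Sym_sum tame_mult tame_const tame_prod tame_arc_integrand)
         (auto simp: labelled_graphs_def PiE_def Pi_def mem_Times_iff)
    then show ?thesis by (simp add: fps_sum_nth)
  qed
  finally show "Omega_RB f t $ n $ m $ j $ k = ser (graph_kernel rb_coeff) $ n $ m $ j $ k"
    by (simp add: ser_nth)
qed

end

section \<open>Star powers of the graph kernel\<close>

text \<open>
  A function into a disjoint union amounts to a splitting of the domain and a function on each part.
\<close>

lemma sum_PiE_split:
  fixes F G :: "'e set \<Rightarrow> ('e \<Rightarrow> 'a) \<Rightarrow> complex"
  assumes fin: "finite E" "finite A" "finite B" and disj: "A \<inter> B = {}"
    and F: "\<And>E' g g'. E' \<subseteq> E \<Longrightarrow> g \<in> E' \<rightarrow> A \<Longrightarrow> (\<And>e. e \<in> E' \<Longrightarrow> g e = g' e) \<Longrightarrow> F E' g = F E' g'"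
    and G: "\<And>E' g g'. E' \<subseteq> E \<Longrightarrow> g \<in> E' \<rightarrow> B \<Longrightarrow> (\<And>e. e \<in> E' \<Longrightarrow> g e = g' e) \<Longrightarrow> G E' g = G E' g'"
  shows "(\<Sum>E1\<in>Pow E. (\<Sum>g\<in>E1 \<rightarrow>\<^sub>E A. F E1 g) * (\<Sum>g\<in>(E - E1) \<rightarrow>\<^sub>E B. G (E - E1) g)) =
    (\<Sum>g\<in>E \<rightarrow>\<^sub>E A \<union> B. F {e \<in> E. g e \<in> A} g * G {e \<in> E. g e \<in> B} g)"
proof -
  let ?S = "SIGMA E1:Pow E. (E1 \<rightarrow>\<^sub>E A) \<times> ((E - E1) \<rightarrow>\<^sub>E B)"
  let ?merge = "\<lambda>(E1, g1, g2). \<lambda>e\<in>E. if e \<in> E1 then g1 e else g2 e"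
  let ?f = "\<lambda>(E1, g1, g2). F E1 g1 * G (E - E1) g2"
  have finP: "finite (E1 \<rightarrow>\<^sub>E A)" "finite ((E - E1) \<rightarrow>\<^sub>E B)" if "E1 \<in> Pow E" for E1
    using that fin by (auto intro!: finite_PiE intro: finite_subset[of _ E])
  have "(\<Sum>E1\<in>Pow E. (\<Sum>g\<in>E1 \<rightarrow>\<^sub>E A. F E1 g) * (\<Sum>g\<in>(E - E1) \<rightarrow>\<^sub>E B. G (E - E1) g)) =
      (\<Sum>E1\<in>Pow E. \<Sum>p\<in>(E1 \<rightarrow>\<^sub>E A) \<times> ((E - E1) \<rightarrow>\<^sub>E B). ?f (E1, p))"
    by (simp add: sum_product sum.cartesian_product case_prod_unfold)
  also have "\<dots> = (\<Sum>a\<in>?S. ?f a)"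
    using sum.Sigma[of "Pow E" "\<lambda>E1. (E1 \<rightarrow>\<^sub>E A) \<times> ((E - E1) \<rightarrow>\<^sub>E B)" "\<lambda>E1 p. ?f (E1, p)"] fin finP
    by (simp add: case_prod_unfold)
  also have "\<dots> = (\<Sum>g\<in>E \<rightarrow>\<^sub>E A \<union> B. F {e \<in> E. g e \<in> A} g * G {e \<in> E. g e \<in> B} g)"
  proof (rule sum.reindex_bij_witness[of _
        "\<lambda>g. ({e \<in> E. g e \<in> A}, restrict g {e \<in> E. g e \<in> A}, restrict g (E - {e \<in> E. g e \<in> A}))"
        "\<lambda>(E1, g1, g2). \<lambda>e\<in>E. if e \<in> E1 then g1 e else g2 e"])
    fix a assume "a \<in> ?S"
    then obtain E1 g1 g2 where a: "a = (E1, g1, g2)" and E1: "E1 \<subseteq> E"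
      and g1: "g1 \<in> E1 \<rightarrow>\<^sub>E A" and g2: "g2 \<in> (E - E1) \<rightarrow>\<^sub>E B" by auto
    define g where "g = (\<lambda>e\<in>E. if e \<in> E1 then g1 e else g2 e)"
    have gA: "g e = g1 e \<and> g e \<in> A" if "e \<in> E1" for e
      using that E1 PiE_mem[OF g1 that] by (auto simp: g_def)
    have gB: "g e = g2 e \<and> g e \<in> B" if "e \<in> E - E1" for e
      using that PiE_mem[OF g2 that] by (auto simp: g_def)
    have sets: "{e \<in> E. g e \<in> A} = E1" "{e \<in> E. g e \<in> B} = E - E1"
      using gA gB disj E1 by blast+
    have r: "restrict g E1 = g1" "restrict g (E - E1) = g2"
      using gA gB PiE_arb[OF g1] PiE_arb[OF g2] by (auto simp: restrict_def)
    have w: "(?merge a) = g"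
      by (simp add: a g_def)
    show "({e \<in> E. (?merge a) e \<in> A},
        restrict (?merge a)
          {e \<in> E. (?merge a) e \<in> A},
        restrict (?merge a)
          (E - {e \<in> E. (?merge a) e \<in> A})) = a"
      unfolding w sets r by (simp add: a)
    show "(?merge a) \<in> E \<rightarrow>\<^sub>E A \<union> B"
      unfolding w
    proof (rule PiE_I)
      show "g e \<in> A \<union> B" if "e \<in> E" for e using gA[of e] gB[of e] that by blast
    qed (simp add: g_def)
    have "F E1 g1 = F E1 g" "G (E - E1) g2 = G (E - E1) g"
      using gA gB g1 g2 E1 by (auto intro!: F G)
    then show "F {e \<in> E. (?merge a) e \<in> A}
          (?merge a) *
        G {e \<in> E. (?merge a) e \<in> B}
          (?merge a) = ?f a"
      unfolding w sets by (simp add: a)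
  next
    fix g assume g: "g \<in> E \<rightarrow>\<^sub>E A \<union> B"
    show "(case ({e \<in> E. g e \<in> A}, restrict g {e \<in> E. g e \<in> A}, restrict g (E - {e \<in> E. g e \<in> A}))
        of (E1, g1, g2) \<Rightarrow> \<lambda>e\<in>E. if e \<in> E1 then g1 e else g2 e) = g"
      using PiE_arb[OF g] by (auto simp: fun_eq_iff)
    show "({e \<in> E. g e \<in> A}, restrict g {e \<in> E. g e \<in> A}, restrict g (E - {e \<in> E. g e \<in> A})) \<in> ?S"
      using PiE_mem[OF g] by auto
  qed
  finally show ?thesis .
qed

text \<open>The possible arcs between two disjoint vertex sets in the direction allowed by the color.\<close>

definition crossing :: "'v set \<Rightarrow> 'v set \<Rightarrow> ('v \<times> 'v \<times> color) set" where
  "crossing V1 V2 = {a. crosses V1 V2 a}"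

lemma crossing_eq:
  "crossing V1 V2 = (\<lambda>(i, j). (i, j, Red)) ` (V1 \<times> V2) \<union> (\<lambda>(i, j). (j, i, Blue)) ` (V1 \<times> V2)"
proof (intro equalityI subsetI)
  fix a assume "a \<in> crossing V1 V2"
  then show "a \<in> (\<lambda>(i, j). (i, j, Red)) ` (V1 \<times> V2) \<union> (\<lambda>(i, j). (j, i, Blue)) ` (V1 \<times> V2)"
    by (cases a; cases "snd (snd a)") (auto simp: crossing_def crosses_def)
qed (auto simp: crossing_def crosses_def)

lemma crossing_subset: "V1 \<subseteq> V \<Longrightarrow> V2 \<subseteq> V \<Longrightarrow> crossing V1 V2 \<subseteq> V \<times> V \<times> UNIV"
  by (auto simp: crossing_eq)

text \<open>
  A contraction between two factors is an arc: for different times exactly one of the two step functions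
  is one, and the color records whether the later time belongs to the left or the right factor.
\<close>

lemma sum_crossing:
  assumes fin: "finite V1" "finite V2" and disj: "V1 \<inter> V2 = {}" and inj: "inj_on x (V1 \<union> V2)"
  shows "(\<Sum>a\<in>crossing V1 V2. arc_integrand f x a) = (\<Sum>i\<in>V1. \<Sum>j\<in>V2. W_contraction f (x i) (x j))"
proof -
  let ?R = "(\<lambda>(i, j). (i, j, Red)) ` (V1 \<times> V2)" and ?B = "(\<lambda>(i, j). (j, i, Blue)) ` (V1 \<times> V2)"
  have "(\<Sum>a\<in>crossing V1 V2. arc_integrand f x a) = (\<Sum>a\<in>?R. arc_integrand f x a) + (\<Sum>a\<in>?B. arc_integrand f x a)"
    unfolding crossing_eq using fin by (intro sum.union_disjoint) auto
  also have "(\<Sum>a\<in>?R. arc_integrand f x a) = (\<Sum>(i, j)\<in>V1 \<times> V2. W_contraction f (x i) (x j) * theta (x j - x i))"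
    by (subst sum.reindex) (auto simp: inj_on_def arc_integrand_def intro!: sum.cong)
  also have "(\<Sum>a\<in>?B. arc_integrand f x a) = (\<Sum>(i, j)\<in>V1 \<times> V2. W_contraction f (x i) (x j) * theta (x i - x j))"
    by (subst sum.reindex) (auto simp: inj_on_def arc_integrand_def intro!: sum.cong)
  also have "(\<Sum>(i, j)\<in>V1 \<times> V2. W_contraction f (x i) (x j) * theta (x j - x i)) +
      (\<Sum>(i, j)\<in>V1 \<times> V2. W_contraction f (x i) (x j) * theta (x i - x j)) =
    (\<Sum>(i, j)\<in>V1 \<times> V2. W_contraction f (x i) (x j))"
    unfolding sum.distrib[symmetric]
  proof (rule sum.cong[OF refl], clarify)
    fix i j assume ij: "i \<in> V1" "j \<in> V2"
    then have "x i \<noteq> x j" using inj disj by (auto dest: inj_onD)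
    then show "W_contraction f (x i) (x j) * theta (x j - x i) + W_contraction f (x i) (x j) * theta (x i - x j) =
        W_contraction f (x i) (x j)"
      by (auto simp: theta_def)
  qed
  finally show ?thesis by (simp add: sum.cartesian_product)
qed

lemma arcs_within_eq: "arcs_within V1 E g = {e \<in> E. g e \<in> V1 \<times> V1 \<times> UNIV}"
  by (auto simp: arcs_within_def mem_Times_iff)

text \<open>On graphs with all ends in \<open>V\<close>, independence of the values of \<open>g\<close> outside the arc set.\<close>

definition local_coeff :: "graph_coeff \<Rightarrow> bool" where
  "local_coeff c \<longleftrightarrow> (\<forall>V E g g'. finite V \<longrightarrow> finite E \<longrightarrow> g \<in> E \<rightarrow> V \<times> V \<times> UNIV \<longrightarrow>
     (\<forall>e\<in>E. g e = g' e) \<longrightarrow> c V E g = c V E g')"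

lemma local_coeffD:
  "local_coeff c \<Longrightarrow> finite V \<Longrightarrow> finite E \<Longrightarrow> g \<in> E \<rightarrow> V \<times> V \<times> UNIV \<Longrightarrow>
     (\<And>e. e \<in> E \<Longrightarrow> g e = g' e) \<Longrightarrow> c V E g = c V E g'"
  unfolding local_coeff_def
  by (drule spec[of _ V], drule spec[of _ E], drule spec[of _ g], drule spec[of _ g']) simp

text \<open>An arc that is allowed once the vertices \<open>V1\<close> have been split off from \<open>V\<close>.\<close>

definition split_arcs :: "'v set \<Rightarrow> 'v set \<Rightarrow> ('v \<times> 'v \<times> color) set" where
  "split_arcs V V1 = V1 \<times> V1 \<times> UNIV \<union> ((V - V1) \<times> (V - V1) \<times> UNIV \<union> crossing V1 (V - V1))"

text \<open>
  The coefficients of a star product: the left factor carries the vertices \<open>V1\<close> and the arcs within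
  them, the right factor the remaining vertices and the arcs within these, and the arcs in between come
  from contractions and must have the direction that their color allows.
\<close>

definition conv_coeff :: "graph_coeff \<Rightarrow> graph_coeff \<Rightarrow> graph_coeff" where
  "conv_coeff a c V E g = (\<Sum>V1\<in>Pow V. of_bool (g ` E \<subseteq> split_arcs V V1) *
     (a V1 (arcs_within V1 E g) g * c (V - V1) (arcs_within (V - V1) E g) g))"

lemma finite_arc_set: "finite V \<Longrightarrow> finite (V \<times> V \<times> (UNIV :: color set))"
  unfolding UNIV_color by auto

context drive
begin

lemma conv_graph_kernel:
  assumes a: "local_coeff a" and c: "local_coeff c" and fin: "finite V" "finite E" and inj: "inj_on x V"
  shows "conv (graph_kernel a) (graph_kernel c) V E x = graph_kernel (conv_coeff a c) V E x"
proof -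
  let ?w = "\<lambda>E g. \<Prod>e\<in>E. arc_integrand f x (g e)"
  have split: "(\<Sum>E1\<in>Pow E. \<Sum>E2\<in>Pow (E - E1).
      graph_kernel a V1 E1 x * graph_kernel c (V - V1) E2 x * Wsum V1 (V - V1) x ^ card (E - E1 - E2)) =
    (\<Sum>g\<in>labelled_graphs V E. of_bool (g ` E \<subseteq> split_arcs V V1) *
     (a V1 (arcs_within V1 E g) g * c (V - V1) (arcs_within (V - V1) E g) g) * ?w E g)"
    if V1: "V1 \<in> Pow V" for V1
  proof -
    let ?V2 = "V - V1"
    let ?X1 = "V1 \<times> V1 \<times> (UNIV :: color set)" and ?X2 = "?V2 \<times> ?V2 \<times> (UNIV :: color set)"
      and ?Y = "crossing V1 ?V2"
    have finV: "finite V1" "finite ?V2" using V1 fin finite_subset by auto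
    have X: "finite ?X1" "finite ?X2" using finV by (auto intro: finite_arc_set)
    have Y: "finite ?Y" unfolding crossing_eq using finV by auto
    have disj: "?X1 \<inter> (?X2 \<union> ?Y) = {}" "?X2 \<inter> ?Y = {}" by (auto simp: crossing_eq)
    have finE: "finite E'" if "E' \<subseteq> E" for E' using that fin finite_subset by auto
    define F where "F E' g = a V1 E' g * ?w E' g" for E' g
    define G where "G E' g = c ?V2 E' g * ?w E' g" for E' g
    define H where "H E' g = G {e \<in> E'. g e \<in> ?X2} g * ?w {e \<in> E'. g e \<in> ?Y} g" for E' g
    have F: "F E' g = F E' g'" if "E' \<subseteq> E" "g \<in> E' \<rightarrow> ?X1" "\<And>e. e \<in> E' \<Longrightarrow> g e = g' e" for E' g g'
      using local_coeffD[OF a finV(1) finE[OF that(1)] that(2,3)] that(3) by (simp add: F_def)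
    have G: "G E' g = G E' g'" if "E' \<subseteq> E" "g \<in> E' \<rightarrow> ?X2" "\<And>e. e \<in> E' \<Longrightarrow> g e = g' e" for E' g g'
      using local_coeffD[OF c finV(2) finE[OF that(1)] that(2,3)] that(3) by (simp add: G_def)
    have H: "H E' g = H E' g'" if "E' \<subseteq> E" "g \<in> E' \<rightarrow> ?X2 \<union> ?Y" "\<And>e. e \<in> E' \<Longrightarrow> g e = g' e" for E' g g'
    proof -
      have s: "{e \<in> E'. g e \<in> Z} = {e \<in> E'. g' e \<in> Z}" for Z using that(3) by auto
      have "G {e \<in> E'. g e \<in> ?X2} g = G {e \<in> E'. g e \<in> ?X2} g'"
        using that(1,3) by (intro G) auto
      moreover have "?w {e \<in> E'. g e \<in> ?Y} g = ?w {e \<in> E'. g e \<in> ?Y} g'"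
        using that(3) by (intro prod.cong) auto
      ultimately show ?thesis unfolding H_def by (simp only: s)
    qed
    have inner: "(\<Sum>E2\<in>Pow E'. graph_kernel c ?V2 E2 x * Wsum V1 ?V2 x ^ card (E' - E2)) =
        (\<Sum>g\<in>E' \<rightarrow>\<^sub>E ?X2 \<union> ?Y. H E' g)" if E': "E' \<subseteq> E" for E'
    proof -
      have "Wsum V1 ?V2 x ^ card (E' - E2) = (\<Sum>g\<in>(E' - E2) \<rightarrow>\<^sub>E ?Y. ?w (E' - E2) g)" for E2
      proof -
        have "Wsum V1 ?V2 x = (\<Sum>a\<in>?Y. arc_integrand f x a)"
          unfolding Wsum_def using finV V1 inj
          by (intro sum_crossing[symmetric]) (auto intro: inj_on_subset)
        then have "Wsum V1 ?V2 x ^ card (E' - E2) = (\<Prod>e\<in>E' - E2. \<Sum>a\<in>?Y. arc_integrand f x a)" by simp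
        also have "\<dots> = (\<Sum>g\<in>(E' - E2) \<rightarrow>\<^sub>E ?Y. ?w (E' - E2) g)"
          using finE[OF E'] Y by (intro prod_sum_PiE) auto
        finally show ?thesis .
      qed
      then have "(\<Sum>E2\<in>Pow E'. graph_kernel c ?V2 E2 x * Wsum V1 ?V2 x ^ card (E' - E2)) =
          (\<Sum>E2\<in>Pow E'. (\<Sum>g\<in>E2 \<rightarrow>\<^sub>E ?X2. G E2 g) * (\<Sum>g\<in>(E' - E2) \<rightarrow>\<^sub>E ?Y. ?w (E' - E2) g))"
        by (simp add: graph_kernel_def labelled_graphs_def G_def)
      also have "\<dots> = (\<Sum>g\<in>E' \<rightarrow>\<^sub>E ?X2 \<union> ?Y. G {e \<in> E'. g e \<in> ?X2} g * ?w {e \<in> E'. g e \<in> ?Y} g)"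
      proof (rule sum_PiE_split[OF finE[OF E'] X(2) Y disj(2)])
        fix D g g' assume "D \<subseteq> E'" "g \<in> D \<rightarrow> ?X2" "\<And>e. e \<in> D \<Longrightarrow> g e = g' e"
        then show "G D g = G D g'" using E' by (intro G) auto
      qed (auto intro: prod.cong)
      finally show ?thesis by (simp only: H_def)
    qed
    have "(\<Sum>E1\<in>Pow E. \<Sum>E2\<in>Pow (E - E1).
        graph_kernel a V1 E1 x * graph_kernel c ?V2 E2 x * Wsum V1 ?V2 x ^ card (E - E1 - E2)) =
      (\<Sum>E1\<in>Pow E. (\<Sum>g\<in>E1 \<rightarrow>\<^sub>E ?X1. F E1 g) * (\<Sum>g\<in>(E - E1) \<rightarrow>\<^sub>E ?X2 \<union> ?Y. H (E - E1) g))"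
    proof (rule sum.cong[OF refl])
      fix E1
      have "graph_kernel a V1 E1 x = (\<Sum>g\<in>E1 \<rightarrow>\<^sub>E ?X1. F E1 g)"
        by (simp add: graph_kernel_def labelled_graphs_def F_def)
      then show "(\<Sum>E2\<in>Pow (E - E1). graph_kernel a V1 E1 x * graph_kernel c ?V2 E2 x *
          Wsum V1 ?V2 x ^ card (E - E1 - E2)) =
        (\<Sum>g\<in>E1 \<rightarrow>\<^sub>E ?X1. F E1 g) * (\<Sum>g\<in>(E - E1) \<rightarrow>\<^sub>E ?X2 \<union> ?Y. H (E - E1) g)"
        unfolding inner[OF Diff_subset, symmetric] by (simp add: sum_distrib_left mult.assoc)
    qed
    also have "\<dots> = (\<Sum>g\<in>E \<rightarrow>\<^sub>E ?X1 \<union> (?X2 \<union> ?Y). F {e \<in> E. g e \<in> ?X1} g * H {e \<in> E. g e \<in> ?X2 \<union> ?Y} g)"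
      using X Y by (intro sum_PiE_split[OF fin(2) _ _ disj(1)] F H) auto
    also have "\<dots> = (\<Sum>g\<in>E \<rightarrow>\<^sub>E ?X1 \<union> (?X2 \<union> ?Y).
        (a V1 (arcs_within V1 E g) g * c ?V2 (arcs_within ?V2 E g) g) * ?w E g)"
    proof (rule sum.cong[OF refl])
      fix g assume g: "g \<in> E \<rightarrow>\<^sub>E ?X1 \<union> (?X2 \<union> ?Y)"
      let ?E1 = "{e \<in> E. g e \<in> ?X1}" and ?E2 = "{e \<in> E. g e \<in> ?X2}" and ?E3 = "{e \<in> E. g e \<in> ?Y}"
      have s: "{e \<in> {e \<in> E. g e \<in> ?X2 \<union> ?Y}. g e \<in> ?X2} = ?E2"
        "{e \<in> {e \<in> E. g e \<in> ?X2 \<union> ?Y}. g e \<in> ?Y} = ?E3" by auto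
      have E: "E = ?E1 \<union> (?E2 \<union> ?E3)" using PiE_mem[OF g] by blast
      have "?w (?E1 \<union> (?E2 \<union> ?E3)) g = ?w ?E1 g * (?w ?E2 g * ?w ?E3 g)"
      proof -
        have pre: "{e \<in> E. g e \<in> Z} \<inter> {e \<in> E. g e \<in> Z'} = {}" if "Z \<inter> Z' = {}" for Z Z'
          using that by blast
        have "?X1 \<inter> ?X2 = {}" "?X1 \<inter> ?Y = {}" using disj(1) unfolding Int_Un_distrib Un_empty by simp_all
        then have "?E1 \<inter> (?E2 \<union> ?E3) = {}" "?E2 \<inter> ?E3 = {}"
          unfolding Int_Un_distrib Un_empty using pre disj(2) by simp_all
        then show ?thesis using fin(2) by (simp add: prod.union_disjoint)
      qed
      then have w: "?w E g = ?w ?E1 g * (?w ?E2 g * ?w ?E3 g)" using E by metis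
      show "F ?E1 g * H {e \<in> E. g e \<in> ?X2 \<union> ?Y} g =
          (a V1 (arcs_within V1 E g) g * c ?V2 (arcs_within ?V2 E g) g) * ?w E g"
        unfolding w arcs_within_eq H_def s F_def G_def by (simp only: mult_ac)
    qed
    also have "\<dots> = (\<Sum>g\<in>labelled_graphs V E. of_bool (g ` E \<subseteq> split_arcs V V1) *
       (a V1 (arcs_within V1 E g) g * c ?V2 (arcs_within ?V2 E g) g) * ?w E g)"
    proof (rule sum.mono_neutral_cong_left)
      show "finite (labelled_graphs V E)" by (rule finite_labelled_graphs[OF fin])
      have "?X1 \<union> (?X2 \<union> ?Y) \<subseteq> V \<times> V \<times> UNIV" using V1 crossing_subset[of V1 V ?V2] by auto
      then show "(E \<rightarrow>\<^sub>E ?X1 \<union> (?X2 \<union> ?Y)) \<subseteq> labelled_graphs V E"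
        unfolding labelled_graphs_def by (intro PiE_mono)
      show "\<forall>g\<in>labelled_graphs V E - (E \<rightarrow>\<^sub>E ?X1 \<union> (?X2 \<union> ?Y)). of_bool (g ` E \<subseteq> split_arcs V V1) *
         (a V1 (arcs_within V1 E g) g * c ?V2 (arcs_within ?V2 E g) g) * ?w E g = 0"
      proof
        fix g assume g: "g \<in> labelled_graphs V E - (E \<rightarrow>\<^sub>E ?X1 \<union> (?X2 \<union> ?Y))"
        then have "\<not> g ` E \<subseteq> split_arcs V V1"
          unfolding labelled_graphs_def split_arcs_def PiE_def Pi_def by blast
        then show "of_bool (g ` E \<subseteq> split_arcs V V1) *
         (a V1 (arcs_within V1 E g) g * c ?V2 (arcs_within ?V2 E g) g) * ?w E g = 0" by simp
      qed
      fix g assume "g \<in> E \<rightarrow>\<^sub>E ?X1 \<union> (?X2 \<union> ?Y)"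
      then have "g ` E \<subseteq> split_arcs V V1" unfolding split_arcs_def by blast
      then show "(a V1 (arcs_within V1 E g) g * c ?V2 (arcs_within ?V2 E g) g) * ?w E g =
        of_bool (g ` E \<subseteq> split_arcs V V1) *
         (a V1 (arcs_within V1 E g) g * c ?V2 (arcs_within ?V2 E g) g) * ?w E g" by simp
    qed
    finally show ?thesis .
  qed
  have "conv (graph_kernel a) (graph_kernel c) V E x = (\<Sum>V1\<in>Pow V. \<Sum>g\<in>labelled_graphs V E.
      of_bool (g ` E \<subseteq> split_arcs V V1) *
     (a V1 (arcs_within V1 E g) g * c (V - V1) (arcs_within (V - V1) E g) g) * ?w E g)"
    unfolding conv_def by (intro sum.cong refl split)
  also have "\<dots> = graph_kernel (conv_coeff a c) V E x"
    unfolding graph_kernel_def conv_coeff_def sum_distrib_right by (rule sum.swap)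
  finally show ?thesis .
qed

end

text \<open>The coefficients of the star powers of \<^const>\<open>rb_coeff\<close>.\<close>

primrec power_coeff :: "nat \<Rightarrow> graph_coeff" where
  "power_coeff 0 = (\<lambda>V E g. of_bool (V = {} \<and> E = {}))"
| "power_coeff (Suc k) = conv_coeff rb_coeff (power_coeff k)"

lemma local_rb_coeff: "local_coeff rb_coeff"
  unfolding local_coeff_def rb_coeff_def
proof (intro allI impI)
  fix V E :: "nat set" and g g' :: "nat \<Rightarrow> nat \<times> nat \<times> color"
  assume fin: "finite V" "finite E" and g: "g \<in> E \<rightarrow> V \<times> V \<times> UNIV" and eq: "\<forall>e\<in>E. g e = g' e"
  have g': "g' \<in> E \<rightarrow> V \<times> V \<times> UNIV" using g eq by (auto simp: Pi_iff)
  have "is_rb_isomorphism id id (rb V E g) (rb V E g')" using eq by (auto simp: is_rb_isomorphism_def)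
  then have "omega_RB_c (rb V E g) = omega_RB_c (rb V E g')"
    by (rule omega_RB_c_iso[OF fin_digraph_rb[OF fin g] fin_digraph_rb[OF fin g']])
  then show "complex_of_real (omega_RB_c (rb V E g)) = of_real (omega_RB_c (rb V E g'))" by simp
qed

lemma local_conv_coeff:
  assumes a: "local_coeff a" and c: "local_coeff c"
  shows "local_coeff (conv_coeff a c)"
  unfolding local_coeff_def
proof (intro allI impI)
  fix V E :: "nat set" and g g' :: "nat \<Rightarrow> nat \<times> nat \<times> color"
  assume fin: "finite V" "finite E" and g: "g \<in> E \<rightarrow> V \<times> V \<times> UNIV" and eq: "\<forall>e\<in>E. g e = g' e"
  have img: "g ` E = g' ` E" using eq by auto
  show "conv_coeff a c V E g = conv_coeff a c V E g'"
    unfolding conv_coeff_def img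
  proof (intro sum.cong refl arg_cong2[where f = "(*)"])
    fix V1 assume V1: "V1 \<in> Pow V"
    have w: "arcs_within U E g = arcs_within U E g'" for U using eq by (auto simp: arcs_within_def)
    have p: "g \<in> arcs_within U E g' \<rightarrow> U \<times> U \<times> UNIV" for U
      unfolding w[symmetric] by (auto simp: arcs_within_eq)
    have finw: "finite (arcs_within U E g')" for U using fin by (simp add: arcs_within_def)
    have fV: "finite V1" "finite (V - V1)" using V1 fin finite_subset by auto
    show "a V1 (arcs_within V1 E g) g = a V1 (arcs_within V1 E g') g'"
      unfolding w by (rule local_coeffD[OF a fV(1) finw p]) (use eq in \<open>auto simp: arcs_within_def\<close>)
    show "c (V - V1) (arcs_within (V - V1) E g) g = c (V - V1) (arcs_within (V - V1) E g') g'"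
      unfolding w by (rule local_coeffD[OF c fV(2) finw p]) (use eq in \<open>auto simp: arcs_within_def\<close>)
  qed
qed

lemma local_power_coeff: "local_coeff (power_coeff k)"
proof (induction k)
  case 0
  show ?case by (simp add: local_coeff_def)
next
  case (Suc k)
  then show ?case using local_conv_coeff[OF local_rb_coeff] by simp
qed

lemma (in drive) conv_power_graph_kernel:
  assumes "finite V" "finite E" "inj_on x V"
  shows "conv_power (graph_kernel rb_coeff) k V E x = graph_kernel (power_coeff k) V E x"
  using assms
proof (induction k arbitrary: V E)
  case 0
  show ?case
  proof (cases "V = {} \<and> E = {}")
    case True
    then show ?thesis by (simp add: unit_kernel_def graph_kernel_def labelled_graphs_def)
  next
    case False
    then have "graph_kernel (\<lambda>V E g. of_bool (V = {} \<and> E = {})) V E x = 0"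
      unfolding graph_kernel_def by (intro sum.neutral) auto
    then show ?thesis using False by (auto simp: unit_kernel_def)
  qed
next
  case (Suc k)
  have "conv_power (graph_kernel rb_coeff) (Suc k) V E x =
      conv (graph_kernel rb_coeff) (graph_kernel (power_coeff k)) V E x"
    unfolding conv_power.simps conv_def
  proof (intro sum.cong refl)
    fix V1 E1 E2 assume s: "V1 \<in> Pow V" "E1 \<in> Pow E" "E2 \<in> Pow (E - E1)"
    then have "conv_power (graph_kernel rb_coeff) k (V - V1) E2 x = graph_kernel (power_coeff k) (V - V1) E2 x"
      using Suc.prems by (intro Suc.IH) (auto intro: inj_on_subset finite_subset[of _ E])
    then show "graph_kernel rb_coeff V1 E1 x * conv_power (graph_kernel rb_coeff) k (V - V1) E2 x *
        Wsum V1 (V - V1) x ^ card (E - E1 - E2) =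
      graph_kernel rb_coeff V1 E1 x * graph_kernel (power_coeff k) (V - V1) E2 x *
        Wsum V1 (V - V1) x ^ card (E - E1 - E2)" by simp
  qed
  also have "\<dots> = graph_kernel (power_coeff (Suc k)) V E x"
    using conv_graph_kernel[OF local_rb_coeff local_power_coeff Suc.prems]
    by simp
  finally show ?case .
qed

lemma omega_RB_c_empty: "omega_RB_c (rb {} E g) = 0"
  by (simp add: omega_RB_c_def omega_c_def Digraph_Component.connected_def strongly_connected_def
      mk_symmetric_def)

lemma arcs_within_arcs_within: "x \<subseteq> U \<Longrightarrow> arcs_within x (arcs_within U E g) g = arcs_within x E g"
  by (auto simp: arcs_within_def)

lemma partition_on_Cons:
  assumes "x \<notin> set xs"
  shows "partition_on V (set (x # xs)) \<longleftrightarrow> x \<subseteq> V \<and> x \<noteq> {} \<and> partition_on (V - x) (set xs)"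
proof
  assume P: "partition_on V (set (x # xs))"
  have "x \<inter> \<Union>(set xs) = {}"
  proof -
    have "x \<inter> y = {}" if "y \<in> set xs" for y
      using P that assms by (auto simp: partition_on_def disjoint_def)
    then show ?thesis by blast
  qed
  moreover have "V = x \<union> \<Union>(set xs)" using P by (auto simp: partition_on_def)
  moreover have "disjoint (set xs)" "{} \<notin> set xs" "x \<noteq> {}"
    using P by (auto simp: partition_on_def disjoint_def)
  ultimately show "x \<subseteq> V \<and> x \<noteq> {} \<and> partition_on (V - x) (set xs)"
    unfolding partition_on_def by blast
next
  assume P: "x \<subseteq> V \<and> x \<noteq> {} \<and> partition_on (V - x) (set xs)"
  then have U: "\<Union>(set xs) = V - x" "disjoint (set xs)" "{} \<notin> set xs" by (auto simp: partition_on_def)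
  have d: "x \<inter> y = {}" if "y \<in> set xs" for y using U(1) that by blast
  have "\<Union>(set (x # xs)) = V" using U(1) P by auto
  moreover have "disjoint (set (x # xs))" using U(2) d by (auto simp: disjoint_def)
  ultimately show "partition_on V (set (x # xs))" using U(3) P by (auto simp: partition_on_def)
qed

lemma compatible_blocks_Cons:
  assumes V1: "V1 \<subseteq> V" and P: "partition_on (V - V1) (set xs)" and g: "g \<in> E \<rightarrow> V \<times> V \<times> UNIV"
    and n: "V1 \<notin> set xs"
  shows "compatible_blocks E g (V1 # xs) \<longleftrightarrow>
    g ` E \<subseteq> split_arcs V V1 \<and> compatible_blocks (arcs_within (V - V1) E g) g xs"
proof -
  let ?V2 = "V - V1"
  have U: "\<Union>(set xs) = ?V2" using P by (simp add: partition_on_def)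
  then have sub: "y \<subseteq> ?V2" if "y \<in> set xs" for y using that by blast
  let ?in = "\<lambda>e x. fst (g e) \<in> x \<and> fst (snd (g e)) \<in> x"
  let ?cr = "\<lambda>e xs. \<exists>x y. x \<noteq> y \<and> (x, y) \<in> list_order xs \<and> crosses x y (g e)"
  have cr_sub: "crosses x y a \<Longrightarrow> y \<subseteq> y' \<Longrightarrow> crosses x y' a" for x y y' and a :: "'a \<times> 'a \<times> color"
    by (auto simp: crosses_def split: color.splits)
  have cr_ends: "crosses x y (g e) \<Longrightarrow> x \<subseteq> ?V2 \<Longrightarrow> y \<subseteq> ?V2 \<Longrightarrow> ?in e ?V2" for x y e
    by (auto simp: crosses_def split: color.splits)
  have cr_no: "crosses V1 y (g e) \<Longrightarrow> \<not> ?in e ?V2" for y e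
    by (auto simp: crosses_def split: color.splits)
  have cons: "((\<exists>x\<in>set (V1 # xs). ?in e x) \<or> ?cr e (V1 # xs)) \<longleftrightarrow>
     ?in e V1 \<or> (\<exists>y\<in>set xs. crosses V1 y (g e)) \<or> (\<exists>x\<in>set xs. ?in e x) \<or> ?cr e xs" for e
  proof -
    have cr: "?cr e (V1 # xs) \<longleftrightarrow> (\<exists>y\<in>set xs. crosses V1 y (g e)) \<or> ?cr e xs"
    proof
      assume "?cr e (V1 # xs)"
      then obtain x y where xy: "x \<noteq> y" "(x, y) \<in> list_order (V1 # xs)" "crosses x y (g e)" by blast
      then have "x = V1 \<and> y \<in> set xs \<or> (x, y) \<in> list_order xs" by auto
      then show "(\<exists>y\<in>set xs. crosses V1 y (g e)) \<or> ?cr e xs" using xy(1,3) by blast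
    next
      assume "(\<exists>y\<in>set xs. crosses V1 y (g e)) \<or> ?cr e xs"
      then show "?cr e (V1 # xs)"
      proof
        assume "\<exists>y\<in>set xs. crosses V1 y (g e)"
        then obtain y where "y \<in> set xs" "crosses V1 y (g e)" by blast
        moreover from this have "V1 \<noteq> y" "(V1, y) \<in> list_order (V1 # xs)" using n by auto
        ultimately show ?thesis by blast
      next
        assume "?cr e xs"
        then obtain x y where "x \<noteq> y" "(x, y) \<in> list_order (V1 # xs)" "crosses x y (g e)" by auto
        then show ?thesis by blast
      qed
    qed
    have "(\<exists>x\<in>set (V1 # xs). ?in e x) \<longleftrightarrow> ?in e V1 \<or> (\<exists>x\<in>set xs. ?in e x)" by simp
    then show ?thesis unfolding cr by (simp only: disj_ac)
  qed
  have cross: "(\<exists>y\<in>set xs. crosses V1 y (g e)) \<longleftrightarrow> crosses V1 ?V2 (g e)" for e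
  proof
    assume "crosses V1 ?V2 (g e)"
    then show "\<exists>y\<in>set xs. crosses V1 y (g e)"
      unfolding U[symmetric] by (cases "snd (snd (g e))") (auto simp: crosses_def)
  qed (use cr_sub sub in blast)
  have in2: "?in e ?V2" if "(\<exists>x\<in>set xs. ?in e x) \<or> ?cr e xs" for e
    using that
  proof
    assume "?cr e xs"
    then obtain x y where xy: "(x, y) \<in> list_order xs" "crosses x y (g e)" by blast
    then have "x \<in> set xs" "y \<in> set xs" using list_order_in_set by fast+
    then show ?thesis using cr_ends[OF xy(2) sub sub] by simp
  qed (use sub in blast)
  have split: "g e \<in> split_arcs V V1 \<longleftrightarrow> ?in e V1 \<or> ?in e ?V2 \<or> crosses V1 ?V2 (g e)" for e
    by (auto simp: split_arcs_def crossing_def mem_Times_iff)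
  show ?thesis
    unfolding compatible_blocks_def cons cross
  proof (intro iffI conjI ballI subsetI)
    assume L: "\<forall>e\<in>E. ?in e V1 \<or> crosses V1 ?V2 (g e) \<or> (\<exists>x\<in>set xs. ?in e x) \<or> ?cr e xs"
    {
      fix a assume "a \<in> g ` E"
      then obtain e where e: "e \<in> E" "a = g e" by blast
      then show "a \<in> split_arcs V V1" using L in2[of e] split[of e] by metis
    next
      fix e assume "e \<in> arcs_within ?V2 E g"
      then have e: "e \<in> E" "?in e ?V2" by (auto simp: arcs_within_def)
      have no: "\<not> ?in e V1" "\<not> crosses V1 ?V2 (g e)" using e(2) cr_no[of ?V2 e] by auto
      show "(\<exists>x\<in>set xs. ?in e x) \<or> ?cr e xs"
        using bspec[OF L e(1)] no by (elim disjE) (simp_all only: simp_thms)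
    }
  next
    assume R: "g ` E \<subseteq> split_arcs V V1 \<and> (\<forall>e\<in>arcs_within ?V2 E g. (\<exists>x\<in>set xs. ?in e x) \<or> ?cr e xs)"
    fix e assume e: "e \<in> E"
    then have "g e \<in> split_arcs V V1" using R by blast
    then have "?in e V1 \<or> ?in e ?V2 \<or> crosses V1 ?V2 (g e)" unfolding split .
    moreover have "(\<exists>x\<in>set xs. ?in e x) \<or> ?cr e xs" if "?in e ?V2"
    proof -
      have "e \<in> arcs_within ?V2 E g" using that e by (simp add: arcs_within_def)
      then show ?thesis using R by (simp only: Ball_def)
    qed
    ultimately show "?in e V1 \<or> crosses V1 ?V2 (g e) \<or> (\<exists>x\<in>set xs. ?in e x) \<or> ?cr e xs"
      by (elim disjE) (simp_all only: simp_thms)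
  qed
qed

text \<open>
  Splitting off one factor after the other expresses the coefficient of a star power as a sum over
  ordered partitions whose blocks are the vertex sets of the factors.
\<close>

lemma power_coeff_eq:
  assumes "finite V" "finite E" "g \<in> E \<rightarrow> V \<times> V \<times> UNIV"
  shows "power_coeff k V E g = (\<Sum>xs\<in>{xs \<in> ordered_partitions V. length xs = k}.
     of_bool (compatible_blocks E g xs) * (\<Prod>x\<in>set xs. of_real (omega_RB_c (rb x (arcs_within x E g) g))))"
  using assms
proof (induction k arbitrary: V E)
  case 0
  have "{xs \<in> ordered_partitions V. length xs = 0} = (if V = {} then {[]} else {})"
    by (auto simp: ordered_partitions_def partition_on_def)
  moreover have "compatible_blocks E g [] \<longleftrightarrow> E = {}" by (auto simp: compatible_blocks_def)
  ultimately show ?case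
    by (simp del: sum_of_bool_mult_eq sum_mult_of_bool_eq sum_of_bool_eq)
next
  case (Suc k)
  let ?a = "\<lambda>x E. complex_of_real (omega_RB_c (rb x (arcs_within x E g) g))"
  let ?O = "\<lambda>V k. {xs \<in> ordered_partitions V. length xs = k}"
  have finO: "finite (?O V' k)" if "V' \<subseteq> V" for V' k
    using finite_ordered_partitions[OF finite_subset[OF that Suc.prems(1)]] by simp
  have "power_coeff (Suc k) V E g = (\<Sum>V1\<in>Pow V - {{}}. of_bool (g ` E \<subseteq> split_arcs V V1) *
     (?a V1 E * power_coeff k (V - V1) (arcs_within (V - V1) E g) g))"
    unfolding power_coeff.simps conv_coeff_def rb_coeff_def
    using Suc.prems(1) by (intro sum.mono_neutral_right) (auto simp: omega_RB_c_empty)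
  also have "\<dots> = (\<Sum>V1\<in>Pow V - {{}}. \<Sum>xs\<in>?O (V - V1) k. of_bool (compatible_blocks E g (V1 # xs)) *
      (\<Prod>x\<in>set (V1 # xs). ?a x E))"
  proof (rule sum.cong[OF refl])
    fix V1 assume V1: "V1 \<in> Pow V - {{}}"
    let ?E2 = "arcs_within (V - V1) E g"
    have IH: "power_coeff k (V - V1) ?E2 g = (\<Sum>xs\<in>?O (V - V1) k.
        of_bool (compatible_blocks ?E2 g xs) * (\<Prod>x\<in>set xs. ?a x ?E2))"
      using Suc.prems by (intro Suc.IH) (auto simp: arcs_within_eq)
    show "of_bool (g ` E \<subseteq> split_arcs V V1) * (?a V1 E * power_coeff k (V - V1) ?E2 g) =
      (\<Sum>xs\<in>?O (V - V1) k. of_bool (compatible_blocks E g (V1 # xs)) * (\<Prod>x\<in>set (V1 # xs). ?a x E))"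
      unfolding IH sum_distrib_left
    proof (rule sum.cong[OF refl])
      fix xs assume "xs \<in> ?O (V - V1) k"
      then have xs: "partition_on (V - V1) (set xs)" by (simp add: ordered_partitions_def)
      have sub: "x \<subseteq> V - V1" if "x \<in> set xs" for x using xs that by (auto simp: partition_on_def)
      have n: "V1 \<notin> set xs" using sub[of V1] V1 by blast
      have p: "(\<Prod>x\<in>set xs. ?a x ?E2) = (\<Prod>x\<in>set xs. ?a x E)"
        by (intro prod.cong refl) (simp add: arcs_within_arcs_within[OF sub])
      have "compatible_blocks E g (V1 # xs) \<longleftrightarrow> g ` E \<subseteq> split_arcs V V1 \<and> compatible_blocks ?E2 g xs"
        by (rule compatible_blocks_Cons[OF _ xs Suc.prems(3) n]) (use V1 in auto)
      moreover have "(\<Prod>x\<in>set (V1 # xs). ?a x E) = ?a V1 E * (\<Prod>x\<in>set xs. ?a x E)" using n by simp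
      ultimately show "of_bool (g ` E \<subseteq> split_arcs V V1) *
          (?a V1 E * (of_bool (compatible_blocks ?E2 g xs) * (\<Prod>x\<in>set xs. ?a x ?E2))) =
        of_bool (compatible_blocks E g (V1 # xs)) * (\<Prod>x\<in>set (V1 # xs). ?a x E)"
        unfolding p by (simp add: of_bool_conj mult_ac)
    qed
  qed
  also have "\<dots> = (\<Sum>(V1, xs)\<in>(SIGMA V1:Pow V - {{}}. ?O (V - V1) k).
      of_bool (compatible_blocks E g (V1 # xs)) * (\<Prod>x\<in>set (V1 # xs). ?a x E))"
    using Suc.prems(1) finO by (intro sum.Sigma) auto
  also have "\<dots> = (\<Sum>xs\<in>?O V (Suc k). of_bool (compatible_blocks E g xs) * (\<Prod>x\<in>set xs. ?a x E))"
  proof (rule sum.reindex_bij_witness[of _ "\<lambda>xs. (hd xs, tl xs)" "\<lambda>(V1, xs). V1 # xs"])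
    fix p assume "p \<in> (SIGMA V1:Pow V - {{}}. ?O (V - V1) k)"
    then obtain V1 xs where p: "p = (V1, xs)" "V1 \<subseteq> V" "V1 \<noteq> {}" "distinct xs"
      "partition_on (V - V1) (set xs)" "length xs = k"
      by (auto simp: ordered_partitions_def)
    have n: "V1 \<notin> set xs" using p(2,3,5) by (auto simp: partition_on_def)
    show "(case p of (V1, xs) \<Rightarrow> V1 # xs) \<in> ?O V (Suc k)"
      using p n partition_on_Cons[OF n, of V] by (simp add: ordered_partitions_def)
    show "(hd (case p of (V1, xs) \<Rightarrow> V1 # xs), tl (case p of (V1, xs) \<Rightarrow> V1 # xs)) = p"
      by (simp add: p)
    show "of_bool (compatible_blocks E g (case p of (V1, xs) \<Rightarrow> V1 # xs)) *
        (\<Prod>x\<in>set (case p of (V1, xs) \<Rightarrow> V1 # xs). ?a x E) =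
      (case p of (V1, xs) \<Rightarrow> of_bool (compatible_blocks E g (V1 # xs)) * (\<Prod>x\<in>set (V1 # xs). ?a x E))"
      by (simp only: p prod.case)
  next
    fix xs assume "xs \<in> ?O V (Suc k)"
    then obtain V1 ys where xs: "xs = V1 # ys" "V1 \<notin> set ys" "distinct ys" "partition_on V (set (V1 # ys))" "length ys = k"
      by (auto simp: ordered_partitions_def length_Suc_conv)
    show "(case (hd xs, tl xs) of (V1, xs) \<Rightarrow> V1 # xs) = xs" by (simp add: xs(1))
    show "(hd xs, tl xs) \<in> (SIGMA V1:Pow V - {{}}. ?O (V - V1) k)"
      using xs partition_on_Cons[OF xs(2), of V] by (simp add: ordered_partitions_def)
  qed
  finally show ?case .
qed

lemma card_partition_le:
  assumes "finite V" "partition_on V P"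
  shows "card P \<le> card V"
proof -
  have pick: "(SOME v. v \<in> p) \<in> p" if "p \<in> P" for p
    using assms(2) that by (metis all_not_in_conv partition_on_def someI)
  have "inj_on (\<lambda>p. SOME v. v \<in> p) P"
  proof (rule inj_onI)
    fix p q assume pq: "p \<in> P" "q \<in> P" "(SOME v. v \<in> p) = (SOME v. v \<in> q)"
    then show "p = q" using pick[of p] pick[of q] assms(2) by (auto simp: partition_on_def disjoint_def)
  qed
  moreover have "(\<lambda>p. SOME v. v \<in> p) ` P \<subseteq> V"
    using pick assms(2) by (auto simp: partition_on_def)
  ultimately show ?thesis using assms(1) by (metis card_inj_on_le)
qed

text \<open>In the star exponential exactly the blue graphs survive, each with coefficient one.\<close>

lemma sum_power_coeff:
  assumes fin: "finite V" "finite E" and g: "g \<in> E \<rightarrow> V \<times> V \<times> UNIV"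
  shows "(\<Sum>k\<le>card V. 1 / fact k * power_coeff k V E g) = of_bool (\<forall>e\<in>E. snd (snd (g e)) = Blue)"
proof -
  interpret finite_rb V E g by unfold_locales (fact fin g)+
  let ?r = "\<lambda>xs. of_bool (compatible_blocks E g xs) *
      (\<Prod>x\<in>set xs. omega_RB_c (rb x (arcs_within x E g) g)) / fact (length xs)"
  have "(\<Sum>k\<le>card V. 1 / fact k * power_coeff k V E g) =
      (\<Sum>k\<in>{..card V}. \<Sum>xs\<in>{xs \<in> ordered_partitions V. length xs = k}. complex_of_real (?r xs))"
    unfolding power_coeff_eq[OF fin g] sum_distrib_left
    by (intro sum.cong refl) simp
  also have "\<dots> = (\<Sum>xs\<in>ordered_partitions V. complex_of_real (?r xs))"
  proof (rule sum.group)
    show "length ` ordered_partitions V \<subseteq> {..card V}"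
      using card_partition_le[OF fin(1)] by (auto simp: ordered_partitions_def distinct_card[symmetric])
  qed (auto intro: finite_ordered_partitions fin)
  also have "\<dots> = complex_of_real (\<Sum>xs\<in>ordered_partitions V. ?r xs)" by simp
  also have "\<dots> = of_bool (\<forall>e\<in>E. snd (snd (g e)) = Blue)"
    unfolding sum_ordered_partitions by simp
  finally show ?thesis .
qed

context drive
begin

lemma exp_kernel_eq_dyson_kernel:
  assumes fin: "finite V" "finite E" and inj: "inj_on x V"
  shows "(\<Sum>k\<le>card V. 1 / fact k * conv_power (graph_kernel rb_coeff) k V E x) = dyson_kernel V E x"
proof -
  let ?w = "\<lambda>g. \<Prod>e\<in>E. arc_integrand f x (g e)"
  let ?B = "V \<times> V \<times> {Blue}"
  have "(\<Sum>k\<le>card V. 1 / fact k * conv_power (graph_kernel rb_coeff) k V E x) =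
      (\<Sum>k\<le>card V. \<Sum>g\<in>labelled_graphs V E. 1 / fact k * power_coeff k V E g * ?w g)"
    by (simp add: conv_power_graph_kernel[OF fin inj] graph_kernel_def sum_distrib_left mult.assoc)
  also have "\<dots> = (\<Sum>g\<in>labelled_graphs V E. (\<Sum>k\<le>card V. 1 / fact k * power_coeff k V E g) * ?w g)"
    unfolding sum_distrib_right by (rule sum.swap)
  also have "\<dots> = (\<Sum>g\<in>labelled_graphs V E. of_bool (\<forall>e\<in>E. snd (snd (g e)) = Blue) * ?w g)"
    by (intro sum.cong refl) (simp only: sum_power_coeff[OF fin labelled_graphs_Pi])
  also have "\<dots> = (\<Sum>g\<in>E \<rightarrow>\<^sub>E ?B. ?w g)"
  proof (rule sum.mono_neutral_cong_right)
    show "finite (labelled_graphs V E)" by (rule finite_labelled_graphs[OF fin])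
    show "(E \<rightarrow>\<^sub>E ?B) \<subseteq> labelled_graphs V E"
      unfolding labelled_graphs_def by (intro PiE_mono) auto
    show "\<forall>g\<in>labelled_graphs V E - (E \<rightarrow>\<^sub>E ?B). of_bool (\<forall>e\<in>E. snd (snd (g e)) = Blue) * ?w g = 0"
    proof
      fix g assume g: "g \<in> labelled_graphs V E - (E \<rightarrow>\<^sub>E ?B)"
      have "\<not> (\<forall>e\<in>E. snd (snd (g e)) = Blue)"
      proof
        assume "\<forall>e\<in>E. snd (snd (g e)) = Blue"
        then have "g \<in> E \<rightarrow>\<^sub>E ?B"
          using g by (auto simp: labelled_graphs_def PiE_iff mem_Times_iff)
        then show False using g by blast
      qed
      then show "of_bool (\<forall>e\<in>E. snd (snd (g e)) = Blue) * ?w g = 0" by simp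
    qed
    fix g assume "g \<in> E \<rightarrow>\<^sub>E ?B"
    then have "\<forall>e\<in>E. snd (snd (g e)) = Blue" by (auto simp: PiE_iff mem_Times_iff)
    then show "of_bool (\<forall>e\<in>E. snd (snd (g e)) = Blue) * ?w g = ?w g" by simp
  qed
  also have "\<dots> = (\<Prod>e\<in>E. \<Sum>a\<in>?B. arc_integrand f x a)"
    using fin by (intro prod_sum_PiE[symmetric]) auto
  also have "(\<Sum>a\<in>?B. arc_integrand f x a) = (\<Sum>(j, i)\<in>V \<times> V. W_contraction f (x i) (x j) * theta (x i - x j))"
    by (rule sum.reindex_bij_witness[of _ "\<lambda>(j, i). (j, i, Blue)" "\<lambda>(j, i, k). (j, i)"])
       (auto simp: arc_integrand_def)
  also have "\<dots> = (\<Sum>i\<in>V. \<Sum>j\<in>V. W_contraction f (x i) (x j) * theta (x i - x j))"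
    by (subst sum.cartesian_product[symmetric], rule sum.swap)
  finally show ?thesis by (simp add: dyson_kernel_def)
qed

theorem exp_star_Omega_RB: "exp_star (Omega_RB f t) = Dyson f t"
proof (rule fps_ext, rule fps_ext)
  fix n m :: nat
  have "Sym {..<n} (\<lambda>x. \<Sum>k\<le>n. 1 / fact k * conv_power (graph_kernel rb_coeff) k {..<n} {..<m} x) =
      Sym {..<n} (dyson_kernel {..<n} {..<m})"
  proof (rule Sym_cong)
    show "tame f {..<n} (\<lambda>x. \<Sum>k\<le>n. 1 / fact k * conv_power (graph_kernel rb_coeff) k {..<n} {..<m} x)"
      by (intro tame_sum tame_mult tame_const good_kernel_tame good_conv_power good_rb_kernel) auto
    show "tame f {..<n} (dyson_kernel {..<n} {..<m})"
      by (intro good_kernel_tame good_dyson_kernel) auto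
    fix x :: "nat \<Rightarrow> real" assume "inj_on x {..<n}"
    then show "(\<Sum>k\<le>n. 1 / fact k * conv_power (graph_kernel rb_coeff) k {..<n} {..<m} x) =
        dyson_kernel {..<n} {..<m} x"
      using exp_kernel_eq_dyson_kernel[of "{..<n}" "{..<m}" x] by simp
  qed simp
  then show "exp_star (Omega_RB f t) $ n $ m = Dyson f t $ n $ m"
    by (simp only: Omega_RB_eq_ser Dyson_eq_ser exp_star_ser[OF good_rb_kernel] ser_nth)
qed

lemma Omega_RB_nth_0: "Omega_RB f t $ 0 = 0"
proof (rule fps_ext)
  fix m
  have "graph_kernel rb_coeff {..<0} {..<m} = (\<lambda>x. 0)"
    by (rule ext) (simp add: graph_kernel_def rb_coeff_def omega_RB_c_empty)
  moreover have "Sym {..<0 :: nat} (\<lambda>x. 0) = 0"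
    using Sym_scale[of "{..<0 :: nat}" 0 "\<lambda>_. 0"] by (simp only: sconst_0 mult_zero_left)
  ultimately show "Omega_RB f t $ 0 $ m = 0 $ m"
    by (simp only: Omega_RB_eq_ser ser_nth) simp
qed

end

section \<open>Restriction to the time interval\<close>

lemma symbol_integral_cong:
  assumes "S \<in> sets M" "\<And>x. x \<in> S \<Longrightarrow> F x = G x"
  shows "symbol_integral M S F = symbol_integral M S G"
  using assms by (auto simp: symbol_integral_def fps_eq_iff intro!: set_lebesgue_integral_cong)

lemma I_color_cong:
  assumes fin: "fin_digraph (fst H)" and eq: "\<And>s. s \<in> {0..t} \<Longrightarrow> f s = f' s"
  shows "I_color f t H = I_color f' t H"
  unfolding I_color_def Let_def
proof (rule symbol_integral_cong)
  show "(\<Pi>\<^sub>E v\<in>verts (fst H). {0..t}) \<in> sets (\<Pi>\<^sub>M v\<in>verts (fst H). lborel)"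
    using fin by (intro sets_PiM_I_finite) (auto simp: fin_digraph_iff)
  fix x assume x: "x \<in> (\<Pi>\<^sub>E v\<in>verts (fst H). {0..t})"
  have v: "f (x v) = f' (x v)" if "v \<in> verts (fst H)" for v using PiE_mem[OF x that] by (rule eq)
  have "f (x (tail (fst H) e)) = f' (x (tail (fst H) e)) \<and> f (x (head (fst H) e)) = f' (x (head (fst H) e))"
    if "e \<in> arcs_of_color k H" for e k
    using that fin v by (auto simp: arcs_of_color_def fin_digraph_iff)
  then show "sconst (\<Prod>e\<in>arcs_of_color Blue H. W_contraction f (x (head (fst H) e)) (x (tail (fst H) e)) *
        theta (x (head (fst H) e) - x (tail (fst H) e))) *
      sconst (\<Prod>e\<in>arcs_of_color Red H. W_contraction f (x (tail (fst H) e)) (x (head (fst H) e)) *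
        theta (x (head (fst H) e) - x (tail (fst H) e))) * (\<Prod>v\<in>verts (fst H). A_symbol f (x v)) =
      sconst (\<Prod>e\<in>arcs_of_color Blue H. W_contraction f' (x (head (fst H) e)) (x (tail (fst H) e)) *
        theta (x (head (fst H) e) - x (tail (fst H) e))) *
      sconst (\<Prod>e\<in>arcs_of_color Red H. W_contraction f' (x (tail (fst H) e)) (x (head (fst H) e)) *
        theta (x (head (fst H) e) - x (tail (fst H) e))) * (\<Prod>v\<in>verts (fst H). A_symbol f' (x v))"
    using v by (simp add: W_contraction_def A_symbol_def cong: prod.cong)
qed

lemma Omega_RB_cong:
  assumes "\<And>s. s \<in> {0..t} \<Longrightarrow> f s = f' s"
  shows "Omega_RB f t = Omega_RB f' t"
proof -
  have "I_color f t (SOME H. H \<in> C) = I_color f' t (SOME H. H \<in> C)" if "C \<in> rb_classes n m" for C n m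
  proof (rule I_color_cong[OF _ assms])
    from that obtain H where H: "fin_digraph (fst H)" "C = rb_iso `` {H}"
      by (auto simp: rb_classes_def quotient_def)
    then have "H \<in> C" using equiv_class_self[OF equiv_rb_iso] by simp
    then have "(SOME H. H \<in> C) \<in> C" by (rule someI)
    then show "fin_digraph (fst (SOME H. H \<in> C))" using H(2) by (auto simp: rb_iso_def)
  qed
  then show ?thesis by (simp add: Omega_RB_def Let_def cong: sum.cong)
qed

lemma Dyson_cong:
  assumes "\<And>s. s \<in> {0..t} \<Longrightarrow> f s = f' s"
  shows "Dyson f t = Dyson f' t"
proof -
  have "symbol_integral (\<Pi>\<^sub>M i\<in>{1..n}. lborel) (time_ordered t n)
       (\<lambda>x. foldr (\<star>) (map (\<lambda>i. fps_const (A_symbol f (x i))) [1..<n + 1]) 1 $ m) =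
      symbol_integral (\<Pi>\<^sub>M i\<in>{1..n}. lborel) (time_ordered t n)
       (\<lambda>x. foldr (\<star>) (map (\<lambda>i. fps_const (A_symbol f' (x i))) [1..<n + 1]) 1 $ m)" if "n \<noteq> 0" for n m
  proof (rule symbol_integral_cong)
    show "time_ordered t n \<in> sets (\<Pi>\<^sub>M i\<in>{1..n}. lborel)" using that by (intro time_ordered_sets) simp
    fix x assume x: "x \<in> time_ordered t n"
    have "map (\<lambda>i. fps_const (A_symbol f (x i))) [1..<n + 1] = map (\<lambda>i. fps_const (A_symbol f' (x i))) [1..<n + 1]"
    proof (rule map_cong[OF refl])
      fix i assume "i \<in> set [1..<n + 1]"
      then have "i \<in> {1..n}" by auto
      then have "f (x i) = f' (x i)" using time_ordered_bounds[OF x, of i] by (intro assms) auto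
      then show "fps_const (A_symbol f (x i)) = fps_const (A_symbol f' (x i))" by (simp add: A_symbol_def)
    qed
    then show "foldr (\<star>) (map (\<lambda>i. fps_const (A_symbol f (x i))) [1..<n + 1]) 1 $ m =
      foldr (\<star>) (map (\<lambda>i. fps_const (A_symbol f' (x i))) [1..<n + 1]) 1 $ m" by (simp only:)
  qed
  then show ?thesis unfolding Dyson_def by (intro arg_cong[of _ _ Abs_fps] ext) auto
qed

theorem theorem8p7:
  fixes f :: "real \<Rightarrow> complex" and t :: real
  assumes "0 \<le> t"
    and "\<And>j k. set_integrable lborel {0..t} (\<lambda>s. f s ^ j * cnj (f s) ^ k)"
  shows "exp_star (Omega_RB f t) = Dyson f t \<and> Omega_RB f t = Magnusian f t"
proof -
  \<comment> \<open>only the values of \<open>f\<close> on \<open>[0,t]\<close> enter, and the hypothesis makes \<open>f\<close> measurable only there\<close>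
  define f' where "f' s = indicat_real {0..t} s *\<^sub>R f s" for s
  have eq: "f s = f' s" if "s \<in> {0..t}" for s using that by (simp add: f'_def)
  have int: "set_integrable lborel {0..t} (\<lambda>s. f s ^ j)" for j
    using assms(2)[of j 0] by simp
  interpret drive f' t
  proof
    have "f' \<in> borel_measurable lborel"
      using int[of 1] unfolding set_integrable_def f'_def[abs_def] by (simp add: borel_measurable_integrable)
    then show "f' \<in> borel_measurable borel" by simp
    fix k
    have "integrable lborel (\<lambda>s. norm (indicat_real {0..t} s *\<^sub>R f s ^ k))"
      using int[of k] unfolding set_integrable_def by (rule integrable_norm)
    also have "(\<lambda>s. norm (indicat_real {0..t} s *\<^sub>R f s ^ k)) = (\<lambda>s. indicat_real {0..t} s *\<^sub>R norm (f' s) ^ k)"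
      by (auto simp: f'_def indicator_def norm_power)
    finally show "set_integrable lborel {0..t} (\<lambda>s. norm (f' s) ^ k)"
      by (simp add: set_integrable_def)
  qed
  have Om: "Omega_RB f t = Omega_RB f' t" and Dy: "Dyson f t = Dyson f' t"
    using Omega_RB_cong[of t f f'] Dyson_cong[of t f f'] eq by auto
  have exp: "exp_star (Omega_RB f t) = Dyson f t"
    unfolding Om Dy by (rule exp_star_Omega_RB)
  moreover have "Omega_RB f t = Magnusian f t"
    unfolding Magnusian_def exp[symmetric] Om using log_star_exp_star[OF Omega_RB_nth_0] by simp
  ultimately show ?thesis ..
qed

end
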